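(* Let the data $(Y,X)$ (with $Y_{-q+1},\dots,Y_0$) be fixed. Suppose $C$ is symmetric positive definite and at least one of the following two sets of conditions holds: (1) $D$ is symmetric positive definite, $X$ has full column rank, $n+a>2r+p$, and the prior $f(\alpha)$ is proper; (2) $[Y,Z,X]\in\mathbb{R}^{n\times(r+qr+p)}$ has full column rank, $n+a>(2+q)r+p$, and the prior $f(\alpha)$ is bounded. Then the transition kernels $K_C$, $K_G$ and $K_{\mathcal{A}}$ are geometrically ergodic.
   Context: Setting. Let $n,p,q,r$ be positive integers with $n>p$. The data are $Y_t\in\mathbb{R}^r$, $X_t\in\mathbb{R}^p$, $t=1,\dots,n$, together with known non-stochastic starting values $Y_{-q+1},\dots,Y_0\in\mathbb{R}^r$. Put $Y=[Y_1,\dots,Y_n]^{\mathsf T}\in\mathbb{R}^{n\times r}$, $X=[X_1,\dots,X_n]^{\mathsf T}\in\mathbb{R}^{n\times p}$, $Z_t=[Y_{t-1}^{\mathsf T},\dots,Y_{t-q}^{\mathsf T}]^{\mathsf T}\in\mathbb{R}^{qr}$, $Z=[Z_1,\dots,Z_n]^{\mathsf T}\in\mathbb{R}^{n\times qr}$. Parameters: $\mathcal{A}\in\mathbb{R}^{qr\times r}$ with $\alpha=\operatorname{vec}(\mathcal{A})\in\mathbb{R}^{qr^2}$ (column stacking; $\alpha$ and $\mathcal A$ are identified), $\mathcal{B}\in\mathbb{R}^{p\times r}$, and $\Sigma\in\mathbb{S}^r_{++}$, the $r\times r$ symmetric positive definite matrices; $\theta=(\alpha,\mathcal{B},\Sigma)\in\Theta=\mathbb{R}^{qr^2}\times\mathbb{R}^{p\times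 r}\times\mathbb{S}^r_{++}$. The likelihood is $$f(Y\mid X,\mathcal{A},\mathcal{B},\Sigma)=(2\pi)^{-nr/2}|\Sigma|^{-n/2}\exp\left(-\tfrac12\operatorname{tr}[\Sigma^{-1}(Y-Z\mathcal{A}-X\mathcal{B})^{\mathsf T}(Y-Z\mathcal{A}-X\mathcal{B})]\right).$$ The prior is $f(\theta)=f(\alpha)f(\mathcal{B})f(\Sigma)$ with $f(\alpha)\propto\exp(-\tfrac12(\alpha-m)^{\mathsf T}C(\alpha-m))$, $f(\mathcal{B})\propto1$, $f(\Sigma)\propto|\Sigma|^{-a/2}\exp(-\tfrac12\operatorname{tr}[D\Sigma^{-1}])$, with hyperparameters $m\in\mathbb{R}^{qr^2}$, $C\in\mathbb{R}^{qr^2\times qr^2}$ and $D\in\mathbb{R}^{r\times r}$ symmetric positive semi-definite, and $a\ge0$. The posterior $F(\cdot\mid Y,X)$ has density $f(\alpha,\mathcal{B},\Sigma\mid Y,X)$ proportional to likelihood times prior; $F_{\mathcal{A},\Sigma}(\cdot\mid Y,X)$ and $F_{\mathcal{A}}(\cdot\mid Y,X)$ are its marginals for $(\alpha,\Sigma)$ and $\alpha$. Conditional densities such as $f(\Sigma\mid\alpha,Y,X)$, $f(\alpha\mid\Sigma,Y,X)$ and $f(\mathcal{B}\mid\alpha,\Sigma,Y,X)$ are those derived from the posterior (unlisted parameters integrated out). Kernels. For measurable $A$ and current points marked with primes, $K_C(\theta',A)=\iiint I_A(\alpha,\mathcal{B},\Sigma)f(\Sigma\mid\alpha',Y,X)f(\alpha\mid\Sigma,Y,X)f(\mathcal{B}\mid\alpha,\Sigma,Y,X)\,d\Sigma\,d\alpha\,d\mathcal{B}$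 on $\Theta$ (collapsed Gibbs sampler); $K_G((\alpha',\Sigma'),A)=\iint I_A(\alpha,\Sigma)f(\alpha\mid\Sigma,Y,X)f(\Sigma\mid\alpha',Y,X)\,d\alpha\,d\Sigma$ on $\mathbb{R}^{qr^2}\times\mathbb{S}^r_{++}$; $K_{\mathcal{A}}(\alpha',A)=\iint I_A(\alpha)f(\alpha\mid\Sigma,Y,X)f(\Sigma\mid\alpha',Y,X)\,d\Sigma\,d\alpha$ on $\mathbb{R}^{qr^2}$. Their invariant distributions are $F$, $F_{\mathcal{A},\Sigma}$ and $F_{\mathcal{A}}$ (given $Y,X$), respectively. A kernel $K$ on a state space $\mathsf{S}$ with invariant distribution $\pi$ is geometrically ergodic if there exist $\rho\in[0,1)$ and $M:\mathsf{S}\to[0,\infty)$ such that $\|K^h(x,\cdot)-\pi\|_{TV}\le M(x)\rho^h$ for all $x\in\mathsf{S}$ and $h\in\{1,2,\dots\}$, where $K^h$ is the $h$-step kernel and $\|\cdot\|_{TV}$ the total variation norm. *)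

theory Defs
  imports "HOL-Probability.Probability"
begin

section \<open>Matrices\<close>

type_synonym 'k rvec = "(real, 'k) vec"
type_synonym ('i, 'j) rmat = "((real, 'j) vec, 'i) vec"  \<comment> \<open>rows \<open>'i\<close>, columns \<open>'j\<close>\<close>

definition sym_pos_def :: "real^'k^'k \<Rightarrow> bool" where
  "sym_pos_def M \<longleftrightarrow> transpose M = M \<and> (\<forall>x. x \<noteq> 0 \<longrightarrow> x \<bullet> (M *v x) > 0)"

definition sym_pos_semidef :: "real^'k^'k \<Rightarrow> bool" where
  "sym_pos_semidef M \<longleftrightarrow> transpose M = M \<and> (\<forall>x. x \<bullet> (M *v x) \<ge> 0)"

definition full_column_rank :: "real^'c^'n \<Rightarrow> bool" where
  "full_column_rank M \<longleftrightarrow> rank M = CARD('c)"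

definition hcat :: "real^'a^'n \<Rightarrow> real^'b^'n \<Rightarrow> real^('a + 'b)^'n" where
  "hcat M N = (\<chi> t c. case c of Inl i \<Rightarrow> M $ t $ i | Inr j \<Rightarrow> N $ t $ j)"

text \<open>
  A vector indexed by \<open>'c \<times> 'k\<close> is read as the stack of its \<open>'c\<close>-indexed blocks, each of
  which is indexed by \<open>'k\<close>.  So the column stacking of a matrix with row index \<open>'k\<close> and
  column index \<open>'c\<close> has the entry \<open>(j, i)\<close> of the matrix at row \<open>i\<close> and column \<open>j\<close>.
\<close>

definition col_stack :: "real^'c^'k \<Rightarrow> real^('c \<times> 'k)" where
  "col_stack A = (\<chi> c. A $ snd c $ fst c)"

definition col_unstack :: "real^('c \<times> 'k) \<Rightarrow> real^'c^'k" where
  "col_unstack \<alpha> = (\<chi> i j. \<alpha> $ (j, i))"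

lemma col_unstack_col_stack [simp]: "col_unstack (col_stack A) = A"
  by (simp add: col_unstack_def col_stack_def vec_eq_iff)

lemma col_stack_col_unstack [simp]: "col_stack (col_unstack \<alpha>) = \<alpha>"
  by (simp add: col_unstack_def col_stack_def vec_eq_iff)


section \<open>Data\<close>

text \<open>
  A finite linearly ordered index type of cardinality \<open>N\<close> is identified with \<open>1, \<dots>, N\<close>
  through the position of its elements.
\<close>

definition pos :: "'k::{finite,linorder} \<Rightarrow> int" where
  "pos i = int (card {j. j \<le> i})"

lemma pos_strict_mono: "strict_mono (pos :: 'k::{finite,linorder} \<Rightarrow> int)"
proof (rule strict_monoI)
  fix i j :: 'k assume "i < j"
  then have "{k. k \<le> i} \<subseteq> {k. k \<le> j}" and "j \<in> {k. k \<le> j} - {k. k \<le> i}"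
    by auto
  then have "{k. k \<le> i} \<subset> {k. k \<le> j}" by blast
  then have "card {k. k \<le> i} < card {k. k \<le> j}" by (intro psubset_card_mono) auto
  then show "pos i < pos j" by (simp add: pos_def)
qed

lemma bij_betw_pos: "bij_betw pos (UNIV :: 'k::{finite,linorder} set) {1..int CARD('k)}"
proof -
  have inj: "inj (pos :: 'k \<Rightarrow> int)"
    using pos_strict_mono by (rule strict_mono_imp_inj_on)
  have "pos i \<in> {1..int CARD('k)}" for i :: 'k
  proof -
    have "card {j. j \<le> i} \<le> CARD('k)" by (rule card_mono) auto
    moreover have "card {j. j \<le> i} > 0" by (auto simp: card_gt_0_iff)
    ultimately show ?thesis by (auto simp: pos_def)
  qed
  then have "range (pos :: 'k \<Rightarrow> int) = {1..int CARD('k)}"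
    by (intro card_subset_eq) (auto simp: card_image inj)
  with inj show ?thesis by (auto simp: bij_betw_def)
qed

text \<open>
  The series \<open>y t\<close> is used for \<open>t = -q+1, \<dots>, n\<close> only.  The row \<open>t\<close> of \<open>lag_matrix y\<close>
  is the stack of \<open>y (t - 1), \<dots>, y (t - q)\<close>.
\<close>

definition response_matrix :: "(int \<Rightarrow> real^'r) \<Rightarrow> real^'r^('n::{finite,linorder})" where
  "response_matrix y = (\<chi> t. y (pos t))"

definition lag_matrix ::
  "(int \<Rightarrow> real^'r) \<Rightarrow> real^('q::{finite,linorder} \<times> 'r)^('n::{finite,linorder})" where
  "lag_matrix y = (\<chi> t c. y (pos t - pos (fst c)) $ snd c)"


section \<open>Likelihood, prior, posterior\<close>

definition likelihood ::
  "real^'r^'n \<Rightarrow> real^('q::finite \<times> 'r)^'n \<Rightarrow> real^'p^'n \<Rightarrow>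
   real^'r^('q \<times> 'r) \<Rightarrow> real^'r^'p \<Rightarrow> real^'r^'r \<Rightarrow> real" where
  "likelihood Y Z X A B \<Sigma> =
     (2 * pi) powr (- (real CARD('n) * real CARD('r) / 2)) *
     det \<Sigma> powr (- (real CARD('n) / 2)) *
     exp (- (1/2) * trace (matrix_inv \<Sigma> **
       (transpose (Y - Z ** A - X ** B) ** (Y - Z ** A - X ** B))))"

text \<open>The priors are specified up to positive constants only; the prior of \<open>B\<close> is \<open>1\<close>.\<close>

definition prior_alpha :: "real^'k \<Rightarrow> real^'k^'k \<Rightarrow> real^'k \<Rightarrow> real" where
  "prior_alpha m C \<alpha> = exp (- (1/2) * ((\<alpha> - m) \<bullet> (C *v (\<alpha> - m))))"

definition prior_Sigma :: "real^'r^'r \<Rightarrow> real \<Rightarrow> real^'r^'r \<Rightarrow> real" where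
  "prior_Sigma D a \<Sigma> = det \<Sigma> powr (- (a/2)) * exp (- (1/2) * trace (D ** matrix_inv \<Sigma>))"

definition proper_density :: "('a::euclidean_space \<Rightarrow> real) \<Rightarrow> bool" where
  "proper_density f \<longleftrightarrow> (\<integral>\<^sup>+ x. ennreal (f x) \<partial>lborel) < \<infinity>"

definition unnorm_posterior ::
  "real^'r^'n \<Rightarrow> real^('q::finite \<times> 'r)^'n \<Rightarrow> real^'p^'n \<Rightarrow>
   real^('r \<times> 'q \<times> 'r) \<Rightarrow> real^('r \<times> 'q \<times> 'r)^('r \<times> 'q \<times> 'r) \<Rightarrow> real^'r^'r \<Rightarrow> real \<Rightarrow>
   real^('r \<times> 'q \<times> 'r) \<Rightarrow> real^'r^'p \<Rightarrow> real^'r^'r \<Rightarrow> real" where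
  "unnorm_posterior Y Z X m C D a \<alpha> B \<Sigma> =
     likelihood Y Z X (col_unstack \<alpha>) B \<Sigma> * (prior_alpha m C \<alpha> * 1 * prior_Sigma D a \<Sigma>)"

text \<open>
  Lebesgue measure on the symmetric matrices is Lebesgue measure in the entries on and above the
  diagonal.  The restriction to the positive definite ones has these as its underlying space.
\<close>

definition lborel_spd :: "('r::{finite,linorder}, 'r) rmat measure" where
  "lborel_spd = restrict_space
     (distr (\<Pi>\<^sub>M c \<in> {(i, j). i \<le> j}. lborel) borel
       (\<lambda>s :: 'r \<times> 'r \<Rightarrow> real. \<chi> i j. s (min i j, max i j)))
     {\<Sigma>. sym_pos_def \<Sigma>}"

abbreviation lborel_alpha_Sigma ::
  "(('k::finite) rvec \<times> ('r::{finite,linorder}, 'r) rmat) measure" where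
  "lborel_alpha_Sigma \<equiv> lborel \<Otimes>\<^sub>M lborel_spd"

abbreviation lborel_Theta ::
  "(('k::finite) rvec \<times> ('p::finite, 'r::{finite,linorder}) rmat \<times> ('r, 'r) rmat) measure" where
  "lborel_Theta \<equiv> lborel \<Otimes>\<^sub>M (lborel \<Otimes>\<^sub>M lborel_spd)"

text \<open>
  Everything below depends on the unnormalized joint density \<open>g \<alpha> B \<Sigma>\<close> of the posterior alone.
\<close>

context
  fixes g :: "('k::finite) rvec \<Rightarrow> ('p::finite, 'r::{finite,linorder}) rmat \<Rightarrow>
    ('r, 'r) rmat \<Rightarrow> real"
begin

definition posterior :: "('k rvec \<times> ('p, 'r) rmat \<times> ('r, 'r) rmat) measure" where
  "posterior = density lborel_Theta (\<lambda>(\<alpha>, B, \<Sigma>).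
     ennreal (g \<alpha> B \<Sigma>) / (\<integral>\<^sup>+ (\<alpha>, B, \<Sigma>). ennreal (g \<alpha> B \<Sigma>) \<partial>lborel_Theta))"

definition posterior_alpha_Sigma :: "('k rvec \<times> ('r, 'r) rmat) measure" where
  "posterior_alpha_Sigma = distr posterior lborel_alpha_Sigma (\<lambda>(\<alpha>, B, \<Sigma>). (\<alpha>, \<Sigma>))"

definition posterior_alpha :: "'k rvec measure" where
  "posterior_alpha = distr posterior lborel (\<lambda>(\<alpha>, B, \<Sigma>). \<alpha>)"

definition unnorm_alpha_Sigma :: "'k rvec \<Rightarrow> ('r, 'r) rmat \<Rightarrow> ennreal" where
  "unnorm_alpha_Sigma \<alpha> \<Sigma> = (\<integral>\<^sup>+ B. ennreal (g \<alpha> B \<Sigma>) \<partial>lborel)"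

definition dens_Sigma_given_alpha :: "'k rvec \<Rightarrow> ('r, 'r) rmat \<Rightarrow> ennreal" where
  "dens_Sigma_given_alpha \<alpha> \<Sigma> =
     unnorm_alpha_Sigma \<alpha> \<Sigma> / (\<integral>\<^sup>+ S. unnorm_alpha_Sigma \<alpha> S \<partial>lborel_spd)"

definition dens_alpha_given_Sigma :: "('r, 'r) rmat \<Rightarrow> 'k rvec \<Rightarrow> ennreal" where
  "dens_alpha_given_Sigma \<Sigma> \<alpha> =
     unnorm_alpha_Sigma \<alpha> \<Sigma> / (\<integral>\<^sup>+ b. unnorm_alpha_Sigma b \<Sigma> \<partial>lborel)"

definition dens_B_given_alpha_Sigma :: "'k rvec \<Rightarrow> ('r, 'r) rmat \<Rightarrow> ('p, 'r) rmat \<Rightarrow> ennreal" where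
  "dens_B_given_alpha_Sigma \<alpha> \<Sigma> B = ennreal (g \<alpha> B \<Sigma>) / unnorm_alpha_Sigma \<alpha> \<Sigma>"

definition K_C ::
  "'k rvec \<times> ('p, 'r) rmat \<times> ('r, 'r) rmat \<Rightarrow>
   ('k rvec \<times> ('p, 'r) rmat \<times> ('r, 'r) rmat) measure" where
  "K_C = (\<lambda>(\<alpha>', B', \<Sigma>'). density lborel_Theta (\<lambda>(\<alpha>, B, \<Sigma>).
     dens_Sigma_given_alpha \<alpha>' \<Sigma> * dens_alpha_given_Sigma \<Sigma> \<alpha> * dens_B_given_alpha_Sigma \<alpha> \<Sigma> B))"

definition K_G :: "'k rvec \<times> ('r, 'r) rmat \<Rightarrow> ('k rvec \<times> ('r, 'r) rmat) measure" where
  "K_G = (\<lambda>(\<alpha>', \<Sigma>'). density lborel_alpha_Sigma (\<lambda>(\<alpha>, \<Sigma>).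
     dens_alpha_given_Sigma \<Sigma> \<alpha> * dens_Sigma_given_alpha \<alpha>' \<Sigma>))"

definition K_A :: "'k rvec \<Rightarrow> 'k rvec measure" where
  "K_A = (\<lambda>\<alpha>'. density lborel (\<lambda>\<alpha>.
     \<integral>\<^sup>+ \<Sigma>. dens_alpha_given_Sigma \<Sigma> \<alpha> * dens_Sigma_given_alpha \<alpha>' \<Sigma> \<partial>lborel_spd))"

end


section \<open>Geometric ergodicity\<close>

text \<open>
  \<open>sup \<sigma> - inf \<sigma>\<close> over the measurable sets is the total variation norm of the signed measure
  \<open>\<sigma> = \<mu> - \<nu>\<close>, by the Hahn decomposition.
\<close>

definition tv_norm_diff :: "'a measure \<Rightarrow> 'a measure \<Rightarrow> real" where
  "tv_norm_diff \<mu> \<nu> = (SUP A\<in>sets \<nu>. measure \<mu> A - measure \<nu> A) -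
                      (INF A\<in>sets \<nu>. measure \<mu> A - measure \<nu> A)"

primrec kernel_pow :: "'a measure \<Rightarrow> ('a \<Rightarrow> 'a measure) \<Rightarrow> nat \<Rightarrow> 'a \<Rightarrow> 'a measure" where
  "kernel_pow S K 0 = return S"
| "kernel_pow S K (Suc h) = (\<lambda>x. bind (kernel_pow S K h x) K)"

text \<open>
  Of the measure \<open>S\<close> only the measurable space matters.  That \<open>K\<close> is a Markov kernel and \<open>\<pi>\<close>
  an invariant probability measure is part of the notion.
\<close>

definition geometrically_ergodic :: "'a measure \<Rightarrow> ('a \<Rightarrow> 'a measure) \<Rightarrow> 'a measure \<Rightarrow> bool" where
  "geometrically_ergodic S K \<pi> \<longleftrightarrow>
     K \<in> S \<rightarrow>\<^sub>M prob_algebra S \<and> \<pi> \<in> space (prob_algebra S) \<and> bind \<pi> K = \<pi> \<and>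
     (\<exists>(\<rho>::real) (M :: 'a \<Rightarrow> real). 0 \<le> \<rho> \<and> \<rho> < 1 \<and> (\<forall>x\<in>space S. 0 \<le> M x) \<and>
        (\<forall>x\<in>space S. \<forall>h\<ge>1. tv_norm_diff (kernel_pow S K h x) \<pi> \<le> M x * \<rho> ^ h))"

end

theory Submission
  imports Defs
begin

text \<open>
  Each of the three kernels forgets everything but the current \<open>\<alpha>\<close>: it draws \<open>\<Sigma>\<close> given \<open>\<alpha>\<close>, then
  \<open>\<alpha>\<close> given \<open>\<Sigma>\<close>, then possibly \<open>B\<close>. So \<open>K_G\<close> and \<open>K_A\<close> are the images of \<open>K_C\<close> under coordinate
  projections, and geometric ergodicity passes to such images with the same rate
  (\<open>geometrically_ergodic_image\<close>). It remains to treat \<open>K_C\<close>, which is even uniformly ergodic: two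
  steps from an arbitrary starting point dominate a fixed multiple of a fixed probability measure,
  hence every two steps shrink the oscillation of \<open>x \<mapsto> K\<^sup>h(x, A)\<close> by a fixed factor
  (\<open>geometrically_ergodic_of_two_step_minorization\<close>). Two facts give the domination.

  First, the law of \<open>\<alpha>\<close> given \<open>\<Sigma>\<close> puts at least half of its mass on a ball that does not depend on
  \<open>\<Sigma>\<close>. Around a least squares fit of \<open>Y\<close> on \<open>[Z, X]\<close> the residual sum of squares weighted by \<open>\<Sigma>\<^sup>-\<^sup>1\<close> is
  a quadratic form \<open>q \<ge> 0\<close> in \<open>(\<alpha>, B)\<close> plus a term free of \<open>(\<alpha>, B)\<close>. So, up to normalization, \<open>\<Sigma>\<close> enters
  the density of \<open>(\<alpha>, B)\<close> through \<open>q\<close> alone. A common rescaling of \<open>\<alpha>\<close> and \<open>B\<close> compares the mass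
  outside a ball with the total mass, with a constant that is the same for all \<open>q\<close>
  (\<open>gaussian_mass_outside_ball\<close>).

  Second, for \<open>\<alpha>\<close> in a ball the densities of \<open>\<Sigma>\<close> given \<open>\<alpha>\<close> have a common minorant
  (\<open>Sigma_given_alpha_minorization\<close>). Their numerators are bounded below because the residuals at
  \<open>B = 0\<close> are bounded on the ball. Their normalizing constants are bounded above by a coercivity estimate
  \<open>c (\<bar>w\<bar>\<^sup>2 + \<bar>(B - B\<^sub>0(\<alpha>)) w\<bar>\<^sup>2) \<le> \<bar>(Y - Z A - X B) w\<bar>\<^sup>2 + w \<bullet> D w\<close>. This estimate follows from
  either of the two sets of conditions: if \<open>D\<close> is positive definite and \<open>X\<close> has full column rank, then
  \<open>B\<^sub>0(\<alpha>)\<close> is the least squares fit of \<open>Y - Z A\<close> on \<open>X\<close>, and if \<open>[Y, Z, X]\<close> has full column rank, then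
  \<open>B\<^sub>0 = 0\<close>. Integrating the resulting bound over \<open>B\<close> leaves a multiple of an inverse Wishart
  density with exponent \<open>(n + a - p) / 2 > r\<close>, whose integral is finite (\<open>inv_wishart_integral_finite\<close>).

  That integral is estimated by adding one row and one column at a time. If \<open>M\<close> is \<open>W\<close> bordered by a
  vector \<open>v\<close> and a diagonal entry \<open>\<sigma>\<close>, then with \<open>w = W\<^sup>-\<^sup>1 v\<close> and \<open>u = \<sigma> - v \<bullet> w\<close> one has \<open>det M = u det W\<close>,
  while the trace of the inverse grows by \<open>(1 + \<bar>w\<bar>\<^sup>2) / u\<close>. So \<open>v\<close> can be integrated out as a Gaussian
  variable and \<open>u\<close> as an inverse gamma variable, and the exponent of \<open>det W\<close> drops by one together
  with the dimension.
\<close>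

section \<open>Positive definite matrices\<close>

text \<open>The quadratic form attains a positive minimum on the compact unit sphere.\<close>

lemma sym_pos_def_lower_bound:
  fixes M :: "real^'k^'k"
  assumes "sym_pos_def M"
  obtains c where "c > 0" "\<And>x. c * (x \<bullet> x) \<le> x \<bullet> (M *v x)"
proof -
  have cont: "continuous_on (sphere 0 1) (\<lambda>x::real^'k. x \<bullet> (M *v x))"
    by (intro continuous_intros linear_continuous_on_compose[OF continuous_on_id]) auto
  have ne: "sphere 0 1 \<noteq> ({} :: (real^'k) set)" by simp
  obtain z :: "real^'k" where z: "z \<in> sphere 0 1"
    and min: "\<And>x. x \<in> sphere 0 1 \<Longrightarrow> z \<bullet> (M *v z) \<le> x \<bullet> (M *v x)"
    using continuous_attains_inf[OF compact_sphere ne cont] by auto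
  have "z \<noteq> 0" using z by auto
  then have pos: "z \<bullet> (M *v z) > 0" using assms by (simp add: sym_pos_def_def)
  have "(z \<bullet> (M *v z)) * (x \<bullet> x) \<le> x \<bullet> (M *v x)" for x
  proof (cases "x = 0")
    case False
    let ?y = "x /\<^sub>R norm x"
    have "z \<bullet> (M *v z) \<le> ?y \<bullet> (M *v ?y)" by (rule min) (simp add: False)
    also have "\<dots> = (x \<bullet> (M *v x)) / (x \<bullet> x)"
      by (simp add: matrix_vector_mult_scaleR dot_square_norm power2_eq_square divide_simps)
    finally show ?thesis using False by (simp add: field_simps)
  qed simp
  with pos that show ?thesis by blast
qed

lemma inner_transpose: "x \<bullet> (transpose M *v y) = (M *v x) \<bullet> y"
  for M :: "real^'c^'n"
  by (metis dot_lmul_matrix inner_commute vector_transpose_matrix transpose_transpose)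

lemma gram_sym_pos_def:
  fixes M :: "real^'c^'n"
  assumes "full_column_rank M"
  shows "sym_pos_def (transpose M ** M)"
proof -
  have "inj ((*v) M)" using assms unfolding full_column_rank_def by (simp add: full_rank_injective)
  then have "M *v x \<noteq> 0" if "x \<noteq> 0" for x
    using that by (metis injD matrix_vector_mult_0_right)
  then show ?thesis
    unfolding sym_pos_def_def
    by (auto simp: matrix_transpose_mul transpose_transpose matrix_vector_mul_assoc[symmetric] inner_transpose
        simp del: transpose_matrix_vector)
qed

lemma full_column_rank_lower_bound:
  fixes M :: "real^'c^'n"
  assumes "full_column_rank M"
  obtains c where "c > 0" "\<And>x. c * (x \<bullet> x) \<le> (M *v x) \<bullet> (M *v x)"
proof -
  obtain c where "c > 0" "\<And>x. c * (x \<bullet> x) \<le> x \<bullet> ((transpose M ** M) *v x)"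
    using sym_pos_def_lower_bound[OF gram_sym_pos_def[OF assms]] by blast
  with that show ?thesis
    by (simp add: matrix_vector_mul_assoc[symmetric] inner_transpose del: transpose_matrix_vector)
qed

lemma sym_matrix_inner: "transpose M = M \<Longrightarrow> x \<bullet> (M *v y) = (M *v x) \<bullet> y"
  for M :: "real^'k^'k"
  by (metis dot_lmul_matrix vector_transpose_matrix)

lemma sym_pos_def_invertible:
  fixes M :: "real^'k^'k"
  assumes "sym_pos_def M"
  shows "invertible M"
proof -
  have "x = 0" if "M *v x = 0" for x
    using assms that unfolding sym_pos_def_def by (metis inner_zero_right less_irrefl)
  then show ?thesis
    by (simp add: invertible_left_inverse matrix_left_invertible_ker)
qed

lemma matrix_inv_mult:
  fixes M :: "real^'k^'k"
  assumes "invertible M" shows "M ** matrix_inv M = mat 1" "matrix_inv M ** M = mat 1"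
  using assms unfolding matrix_inv_def invertible_def
  by (metis (mono_tags, lifting) someI_ex)+

lemma matrix_inv_eqI:
  fixes M :: "real^'k^'k"
  assumes "M ** N = mat 1" shows "matrix_inv M = N" "invertible M"
proof -
  show i: "invertible M" using assms by (meson invertible_right_inverse)
  show "matrix_inv M = N"
    by (metis assms i matrix_inv_mult(2) matrix_mul_assoc matrix_mul_lid matrix_mul_rid)
qed

lemma matrix_inv_mult_vec:
  fixes M :: "real^'k^'k"
  assumes "invertible M" shows "M *v (matrix_inv M *v x) = x" "matrix_inv M *v (M *v x) = x"
  using matrix_inv_mult[OF assms] by (simp_all add: matrix_vector_mul_assoc)

lemma transpose_matrix_inv:
  fixes M :: "real^'k^'k"
  assumes "invertible M" "transpose M = M" shows "transpose (matrix_inv M) = matrix_inv M"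
  by (metis assms matrix_inv_eqI(1) matrix_inv_mult(2) matrix_transpose_mul transpose_mat)

lemma sym_pos_def_matrix_inv:
  fixes M :: "real^'k^'k"
  assumes "sym_pos_def M" shows "sym_pos_def (matrix_inv M)"
  unfolding sym_pos_def_def
proof safe
  have i: "invertible M" and t: "transpose M = M"
    using assms sym_pos_def_invertible by (auto simp: sym_pos_def_def)
  show "transpose (matrix_inv M) = matrix_inv M" using i t by (rule transpose_matrix_inv)
  fix x :: "real^'k" assume "x \<noteq> 0"
  then have "matrix_inv M *v x \<noteq> 0" by (metis i matrix_inv_mult_vec(1) matrix_vector_mult_0_right)
  then have "(matrix_inv M *v x) \<bullet> (M *v (matrix_inv M *v x)) > 0"
    using assms by (simp add: sym_pos_def_def)
  then show "0 < x \<bullet> (matrix_inv M *v x)" by (simp add: matrix_inv_mult_vec i inner_commute)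
qed

section \<open>Bordered matrices and Cholesky factors\<close>

text \<open>
  Matrices of varying size are represented inside one type: a matrix on the index set \<open>J\<close> is extended by
  the identity outside \<open>J\<close>. The row and the column \<open>j\<close> of \<open>W\<close> are overwritten, so that \<open>bordered W v \<sigma> j\<close>
  is the matrix on \<open>insert j J\<close> with the blocks \<open>W\<close>, \<open>v\<close> and \<open>\<sigma>\<close>.
\<close>

definition bordered :: "real^'k^'k \<Rightarrow> real^'k \<Rightarrow> real \<Rightarrow> 'k \<Rightarrow> real^'k^'k" where
  "bordered W v \<sigma> j = (\<chi> i k. if i = j then (if k = j then \<sigma> else v $ k)
                              else if k = j then v $ i else W $ i $ k)"

definition id_outside :: "'k set \<Rightarrow> real^'k^'k \<Rightarrow> bool" where
  "id_outside J M \<longleftrightarrow> (\<forall>i k. i \<notin> J \<or> k \<notin> J \<longrightarrow> M $ i $ k = (if i = k then 1 else 0))"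

lemma bordered_mult_vec:
  fixes W :: "real^'k^'k"
  assumes W: "id_outside J W" and j: "j \<notin> J" and v: "v $ j = 0"
  shows "bordered W v \<sigma> j *v y =
    W *v y + ((\<sigma> - 1) * y $ j + v \<bullet> y) *\<^sub>R axis j 1 + (y $ j) *\<^sub>R v"
proof (subst vec_eq_iff, intro allI)
  fix i
  have Wj: "W $ j $ k = (if k = j then 1 else 0)" and Wj': "W $ k $ j = (if k = j then 1 else 0)" for k
    using W j unfolding id_outside_def by auto
  have *: "(\<Sum>k\<in>UNIV. f k) = f j + (\<Sum>k\<in>UNIV-{j}. f k)" for f :: "'k \<Rightarrow> real"
    by (simp add: sum.remove[of UNIV j])
  show "(bordered W v \<sigma> j *v y) $ i =
    (W *v y + ((\<sigma> - 1) * y $ j + v \<bullet> y) *\<^sub>R axis j 1 + (y $ j) *\<^sub>R v) $ i"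
    using v by (auto simp: bordered_def matrix_vector_mult_def inner_vec_def axis_def * Wj Wj' algebra_simps)
qed

text \<open>
  Here \<open>u\<close> is the Schur complement of \<open>W\<close> in \<open>M\<close>. The facts below come from the factorization
  \<open>M = L U L\<^sup>T\<close>, where \<open>U\<close> is \<open>W\<close> with its entry at \<open>(j, j)\<close> replaced by \<open>u\<close> and \<open>L\<close> is the identity with
  \<open>w\<close> added to its row \<open>j\<close>.
\<close>

locale bordered_matrix =
  fixes W :: "real^'k^'k" and J and j and v :: "real^'k" and \<sigma> :: real
  assumes W: "id_outside J W" and j: "j \<notin> J" and vj: "v $ j = 0"
    and sym: "transpose W = W" and inv: "invertible W"
begin

abbreviation "e \<equiv> axis j 1 :: real^'k"
definition "w = matrix_inv W *v v"
definition "u = \<sigma> - v \<bullet> w"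
abbreviation "M \<equiv> bordered W v \<sigma> j"

lemma We: "W *v e = e"
  using W j unfolding matrix_vector_mult_basis by (auto simp: vec_eq_iff column_def axis_def id_outside_def)

lemma W_mult_vec_nth: "i \<notin> J \<Longrightarrow> (W *v y) $ i = y $ i"
  using W by (simp add: id_outside_def matrix_vector_mult_def if_distrib[where f="\<lambda>x. x * _"] cong: if_cong)

lemmas W_mult_vec_j = W_mult_vec_nth[OF j]

lemma We': "matrix_inv W *v e = e"
  by (metis We inv matrix_inv_mult_vec(2))

lemma Ww: "W *v w = v" by (simp add: w_def inv matrix_inv_mult_vec)

lemma wj: "w $ j = 0"
proof -
  have "w $ j = w \<bullet> e" by (simp add: inner_axis)
  also have "\<dots> = v \<bullet> (matrix_inv W *v e)" unfolding w_def
    by (simp add: sym_matrix_inner[OF transpose_matrix_inv[OF inv sym]])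
  finally show ?thesis by (simp add: We' inner_axis vj)
qed

lemma mult_vec: "M *v y = W *v y + ((\<sigma> - 1) * y $ j + v \<bullet> y) *\<^sub>R e + (y $ j) *\<^sub>R v"
  by (rule bordered_mult_vec[OF W j vj])

text \<open>
  Completing the square in the coordinate \<open>j\<close>. The vector on the right-hand side is \<open>y\<close> with its entry \<open>j\<close>
  removed and shifted by a multiple of \<open>w\<close>; its entry \<open>j\<close> is zero, so the entry \<open>1\<close> of \<open>W\<close> at \<open>j\<close>
  does not contribute.
\<close>

lemma quadratic_form:
  "y \<bullet> (M *v y) = (y - y $ j *\<^sub>R e + y $ j *\<^sub>R w) \<bullet> (W *v (y - y $ j *\<^sub>R e + y $ j *\<^sub>R w)) + u * (y $ j)\<^sup>2"
proof -
  have 1: "y \<bullet> (W *v e) = y $ j" "e \<bullet> (W *v y) = y $ j" "e \<bullet> e = 1" "e \<bullet> (W *v e) = 1" "e \<bullet> (W *v w) = 0"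
     "w \<bullet> (W *v e) = 0"
    using We sym_matrix_inner[OF sym, of e y]
    by (simp_all add: inner_axis inner_axis' Ww vj wj)
  have 2: "y \<bullet> (W *v w) = v \<bullet> y" "w \<bullet> (W *v y) = v \<bullet> y" "w \<bullet> (W *v w) = v \<bullet> w"
    using sym_matrix_inner[OF sym, of w y] by (simp_all add: Ww inner_commute)
  show ?thesis
    unfolding mult_vec
    by (simp add: 1 2 matrix_vector_right_distrib matrix_vector_mult_diff_distrib matrix_vector_mult_scaleR
        inner_add_left inner_add_right inner_diff_left inner_diff_right u_def power2_eq_square
            algebra_simps inner_axis inner_axis')
       (simp add: inner_commute W_mult_vec_j wj)
qed

lemma schur_complement_pos:
  assumes "sym_pos_def M"
  shows "u > 0"
proof -
  have "(e - w) $ j = 1" by (simp add: wj)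
  then have "e - w \<noteq> 0" by (metis zero_index zero_neq_one)
  then have "(e - w) \<bullet> (M *v (e - w)) > 0" using assms by (simp add: sym_pos_def_def)
  then show "u > 0" by (simp add: quadratic_form wj)
qed

lemma det_bordered: "det M = u * det W"
proof -
  define L where "L = (\<chi> k. if k = j then row j (mat 1) + w else row k (mat 1 :: real^'k^'k))"
  define U where "U = (\<chi> k. if k = j then u *s row j W else row k W)"
  have Lv: "L *v y = y + (w \<bullet> y) *\<^sub>R e" for y
    by (auto simp: L_def matrix_vector_mult_def vec_eq_iff row_def mat_def axis_def inner_vec_def
        if_distrib[where f="\<lambda>x. _ * x"]
       algebra_simps sum.distrib sum.delta cong: if_cong)
  have Ltv: "transpose L *v y = y + (y $ j) *\<^sub>R w" for y
  proof (subst vec_eq_iff, intro allI)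
    fix i
    have "(transpose L *v y) $ i = (\<Sum>k\<in>UNIV. (if k = i then 1 else 0) * y $ k + (if k
        = j then w $ i * y $ k else 0))"
      unfolding matrix_vector_mult_def transpose_def L_def
      by (auto simp: row_def mat_def algebra_simps intro!: sum.cong)
    then show "(transpose L *v y) $ i = (y + (y $ j) *\<^sub>R w) $ i"
      by (simp add: sum.distrib if_distrib[where f="\<lambda>x. x * _"] cong: if_cong)
  qed
  have Uv: "U *v y = W *v y + ((u - 1) * y $ j) *\<^sub>R e" for y
  proof (subst vec_eq_iff, intro allI)
    fix i
    have "(U *v y) $ i = (if i = j then u * (W *v y) $ j else (W *v y) $ i)"
      by (auto simp: U_def matrix_vector_mult_def row_def sum_distrib_left mult.assoc)
    then show "(U *v y) $ i = (W *v y + ((u - 1) * y $ j) *\<^sub>R e) $ i"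
      by (auto simp: W_mult_vec_j axis_def algebra_simps)
  qed
  have 1: "W *v w = v" "w \<bullet> e = 0" "e \<bullet> w = 0" by (simp_all add: Ww inner_axis inner_axis' wj)
  have "M *v y = (L ** U ** transpose L) *v y" for y
    unfolding mult_vec matrix_vector_mul_assoc[symmetric] Lv Ltv Uv
    using sym_matrix_inner[OF sym, of w y]
    by (simp add: matrix_vector_right_distrib matrix_vector_mult_scaleR Ww inner_add_left inner_add_right 1
       u_def wj algebra_simps inner_commute)
  then have "M = L ** U ** transpose L" by (simp add: matrix_eq)
  moreover have "det L = 1"
  proof -
    have "w \<in> vec.span {row k (mat 1 :: real^'k^'k) |k. k \<noteq> j}"
    proof -
      have "w = (\<Sum>k\<in>UNIV-{j}. w $ k *s axis k 1)"
        by (auto simp: vec_eq_iff axis_def sum.remove[of UNIV j] wj if_distrib sum.delta' cong: if_cong)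
      moreover have "axis k (1::real) = row k (mat 1 :: real^'k^'k)" for k
        by (auto simp: vec_eq_iff axis_def row_def mat_def)
      ultimately show ?thesis
        by (metis (mono_tags, lifting) vec.span_sum vec.span_scale vec.span_base mem_Collect_eq DiffD2
            singletonI)
    qed
    then show ?thesis unfolding L_def
      by (subst det_row_span) auto
  qed
  moreover have "det U = u * det W"
  proof -
    have "det U = u * det (\<chi> k. if k = j then row j W else row k W)" unfolding U_def
      by (rule det_row_mul)
    also have "(\<chi> k. if k = j then row j W else row k W) = W"
      by (simp add: vec_eq_iff row_def)
    finally show ?thesis .
  qed
  ultimately show ?thesis by (simp add: det_mul)
qed

text \<open>
  The inverse is \<open>W\<^sup>-\<^sup>1 - e e\<^sup>T + (e - w) (e - w)\<^sup>T / u\<close>. The summand \<open>- 1\<close> in the trace removes the diagonal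
  entry \<open>1\<close> that \<open>W\<^sup>-\<^sup>1\<close> has at \<open>j\<close>, outside \<open>J\<close>.
\<close>

lemma inv_bordered:
  assumes "u \<noteq> 0"
  shows "invertible M" "trace (matrix_inv M) = trace (matrix_inv W) - 1 + (1 + w \<bullet> w) / u"
proof -
  define N where "N = (\<chi> i k. matrix_inv W $ i $ k - e $ i * e $ k + (1 / u) * ((e - w) $ i * (e - w) $ k))"
  have Nv: "N *v y = matrix_inv W *v y - y $ j *\<^sub>R e + ((1 / u) * ((e - w) \<bullet> y)) *\<^sub>R (e - w)" for y
  proof -
    have ej: "e \<bullet> y = y $ j" by (simp add: inner_axis')
    have "(N *v y) $ i = (matrix_inv W *v y - (e \<bullet> y) *\<^sub>R e + ((1 / u) * ((e - w) \<bullet> y)) *\<^sub>R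
        (e - w)) $ i" for i
      unfolding N_def matrix_vector_mult_def inner_vec_def
      by (simp add: algebra_simps sum.distrib sum_subtractf sum_distrib_left sum_divide_distrib
          diff_divide_distrib add_divide_distrib)
    then show ?thesis by (simp add: vec_eq_iff ej)
  qed
  have 1: "W *v w = v" "w \<bullet> e = 0" "v \<bullet> e = 0" "W *v e = e" "v \<bullet> (matrix_inv W *v y) = w \<bullet> y"
    "(matrix_inv W *v y) $ j = y $ j" for y
    using sym_matrix_inner[OF transpose_matrix_inv[OF inv sym], of v y]
      sym_matrix_inner[OF transpose_matrix_inv[OF inv sym], of e y]
    by (simp_all add: Ww inner_axis wj vj We inner_axis' We') (simp_all add: w_def)
  have 2: "M *v w = v + (v \<bullet> w) *\<^sub>R e"
    unfolding mult_vec by (simp add: 1 wj)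
  have 3: "M *v (matrix_inv W *v y) = y + ((\<sigma> - 1) * y $ j + w \<bullet> y) *\<^sub>R e + y $ j *\<^sub>R v" for y
    unfolding mult_vec by (simp add: 1 matrix_inv_mult_vec inv)
  have 4: "M *v e = e + (\<sigma> - 1) *\<^sub>R e + v"
    unfolding mult_vec by (simp add: 1)
  have gen: "y + ((s - 1) * t + r) *\<^sub>R e + t *\<^sub>R v - t *\<^sub>R (e + (s - 1) *\<^sub>R e + v)
      + k *\<^sub>R ((e + (s - 1) *\<^sub>R e + v) - (v + q *\<^sub>R e)) = y + (r - t + k * (s - q)) *\<^sub>R e" for y s t r k q
    by (simp add: vec_eq_iff algebra_simps)
  have 5: "w \<bullet> y - y $ j + 1 / u * ((e - w) \<bullet> y) * (\<sigma> - v \<bullet> w) = 0" for y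
    using assms by (simp add: inner_diff_left inner_axis' u_def)
  have "M *v (N *v y) = y" for y
    unfolding Nv matrix_vector_right_distrib matrix_vector_mult_diff_distrib matrix_vector_mult_scaleR 2
        3 4 gen 5
    by simp
  then have MN: "M ** N = mat 1"
    by (simp add: matrix_eq matrix_vector_mul_assoc[symmetric])
  then show "invertible M" by (rule matrix_inv_eqI)
  have "matrix_inv M = N" using MN by (rule matrix_inv_eqI)
  moreover have "trace N = trace (matrix_inv W) - (e \<bullet> e) + (1 / u) * ((e - w) \<bullet> (e - w))"
    unfolding N_def trace_def inner_vec_def by (simp add: sum.distrib sum_subtractf sum_divide_distrib)
  ultimately show "trace (matrix_inv M) = trace (matrix_inv W) - 1 + (1 + w \<bullet> w) / u"
    using 1 by (simp add: inner_diff_left inner_diff_right inner_commute inner_axis)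
qed

end

lemma sym_pos_def_bordered_imp:
  fixes W :: "real^'k^'k"
  assumes W: "id_outside J W" and j: "j \<notin> J" and v: "v $ j = 0" and sym: "transpose W = W"
    and spd: "sym_pos_def (bordered W v \<sigma> j)"
  shows "sym_pos_def W"
  unfolding sym_pos_def_def
proof safe
  let ?e = "axis j 1 :: real^'k"
  have We: "W *v ?e = ?e"
    using W j unfolding matrix_vector_mult_basis by (auto simp: vec_eq_iff column_def axis_def id_outside_def)
  show "transpose W = W" by (rule sym)
  fix x :: "real^'k" assume "x \<noteq> 0"
  define y where "y = x - x $ j *\<^sub>R ?e"
  have yj: "y $ j = 0" by (simp add: y_def)
  have xy: "x = y + x $ j *\<^sub>R ?e" by (simp add: y_def)
  have ye: "y \<bullet> (W *v ?e) = 0" "?e \<bullet> (W *v y) = 0"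
    using We sym_matrix_inner[OF sym, of ?e y] yj by (simp_all add: inner_axis inner_axis')
  have "x \<bullet> (W *v x) = (y + x $ j *\<^sub>R ?e) \<bullet> (W *v (y + x $ j *\<^sub>R ?e))"
    using xy by simp
  also have "\<dots> = y \<bullet> (W *v y) + (x $ j)\<^sup>2"
    using We ye by (simp add: matrix_vector_right_distrib matrix_vector_mult_scaleR inner_add_left
        inner_add_right power2_eq_square)
  finally have q: "x \<bullet> (W *v x) = y \<bullet> (W *v y) + (x $ j)\<^sup>2" .
  have "y \<bullet> (W *v y) = y \<bullet> (bordered W v \<sigma> j *v y)"
    by (simp add: bordered_mult_vec[OF W j v] yj inner_add_right inner_axis)
  moreover have "y \<noteq> 0 \<Longrightarrow> y \<bullet> (bordered W v \<sigma> j *v y) > 0" using spd by (simp add: sym_pos_def_def)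
  ultimately show "x \<bullet> (W *v x) > 0"
    using \<open>x \<noteq> 0\<close> q xy by (cases "y = 0") (auto simp: add_pos_nonneg)
qed

lemma bordered_decomposition:
  fixes M :: "real^'k^'k"
  assumes M: "id_outside (insert j J) M" and j: "j \<notin> J" and spd: "sym_pos_def M"
  obtains W v \<sigma> where "M = bordered W v \<sigma> j" "sym_pos_def W" "bordered_matrix W J j v"
     "\<And>i. i \<notin> J \<Longrightarrow> v $ i = 0"
proof -
  define W where "W = (\<chi> i k. if i = j \<or> k = j then (if i = k then 1 else 0) else M $ i $ k)"
  define v where "v = (\<chi> i. if i = j then 0 else M $ i $ j)"
  have sym: "transpose M = M" using spd by (simp add: sym_pos_def_def)
  then have sym': "M $ i $ k = M $ k $ i" for i k by (metis transpose_def vec_lambda_beta)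
  have W: "id_outside J W" and v: "\<And>i. i \<notin> J \<Longrightarrow> v $ i = 0"
    using M j by (auto simp: id_outside_def W_def v_def)
  have tW: "transpose W = W" using sym' by (auto simp: W_def transpose_def vec_eq_iff)
  have M': "M = bordered W v (M $ j $ j) j"
    using sym' by (auto simp: vec_eq_iff bordered_def W_def v_def)
  have spdW: "sym_pos_def W"
    using sym_pos_def_bordered_imp[OF W j _ tW, of v "M $ j $ j"] spd M' v[OF j] by simp
  moreover have "bordered_matrix W J j v"
    by (unfold_locales) (use W j v tW spdW in \<open>auto intro: sym_pos_def_invertible\<close>)
  ultimately show ?thesis using M' v that by blast
qed

text \<open>
  Induction on the index set: completing the square writes the form of the bordered matrix as the form of
  \<open>W\<close> at a linear image of \<open>y\<close>, because the identity entry of \<open>W\<close> at \<open>j\<close> can absorb \<open>sqrt u * y $ j\<close>.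
\<close>

lemma sym_pos_def_factor_id_outside:
  fixes M :: "real^'k^'k"
  assumes "finite J" "id_outside J M" "sym_pos_def M"
  shows "\<exists>R::real^'k^'k. \<forall>x. x \<bullet> (M *v x) = (R *v x) \<bullet> (R *v x)"
  using assms
proof (induction J arbitrary: M)
  case empty
  then have "M = mat 1" by (simp add: id_outside_def mat_def vec_eq_iff)
  then show ?case by (intro exI[of _ "mat 1"]) simp
next
  case (insert j J)
  obtain W v \<sigma> where M: "M = bordered W v \<sigma> j" and spd: "sym_pos_def W" and bm: "bordered_matrix W J j v"
    using bordered_decomposition[OF insert.prems(1) insert.hyps(2) insert.prems(2)] by metis
  interpret bordered_matrix W J j v \<sigma> by (rule bm)
  obtain R :: "real^'k^'k" where R: "\<And>x. x \<bullet> (W *v x) = (R *v x) \<bullet> (R *v x)"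
    using insert.IH[OF W spd] by blast
  have u: "u > 0" using schur_complement_pos insert.prems(2) M by simp
  define f where "f = (\<lambda>y. y - y $ j *\<^sub>R e + y $ j *\<^sub>R w + (sqrt u * y $ j) *\<^sub>R e)"
  have lin: "linear f"
    by (intro linearI) (simp_all add: f_def algebra_simps vec_eq_iff)
  have "y \<bullet> (M *v y) = ((R ** matrix f) *v y) \<bullet> ((R ** matrix f) *v y)" for y
  proof -
    define z where "z = y - y $ j *\<^sub>R e + y $ j *\<^sub>R w"
    have zj: "z $ j = 0" by (simp add: z_def wj)
    have "((R ** matrix f) *v y) \<bullet> ((R ** matrix f) *v y) = f y \<bullet> (W *v f y)"
      by (simp add: matrix_vector_mul_assoc[symmetric] matrix_works lin R)
    also have "f y = z + (sqrt u * y $ j) *\<^sub>R e" by (simp add: f_def z_def)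
    also have "\<dots> \<bullet> (W *v \<dots>) = z \<bullet> (W *v z) + u * (y $ j)\<^sup>2"
      using zj u by (simp add: matrix_vector_right_distrib matrix_vector_mult_scaleR inner_add_left
          inner_add_right We
        inner_axis inner_axis' W_mult_vec_j power2_eq_square)
    finally show ?thesis by (simp add: quadratic_form z_def M)
  qed
  then show ?case using M by blast
qed

lemma sym_pos_def_factor:
  fixes M :: "real^'k^'k"
  assumes "sym_pos_def M"
  obtains R :: "real^'k^'k" where "M = transpose R ** R"
proof -
  have "id_outside UNIV M" by (simp add: id_outside_def)
  then obtain R :: "real^'k^'k" where R: "\<And>x. x \<bullet> (M *v x) = (R *v x) \<bullet> (R *v x)"
    using sym_pos_def_factor_id_outside[OF finite_class.finite_UNIV _ assms] by blast
  have sym: "transpose M = M" using assms by (simp add: sym_pos_def_def)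
  have "y \<bullet> (M *v x) = (R *v y) \<bullet> (R *v x)" for x y
    using R[of "x + y"] R[of x] R[of y] sym_matrix_inner[OF sym, of x y]
    by (simp add: matrix_vector_right_distrib inner_add_left inner_add_right inner_commute)
  then have "y \<bullet> (M *v x) = y \<bullet> ((transpose R ** R) *v x)" for x y
    by (simp add: matrix_vector_mul_assoc[symmetric] inner_transpose del: transpose_matrix_vector)
  then have "M *v x = (transpose R ** R) *v x" for x
    by (metis vector_eq_ldot)
  then have "M = transpose R ** R" by (simp add: matrix_eq)
  then show ?thesis by (rule that)
qed

lemma det_sym_pos_def:
  fixes M :: "real^'k^'k"
  assumes "sym_pos_def M" shows "det M > 0"
proof -
  obtain R :: "real^'k^'k" where "M = transpose R ** R" using sym_pos_def_factor[OF assms] .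
  then have "det M = (det R)\<^sup>2" by (simp add: det_mul power2_eq_square)
  moreover have "det M \<noteq> 0" using sym_pos_def_invertible[OF assms] by (simp add: invertible_det_nz)
  ultimately show ?thesis by (metis zero_less_power2 zero_eq_power2)
qed

text \<open>
  With a factor \<open>R\<close> of \<open>\<Sigma>\<^sup>-\<^sup>1\<close> a trace against \<open>\<Sigma>\<^sup>-\<^sup>1\<close> becomes a sum over the rows of \<open>R\<close>, and every
  inequality between quadratic forms turns into one between traces.
\<close>

lemma trace_mult_gram:
  fixes R A :: "real^'k^'k"
  shows "trace (A ** (transpose R ** R)) = (\<Sum>i\<in>UNIV. row i R \<bullet> (A *v row i R))"
proof -
  have "trace (A ** (transpose R ** R)) = trace (R ** (A ** transpose R))"
    using trace_mul_sym[of "A ** transpose R" R] by (simp add: matrix_mul_assoc)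
  also have "\<dots> = (\<Sum>i\<in>UNIV. row i R \<bullet> (A *v row i R))"
    by (simp add: trace_def matrix_matrix_mult_def transpose_def matrix_vector_mult_def inner_vec_def row_def)
  finally show ?thesis .
qed

lemma inner_gram: "x \<bullet> ((transpose E ** E) *v x) = (E *v x) \<bullet> (E *v x)"
  for E :: "real^'k^'n"
  by (simp add: matrix_vector_mul_assoc[symmetric] inner_transpose del: transpose_matrix_vector)

lemma sum_norm_rows_swap:
  fixes R :: "real^'k^'k" and B :: "real^'k^'p"
  shows "(\<Sum>i\<in>UNIV. (B *v row i R) \<bullet> (B *v row i R)) = (\<Sum>j\<in>UNIV. B $ j \<bullet> ((transpose R ** R) *v B $ j))"
proof -
  have "(B *v row i R) $ j = (R *v B $ j) $ i" for i j
    by (simp add: matrix_vector_mult_def row_def mult.commute)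
  then have "(\<Sum>i\<in>UNIV. (B *v row i R) \<bullet> (B *v row i R))
      = (\<Sum>i\<in>UNIV. \<Sum>j\<in>UNIV. (R *v B $ j) $ i * (R *v B $ j) $ i)"
    by (simp add: inner_vec_def)
  also have "\<dots> = (\<Sum>j\<in>UNIV. (R *v B $ j) \<bullet> (R *v B $ j))"
    unfolding inner_vec_def by (subst sum.swap) simp
  finally show ?thesis by (simp add: inner_gram)
qed

section \<open>Gaussian integrals\<close>

lemma borel_measurable_vec:
  fixes f :: "'a \<Rightarrow> 'b::euclidean_space^'n"
  assumes "\<And>i. (\<lambda>x. f x $ i) \<in> borel_measurable M"
  shows "f \<in> borel_measurable M"
proof (subst borel_measurable_euclidean_space, intro ballI)
  fix b :: "'b^'n" assume "b \<in> Basis"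
  then obtain i c where "b = axis i c" "c \<in> Basis" by (auto simp: Basis_vec_def)
  then show "(\<lambda>x. f x \<bullet> b) \<in> borel_measurable M" using assms by (simp add: inner_axis)
qed

lemma borel_measurable_vec_nth:
  fixes f :: "'a \<Rightarrow> 'b::euclidean_space^'n"
  assumes "f \<in> borel_measurable M"
  shows "(\<lambda>x. f x $ i) \<in> borel_measurable M"
  by (rule measurable_compose[OF assms]) (auto intro!: borel_measurable_continuous_onI continuous_intros)

lemma borel_measurable_matrix_vector_mult[measurable (raw)]:
  fixes A :: "'a \<Rightarrow> real^'m^'n" and x :: "'a \<Rightarrow> real^'m"
  assumes "A \<in> borel_measurable M" "x \<in> borel_measurable M"
  shows "(\<lambda>s. A s *v x s) \<in> borel_measurable M"
  by (intro borel_measurable_vec)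
    (auto simp: matrix_vector_mult_def intro!: borel_measurable_sum borel_measurable_times
        borel_measurable_vec_nth assms)

lemma gaussian_integral_real:
  fixes a c :: real
  assumes "a > 0"
  shows "(\<integral>\<^sup>+x. ennreal (exp (- a * (x + c)\<^sup>2)) \<partial>lborel) = ennreal (sqrt (pi / a))"
proof -
  define \<sigma> where "\<sigma> = sqrt (1 / (2 * a))"
  have s2: "\<sigma>\<^sup>2 = 1 / (2 * a)" and s: "\<sigma> > 0" using assms by (simp_all add: \<sigma>_def)
  have k: "sqrt (2 * pi * \<sigma>\<^sup>2) = sqrt (pi / a)" using s2 by simp
  have "exp (- a * (x + c)\<^sup>2) = sqrt (pi / a) * normal_density (-c) \<sigma> x" for x
    using assms unfolding normal_density_def k by (simp add: s2 field_simps)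
  then have "(\<integral>\<^sup>+x. ennreal (exp (- a * (x + c)\<^sup>2)) \<partial>lborel) =
     (\<integral>\<^sup>+x. ennreal (sqrt (pi / a)) * ennreal (normal_density (-c) \<sigma> x) \<partial>lborel)"
    using assms by (simp add: ennreal_mult)
  also have "\<dots> = ennreal (sqrt (pi / a)) * (\<integral>\<^sup>+x. ennreal (normal_density (-c) \<sigma> x) \<partial>lborel)"
    by (rule nn_integral_cmult) simp
  also have "(\<integral>\<^sup>+x. ennreal (normal_density (-c) \<sigma> x) \<partial>lborel) = 1"
    using prob_space.emeasure_space_1[OF prob_space_normal_density[of \<sigma> "-c"]] s
    by (simp add: emeasure_density)
  finally show ?thesis by simp
qed

interpretation lborel_product: product_sigma_finite "\<lambda>_. lborel :: 'a::euclidean_space measure"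
  by standard

text \<open>
  The index map \<open>h\<close> allows the coordinates of the vector to be a part of a larger family, such as a column
  of a matrix.
\<close>

definition supp_vec :: "'k set \<Rightarrow> ('k \<Rightarrow> 'b) \<Rightarrow> ('b \<Rightarrow> 'a::zero) \<Rightarrow> 'a^'k" where
  "supp_vec J h s = (\<chi> i. if i \<in> J then s (h i) else 0)"

lemma borel_measurable_supp_vec[measurable]:
  "(supp_vec J h :: _ \<Rightarrow> 'a::euclidean_space^'k) \<in> borel_measurable (\<Pi>\<^sub>M i\<in>h ` J. lborel)"
proof (rule borel_measurable_vec)
  fix i :: 'k show "(\<lambda>s. (supp_vec J h s :: 'a^'k) $ i) \<in> borel_measurable (\<Pi>\<^sub>M i\<in>h ` J. lborel)"
    by (cases "i \<in> J") (simp_all add: supp_vec_def)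
qed

text \<open>
  The coordinates are integrated one by one by completing the square. The next coordinate shifts the centre
  of the remaining Gaussian, which is why the statement carries an arbitrary centre \<open>c\<close>.
\<close>

lemma gaussian_integral_id_outside:
  fixes M :: "real^'k^'k" and h :: "'k \<Rightarrow> 'b"
  assumes "finite J" "inj h" "b > 0" "id_outside J M" "sym_pos_def M" "\<And>i. i \<notin> J \<Longrightarrow> c $ i = 0"
  shows "(\<integral>\<^sup>+s. ennreal (exp (- b * ((supp_vec J h s + c) \<bullet> (M *v (supp_vec J h s + c))))) \<partial>(\<Pi>\<^sub>M i\<in>h `
      J. lborel))
      = ennreal (sqrt (pi / b) ^ card J / sqrt (det M))"
  using assms
proof (induction J arbitrary: M c)
  case empty
  then have "M = mat 1" by (simp add: id_outside_def mat_def vec_eq_iff)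
  moreover have "c = 0" using empty by (simp add: vec_eq_iff)
  moreover have "(supp_vec {} h s :: real^'k) = 0" for s by (simp add: supp_vec_def vec_eq_iff)
  ultimately show ?case by (simp add: PiM_empty nn_integral_count_space_finite)
next
  case (insert j J)
  let ?P = "\<Pi>\<^sub>M i\<in>h ` J. (lborel :: real measure)"
  let ?v = "supp_vec J h :: ('b \<Rightarrow> real) \<Rightarrow> real^'k" and ?v' = "supp_vec (insert j J) h :: ('b \<Rightarrow> real) \<Rightarrow>
      real^'k"
  obtain W v \<sigma> where M: "M = bordered W v \<sigma> j" and spd: "sym_pos_def W" and bm: "bordered_matrix W J j v"
    and v: "\<And>i. i \<notin> J \<Longrightarrow> v $ i = 0"
    using bordered_decomposition[OF insert.prems(3) insert.hyps(2) insert.prems(4)] by metis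
  interpret bordered_matrix W J j v \<sigma> by (rule bm)
  have u: "u > 0" using schur_complement_pos insert.prems M by simp
  have w: "w $ i = 0" if "i \<notin> J" for i
    using W_mult_vec_nth[OF that, of w] v[OF that] by (simp add: Ww)
  let ?q = "\<lambda>z. z \<bullet> (M *v z)"
  let ?K = "sqrt (pi / b) ^ card J / sqrt (det W)"
  have detW: "det W > 0" using spd by (rule det_sym_pos_def)
  have hj: "h j \<notin> h ` J" using insert.hyps(2) \<open>inj h\<close> by (auto dest: injD)
  have q: "?q (?v' (s(h j := t)) + c) =
     (?v s + (c - c $ j *\<^sub>R e + (t + c $ j) *\<^sub>R w)) \<bullet> (W *v (?v s + (c - c $ j *\<^sub>R e + (t + c $ j) *\<^sub>R w)))
     + u * (t + c $ j)\<^sup>2" for s t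
  proof -
    let ?z = "?v' (s(h j := t)) + c"
    have zj: "?z $ j = t + c $ j" by (simp add: supp_vec_def)
    have "?v' (s(h j := t)) = ?v s + t *\<^sub>R e"
      using hj insert.hyps(2) \<open>inj h\<close> by (auto simp: supp_vec_def vec_eq_iff axis_def dest: injD)
    then have z: "?z - ?z $ j *\<^sub>R e + ?z $ j *\<^sub>R w = ?v s + (c - c $ j *\<^sub>R e + (t + c $ j) *\<^sub>R w)"
      unfolding zj by (simp add: algebra_simps)
    show ?thesis unfolding M quadratic_form[of ?z] z unfolding zj ..
  qed
  have IH: "(\<integral>\<^sup>+s. ennreal (exp (- b * ?q (?v' (s(h j := t)) + c))) \<partial>?P)
     = ennreal (exp (- (b * u) * (t + c $ j)\<^sup>2)) * ennreal ?K" for t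
  proof -
    let ?c = "c - c $ j *\<^sub>R e + (t + c $ j) *\<^sub>R w"
    have c': "?c $ i = 0" if "i \<notin> J" for i
      using that insert.prems(5)[of i] w[OF that] by (cases "i = j") (auto simp: axis_def)
    have "ennreal (exp (- b * ?q (?v' (s(h j := t)) + c))) =
       ennreal (exp (- (b * u) * (t + c $ j)\<^sup>2)) *
       ennreal (exp (- b * ((?v s + ?c) \<bullet> (W *v (?v s + ?c)))))" for s
      unfolding q by (simp add: ennreal_mult[symmetric] exp_add[symmetric] algebra_simps)
    then have "(\<integral>\<^sup>+s. ennreal (exp (- b * ?q (?v' (s(h j := t)) + c))) \<partial>?P) =
       (\<integral>\<^sup>+s. ennreal (exp (- (b * u) * (t + c $ j)\<^sup>2)) *
       ennreal (exp (- b * ((?v s + ?c) \<bullet> (W *v (?v s + ?c))))) \<partial>?P)"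
      by simp
    also have "\<dots> = ennreal (exp (- (b * u) * (t + c $ j)\<^sup>2)) * (\<integral>\<^sup>+s.
       ennreal (exp (- b * ((?v s + ?c) \<bullet> (W *v (?v s + ?c))))) \<partial>?P)"
      by (rule nn_integral_cmult) measurable
    also have "\<dots> = ennreal (exp (- (b * u) * (t + c $ j)\<^sup>2)) * ennreal ?K"
      using insert.IH[OF \<open>inj h\<close> \<open>b > 0\<close> W spd c'] by simp
    finally show ?thesis .
  qed
  have "(\<integral>\<^sup>+s. ennreal (exp (- b * ?q (?v' s + c))) \<partial>(\<Pi>\<^sub>M i\<in>h ` insert j J. lborel)) =
      (\<integral>\<^sup>+t. \<integral>\<^sup>+s. ennreal (exp (- b * ?q (?v' (s(h j := t)) + c))) \<partial>?P \<partial>lborel)"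
    unfolding image_insert
    by (rule lborel_product.product_nn_integral_insert_rev)
      (use insert.hyps hj in \<open>simp_all add: image_insert[symmetric] del: image_insert\<close>)
  also have "\<dots> = (\<integral>\<^sup>+t. ennreal (exp (- (b * u) * (t + c $ j)\<^sup>2)) * ennreal ?K \<partial>lborel)"
    unfolding IH ..
  also have "\<dots> = (\<integral>\<^sup>+t. ennreal (exp (- (b * u) * (t + c $ j)\<^sup>2)) \<partial>lborel) * ennreal ?K"
    by (rule nn_integral_multc) measurable
  also have "\<dots> = ennreal (sqrt (pi / (b * u)) * ?K)"
    using gaussian_integral_real[of "b * u" "c $ j"] \<open>b > 0\<close> u detW by (simp add: ennreal_mult[symmetric])
  also have "sqrt (pi / (b * u)) * ?K = sqrt (pi / b) ^ card (insert j J) / sqrt (det M)"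
    using insert.hyps by (simp add: M det_bordered real_sqrt_mult real_sqrt_divide)
  finally show ?case .
qed

lemma lborel_vec_eq_distr:
  fixes h :: "'n::finite \<Rightarrow> 'b"
  assumes "inj h"
  shows "(lborel :: ('a::euclidean_space^'n) measure) = distr (\<Pi>\<^sub>M i\<in>range h. lborel) borel (supp_vec UNIV h)"
proof (rule lborel_eqI)
  fix l u :: "'a^'n" assume lu: "\<And>b. b \<in> Basis \<Longrightarrow> l \<bullet> b \<le> u \<bullet> b"
  have lu': "l $ i \<bullet> b \<le> u $ i \<bullet> b" if "b \<in> Basis" for i b
    using lu[of "axis i b"] that by (auto simp: Basis_vec_def inner_axis)
  have B: "(Basis :: ('a^'n) set) = (\<lambda>(i, b). axis i b) ` (UNIV \<times> Basis)" by (auto simp: Basis_vec_def)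
  have inj: "inj_on (\<lambda>(i, b). axis i b :: 'a^'n) (UNIV \<times> Basis)"
    by (auto simp: inj_on_def axis_eq_axis nonzero_Basis)
  have box: "x \<in> box l u \<longleftrightarrow> (\<forall>i. x $ i \<in> box (l $ i) (u $ i))" for x
    unfolding mem_box B by (auto simp: inner_axis)
  have fin: "finite (range h)" by simp
  have *: "supp_vec UNIV h -` box l u \<inter> space (\<Pi>\<^sub>M i\<in>range h. lborel)
      = (\<Pi>\<^sub>E i\<in>range h. box (l $ inv h i) (u $ inv h i))"
    using assms by (auto simp: supp_vec_def box space_PiM PiE_iff)
  have "emeasure (distr (\<Pi>\<^sub>M i\<in>range h. lborel) borel (supp_vec UNIV h)) (box l u) =
     emeasure (\<Pi>\<^sub>M i\<in>range h. lborel) (\<Pi>\<^sub>E i\<in>range h. box (l $ inv h i) (u $ inv h i))"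
    by (subst emeasure_distr) (simp_all add: *)
  also have "\<dots> = (\<Prod>i\<in>range h. emeasure lborel (box (l $ inv h i) (u $ inv h i)))"
    by (rule lborel_product.emeasure_PiM) (use fin in auto)
  also have "\<dots> = ennreal (\<Prod>i\<in>UNIV. \<Prod>b\<in>Basis. (u $ i - l $ i) \<bullet> b)"
    using assms lu' by (simp add: prod.reindex prod_ennreal emeasure_lborel_box_eq inner_diff_left
        prod_nonneg)
  also have "(\<Prod>i\<in>UNIV. \<Prod>b\<in>Basis. (u $ i - l $ i) \<bullet> b) = (\<Prod>b\<in>Basis. (u - l) \<bullet> b)"
    unfolding B prod.reindex[OF inj] by (simp add: prod.cartesian_product case_prod_beta inner_axis)
  finally show "emeasure (distr (\<Pi>\<^sub>M i\<in>range h. lborel) borel (supp_vec UNIV h)) (box l u)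
      = ennreal (\<Prod>b\<in>Basis. (u - l) \<bullet> b)" .
qed simp

lemma gaussian_integral_vec:
  fixes M :: "real^'k^'k"
  assumes "b > 0" "sym_pos_def M"
  shows "(\<integral>\<^sup>+x. ennreal (exp (- b * (x \<bullet> (M *v x)))) \<partial>lborel)
      = ennreal (sqrt (pi / b) ^ CARD('k) / sqrt (det M))"
proof -
  have "(\<integral>\<^sup>+x. ennreal (exp (- b * (x \<bullet> (M *v x)))) \<partial>lborel) =
     (\<integral>\<^sup>+s. ennreal (exp (- b * (supp_vec UNIV id s \<bullet> (M *v supp_vec UNIV id s)))) \<partial>(\<Pi>\<^sub>M i\<in>range id. lborel))"
    by (subst lborel_vec_eq_distr[OF inj_on_id], subst nn_integral_distr) measurable
  then show ?thesis
    using gaussian_integral_id_outside[of UNIV id b M 0] assms by (simp add: id_outside_def)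
qed

lemma gaussian_integral_matrix:
  fixes M :: "real^'k^'k"
  assumes "b > 0" "sym_pos_def M"
  shows "(\<integral>\<^sup>+(B::real^'k^'p). ennreal (exp (- b * (\<Sum>i\<in>UNIV. B $ i \<bullet> (M *v B $ i)))) \<partial>lborel)
     = ennreal ((sqrt (pi / b) ^ CARD('k) / sqrt (det M)) ^ CARD('p))"
proof -
  let ?f = "\<lambda>x. ennreal (exp (- b * (x \<bullet> (M *v x))))"
  have f: "ennreal (exp (- b * (\<Sum>i\<in>UNIV. B $ i \<bullet> (M *v B $ i)))) = (\<Prod>i\<in>UNIV. ?f (B $ i))"
      for B :: "real^'k^'p"
    by (simp add: prod_ennreal exp_sum sum_distrib_left sum_negf[symmetric])
  have [measurable]: "(\<lambda>B::real^'k^'p. \<Prod>i\<in>UNIV. ?f (B $ i)) \<in> borel_measurable borel"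
    by (intro borel_measurable_prod_ennreal measurable_compose[OF borel_measurable_vec_nth]) auto
  have "(\<integral>\<^sup>+(B::real^'k^'p). (\<Prod>i\<in>UNIV. ?f (B $ i)) \<partial>lborel) =
     (\<integral>\<^sup>+s. (\<Prod>i\<in>(UNIV::'p set). ?f ((supp_vec UNIV id s) $ i)) \<partial>(\<Pi>\<^sub>M i\<in>range id. lborel))"
    by (subst lborel_vec_eq_distr[OF inj_on_id], subst nn_integral_distr) measurable
  also have "\<dots> = (\<integral>\<^sup>+s. (\<Prod>i\<in>(UNIV::'p set). ?f (s i)) \<partial>(\<Pi>\<^sub>M i\<in>UNIV. lborel))"
    by (simp add: supp_vec_def)
  also have "\<dots> = (\<Prod>i\<in>(UNIV::'p set). \<integral>\<^sup>+x. ?f x \<partial>lborel)"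
    by (rule lborel_product.product_nn_integral_prod) auto
  also have "\<dots> = ennreal ((sqrt (pi / b) ^ CARD('k) / sqrt (det M)) ^ CARD('p))"
    using det_sym_pos_def[OF assms(2)] \<open>b > 0\<close>
    by (subst gaussian_integral_vec[OF assms]) (simp add: ennreal_power)
  finally show ?thesis unfolding f .
qed

section \<open>Measurability of matrix operations\<close>

lemma borel_measurable_det[measurable (raw)]:
  fixes A :: "'a \<Rightarrow> real^'n^'n"
  assumes "A \<in> borel_measurable M"
  shows "(\<lambda>s. det (A s)) \<in> borel_measurable M"
  unfolding det_def
  by (intro borel_measurable_sum borel_measurable_times borel_measurable_prod borel_measurable_vec_nth
      assms) auto

text \<open>
  Cramer's rule gives the entries where the determinant does not vanish. Elsewhere \<open>matrix_inv\<close> is the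
  choice from an empty set, hence constant.
\<close>

lemma borel_measurable_matrix_inv[measurable (raw)]:
  fixes A :: "'a \<Rightarrow> real^'n^'n"
  assumes "A \<in> borel_measurable M"
  shows "(\<lambda>s. matrix_inv (A s)) \<in> borel_measurable M"
proof -
  define cof :: "real^'n^'n \<Rightarrow> real^'n^'n" where
    "cof B = (\<chi> k l. det (\<chi> i j. if j = k then axis l 1 $ i else B $ i $ j) / det B)" for B
  have eq: "matrix_inv B = (if det B \<noteq> 0 then cof B else (SOME x. False))" for B :: "real^'n^'n"
  proof (cases "det B = 0")
    case True
    then have "\<not> invertible B" by (simp add: invertible_det_nz)
    then have "(\<lambda>A'. B ** A' = mat 1 \<and> A' ** B = mat 1) = (\<lambda>_. False)" by (auto simp: invertible_def)
    then show ?thesis using True by (simp add: matrix_inv_def)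
  next
    case False
    have "B *v (\<chi> k. cof B $ k $ l) = axis l 1" for l
      using cramer[OF False, of "(\<chi> k. cof B $ k $ l)" "axis l 1"] by (simp add: cof_def)
    then have "(B ** cof B) $ i $ l = axis l 1 $ i" for i l
      by (simp add: matrix_matrix_mult_def matrix_vector_mult_def vec_eq_iff)
    then have "B ** cof B = mat 1" by (auto simp: vec_eq_iff mat_def axis_def)
    then show ?thesis using False by (simp add: matrix_inv_eqI)
  qed
  have "(\<lambda>s. cof (A s)) \<in> borel_measurable M"
  proof (intro borel_measurable_vec)
    fix k l
    have "(\<lambda>s. \<chi> i j. if j = k then axis l 1 $ i else A s $ i $ j) \<in> borel_measurable M"
    proof (intro borel_measurable_vec)
      fix i j show "(\<lambda>s. (\<chi> i j. if j = k then axis l 1 $ i else A s $ i $ j) $ i $ j) \<in> borel_measurable M"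
        by (cases "j = k") (auto intro!: borel_measurable_vec_nth assms)
    qed
    then show "(\<lambda>s. cof (A s) $ k $ l) \<in> borel_measurable M"
      unfolding cof_def using assms by simp
  qed
  then show ?thesis unfolding eq using assms by simp
qed

lemma borel_measurable_trace[measurable (raw)]:
  fixes A :: "'a \<Rightarrow> real^'n^'n"
  assumes "A \<in> borel_measurable M"
  shows "(\<lambda>s. trace (A s)) \<in> borel_measurable M"
  unfolding trace_def by (intro borel_measurable_sum borel_measurable_vec_nth assms)

text \<open>Positive definiteness is a countable union of closed conditions \<open>\<bar>x\<bar>\<^sup>2 / (n + 1) \<le> x \<bullet> (\<Sigma> *v x)\<close>.\<close>

lemma sets_sym_pos_def[measurable]: "{\<Sigma>::real^'r^'r. sym_pos_def \<Sigma>} \<in> sets borel"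
proof -
  have "sym_pos_def \<Sigma> \<longleftrightarrow> transpose \<Sigma> = \<Sigma> \<and> (\<exists>n. \<forall>x. 1 / real (Suc n) * (x \<bullet> x) \<le> x \<bullet> (\<Sigma> *v x))"
      for \<Sigma> :: "real^'r^'r"
  proof safe
    assume *: "sym_pos_def \<Sigma>"
    obtain c where c: "c > 0" "\<And>x. c * (x \<bullet> x) \<le> x \<bullet> (\<Sigma> *v x)" using sym_pos_def_lower_bound[OF *] by blast
    obtain n where n: "1 / real (Suc n) < c" using nat_approx_posE[OF \<open>c > 0\<close>] .
    show "\<exists>n. \<forall>x. 1 / real (Suc n) * (x \<bullet> x) \<le> x \<bullet> (\<Sigma> *v x)"
    proof (intro exI allI)
      fix x show "1 / real (Suc n) * (x \<bullet> x) \<le> x \<bullet> (\<Sigma> *v x)"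
        using mult_right_mono[OF less_imp_le[OF n], of "x \<bullet> x"] c(2)[of x] by (simp del: of_nat_Suc)
    qed
  next
    fix n assume t: "transpose \<Sigma> = \<Sigma>" and n: "\<forall>x. 1 / real (Suc n) * (x \<bullet> x) \<le> x \<bullet> (\<Sigma> *v x)"
    have "x \<bullet> (\<Sigma> *v x) > 0" if "x \<noteq> 0" for x
    proof -
      have "0 < 1 / real (Suc n) * (x \<bullet> x)" using that by simp
      then show ?thesis using n by (meson less_le_trans)
    qed
    then show "sym_pos_def \<Sigma>" using t by (simp add: sym_pos_def_def)
  qed (simp add: sym_pos_def_def)
  then have "{\<Sigma>::real^'r^'r. sym_pos_def \<Sigma>} = {\<Sigma>. \<forall>i j. \<Sigma> $ i $ j = \<Sigma> $ j $ i} \<inter>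
     (\<Union>n. {\<Sigma>. \<forall>x. 1 / real (Suc n) * (x \<bullet> x) \<le> x \<bullet> (\<Sigma> *v x)})"
    by (auto simp: transpose_def vec_eq_iff)
  also have "\<dots> \<in> sets borel"
  proof (intro sets.Int sets.countable_UN borel_closed image_subsetI)
    show "closed {\<Sigma>::real^'r^'r. \<forall>i j. \<Sigma> $ i $ j = \<Sigma> $ j $ i}"
      by (intro closed_Collect_all closed_Collect_eq continuous_intros)
    show "closed {\<Sigma>::real^'r^'r. \<forall>x. 1 / real (Suc n) * (x \<bullet> x) \<le> x \<bullet> (\<Sigma> *v x)}" for n
      unfolding matrix_vector_mult_def
      by (intro closed_Collect_all closed_Collect_le continuous_intros)
  qed
  finally show ?thesis .
qed

lemma inverse_gamma_integral_finite:
  fixes \<kappa> c :: real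
  assumes "\<kappa> > 1" "c > 0"
  shows "(\<integral>\<^sup>+u. indicator {0<..} u * ennreal (u powr (- \<kappa>) * exp (- (c / u))) \<partial>lborel) < \<infinity>"
proof -
  obtain N :: nat where N: "real N \<ge> \<kappa>" using real_arch_simple by blast
  have N0: "N > 0" using N assms by (cases N) auto
  define K where "K = (real N / c) ^ N"
  have K: "K > 0" using assms N0 by (simp add: K_def)
  have small: "u powr (- \<kappa>) * exp (- (c / u)) \<le> K" if "0 < u" "u \<le> 1" for u
  proof -
    have "(c / u / real N) ^ N \<le> (1 + c / u / real N) ^ N"
      using that assms by (intro power_mono) auto
    also have "\<dots> \<le> exp (c / u)"
      using that assms N0 by (intro exp_ge_one_plus_x_over_n_power_n) (auto intro: order_trans[of _ 0])
    finally have "(c / u / real N) ^ N \<le> exp (c / u)" .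
    then have "exp (- (c / u)) \<le> K * u ^ N"
      using that assms N0 by (simp add: K_def exp_minus field_simps power_divide power_mult_distrib)
    then have "u powr (- \<kappa>) * exp (- (c / u)) \<le> u powr (- \<kappa>) * (K * u powr N)"
      using that by (intro mult_left_mono) (auto simp: powr_realpow)
    also have "\<dots> = K * u powr (N - \<kappa>)" using that by (simp add: powr_add[symmetric])
    also have "\<dots> \<le> K * 1" using that N K by (intro mult_left_mono powr_le1) auto
    finally show ?thesis by simp
  qed
  have large: "u powr (- \<kappa>) * exp (- (c / u)) \<le> u powr (- \<kappa>)" if "1 \<le> u" for u
    using that assms by (simp add: mult_left_le)
  have "(\<integral>\<^sup>+u. indicator {0<..} u * ennreal (u powr (- \<kappa>) * exp (- (c / u))) \<partial>lborel) \<le>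
     (\<integral>\<^sup>+u. ennreal K * indicator {0..1} u + ennreal (u powr (- \<kappa>)) * indicator {1..} u \<partial>lborel)"
  proof (intro nn_integral_mono)
    fix u :: real
    show "indicator {0<..} u * ennreal (u powr (- \<kappa>) * exp (- (c / u))) \<le>
      ennreal K * indicator {0..1} u + ennreal (u powr (- \<kappa>)) * indicator {1..} u"
      using small[of u] large[of u] K by (auto simp: indicator_def ennreal_leI intro: add_increasing)
  qed
  also have "\<dots> = ennreal K + (\<integral>\<^sup>+u. ennreal (u powr (- \<kappa>)) * indicator {1..} u \<partial>lborel)"
    by (simp add: nn_integral_add nn_integral_cmult)
  also have "(\<integral>\<^sup>+u. ennreal (u powr (- \<kappa>)) * indicator {1..} u \<partial>lborel)
      = ennreal (0 - (1 powr (1 - \<kappa>) / (1 - \<kappa>)))"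
  proof (rule nn_integral_FTC_atLeast[where F = "\<lambda>u. u powr (1 - \<kappa>) / (1 - \<kappa>)"])
    show "((\<lambda>u. u powr (1 - \<kappa>) / (1 - \<kappa>)) has_real_derivative u powr (- \<kappa>)) (at u)" if "1 \<le> u" for u
      using that assms by (auto intro!: derivative_eq_intros)
    show "((\<lambda>u. u powr (1 - \<kappa>) / (1 - \<kappa>)) \<longlongrightarrow> 0) at_top"
      using assms tendsto_neg_powr[of "1 - \<kappa>" "\<lambda>x. x" at_top]
          by (auto intro!: tendsto_divide_zero filterlim_ident)
  qed auto
  also have "ennreal K + ennreal (0 - (1 powr (1 - \<kappa>) / (1 - \<kappa>))) < \<infinity>" by simp
  finally show ?thesis .
qed

section \<open>The inverse Wishart integral\<close>

definition sym_mat :: "'r::{finite,linorder} set \<Rightarrow> ('r \<times> 'r \<Rightarrow> real) \<Rightarrow> ('r, 'r) rmat" where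
  "sym_mat J s = (\<chi> i k. if i \<in> J \<and> k \<in> J then s (min i k, max i k) else if i = k then 1 else 0)"

definition upper_pairs :: "'r::{finite,linorder} set \<Rightarrow> ('r \<times> 'r) set" where
  "upper_pairs J = {(i, k). i \<le> k \<and> i \<in> J \<and> k \<in> J}"

lemma borel_measurable_sym_mat[measurable]:
  "sym_mat J \<in> borel_measurable (\<Pi>\<^sub>M c\<in>upper_pairs J. lborel)"
proof (intro borel_measurable_vec)
  fix i k show "(\<lambda>s. sym_mat J s $ i $ k) \<in> borel_measurable (\<Pi>\<^sub>M c\<in>upper_pairs J. lborel)"
  proof (cases "i \<in> J \<and> k \<in> J")
    case True
    then have "(min i k, max i k) \<in> upper_pairs J" by (auto simp: upper_pairs_def min_def max_def)
    with True show ?thesis by (simp add: sym_mat_def)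
  next
    case False
    then have "sym_mat J s $ i $ k = (if i = k then 1 else 0)" for s by (auto simp: sym_mat_def)
    then show ?thesis by simp
  qed
qed

text \<open>The unnormalized inverse Wishart density with scale matrix \<open>2 * c\<close> times the identity.\<close>

definition inv_wishart :: "real \<Rightarrow> real \<Rightarrow> real^'r^'r \<Rightarrow> ennreal" where
  "inv_wishart \<kappa> c \<Sigma> = indicator {\<Sigma>. sym_pos_def \<Sigma>} \<Sigma> * ennreal (det \<Sigma> powr (- \<kappa>) * exp
      (- c * trace (matrix_inv \<Sigma>)))"

lemma borel_measurable_inv_wishart[measurable]: "inv_wishart \<kappa> c \<in> borel_measurable borel"
  unfolding inv_wishart_def by measurable

text \<open>
  The substitution of the Schur complement \<open>u\<close> for the new diagonal entry is a translation. Given \<open>u\<close>, the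
  new column is Gaussian with the form \<open>\<bar>W\<^sup>-\<^sup>1 v\<bar>\<^sup>2 * c / u\<close>, and its integral is \<open>det W\<close> times a power of
  \<open>u\<close>. This factor \<open>det W\<close> turns the exponent \<open>\<kappa>\<close> into \<open>\<kappa> - 1\<close>.
\<close>

lemma inv_wishart_bordered_integral:
  fixes W :: "real^'r^'r" and h :: "'r \<Rightarrow> 'b"
  assumes J: "j \<notin> J" "inj h" and W: "id_outside J W" "transpose W = W" and c: "c > 0"
  shows "(\<integral>\<^sup>+y. inv_wishart \<kappa> c (bordered W (supp_vec J h y) (y (h j)) j) \<partial>(\<Pi>\<^sub>M i\<in>h ` insert j J. lborel)) \<le>
     inv_wishart (\<kappa> - 1) c W * (ennreal (exp c * sqrt (pi / c) ^ card J) *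
      (\<integral>\<^sup>+u. indicator {0<..} u * ennreal (u powr (- (\<kappa> - card J / 2)) * exp (- (c / u))) \<partial>lborel))"
    (is "?L \<le> _ * (_ * ?I)")
proof (cases "sym_pos_def W")
  case False
  then have "\<not> sym_pos_def (bordered W (supp_vec J h y) (y (h j)) j)" for y
    using sym_pos_def_bordered_imp[OF W(1) J(1) _ W(2), of "supp_vec J h y"] J(1) by (auto simp: supp_vec_def)
  then show ?thesis by (simp add: inv_wishart_def)
next
  case spd: True
  let ?P = "\<Pi>\<^sub>M i\<in>h ` J. (lborel :: real measure)"
  let ?v = "supp_vec J h :: ('b \<Rightarrow> real) \<Rightarrow> real^'r"
  have inv: "invertible W" using spd by (rule sym_pos_def_invertible)
  have bm: "bordered_matrix W J j (?v y)" for y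
    by (unfold_locales) (use W J spd inv in \<open>auto simp: supp_vec_def\<close>)
  define V where "V = matrix_inv W"
  define P where "P = transpose V ** V"
  define G where "G u v = indicator {0<..} u * ennreal (u powr (- \<kappa>) * exp
      (- c * ((1 + (V *v v) \<bullet> (V *v v)) / u)))" for u v
  \<comment> \<open>\<open>P\<close> is \<open>W\<^sup>-\<^sup>2\<close>, the form of the Gaussian variable \<open>v\<close>; \<open>G\<close> collects the dependence on \<open>u\<close> and \<open>v\<close>.\<close>
  define A where "A = det W powr (- \<kappa>) * exp (- c * (trace V - 1))"
  have A: "A \<ge> 0" by (simp add: A_def)
  have detW: "det W > 0" using spd by (rule det_sym_pos_def)
  have [measurable]: "(\<lambda>z. G (f z) (g z)) \<in> borel_measurable N" if [measurable]: "f
      \<in> borel_measurable N" "g \<in> borel_measurable N" for f g and N :: "'z measure"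
    unfolding G_def by measurable
  have le: "inv_wishart \<kappa> c (bordered W (?v y) t j) \<le> ennreal A * G (t - ?v y \<bullet> (V *v ?v y)) (?v y)" for y t
  proof (cases "sym_pos_def (bordered W (?v y) t j)")
    case True
    interpret bordered_matrix W J j "?v y" t by (rule bm)
    have u: "u > 0" using schur_complement_pos True by simp
    have u': "t - ?v y \<bullet> (V *v ?v y) = u" by (simp add: u_def w_def V_def)
    have "det M powr - \<kappa> * exp (- c * trace (matrix_inv M))
        = A * (u powr - \<kappa> * exp (- c * ((1 + w \<bullet> w) / u)))"
      using u detW by (simp add: det_bordered inv_bordered A_def V_def powr_mult exp_add[symmetric]
          algebra_simps)
    then show ?thesis using True u A unfolding u' by (simp add: inv_wishart_def G_def ennreal_mult w_def
        V_def)
  qed (simp add: inv_wishart_def)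
  have hj: "h j \<notin> h ` J" using J by (auto dest: injD)
  have upd: "?v (y(h j := t)) = ?v y" for y and t :: real
    using J by (auto simp: supp_vec_def vec_eq_iff dest: injD)
  have pidJ: "id_outside J P"
  proof -
    have V: "V *v axis i 1 = axis i 1" if "i \<notin> J" for i
    proof -
      have "W *v axis i 1 = axis i 1" using W(1) that unfolding matrix_vector_mult_basis
        by (auto simp: vec_eq_iff column_def axis_def id_outside_def)
      then show ?thesis by (metis V_def inv matrix_inv_mult_vec(2))
    qed
    have sV: "transpose V = V" unfolding V_def using inv W(2) by (rule transpose_matrix_inv)
    have Pi: "P *v axis i 1 = axis i 1" if "i \<notin> J" for i
      using V[OF that] sV by (simp add: P_def matrix_vector_mul_assoc[symmetric])
    have entry: "P $ k $ i = axis i 1 $ k" if "i \<notin> J" for i k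
      using Pi[OF that] by (simp add: matrix_vector_mult_basis column_def vec_eq_iff)
    have "transpose P = P" by (simp add: P_def matrix_transpose_mul)
    then have "P $ i $ k = P $ k $ i" for i k by (metis transpose_def vec_lambda_beta)
    then show ?thesis using entry unfolding id_outside_def
      by (intro allI impI) (auto simp: axis_def, metis)
  qed
  have Pq: "x \<bullet> (P *v x) = (V *v x) \<bullet> (V *v x)" for x
    by (simp add: P_def matrix_vector_mul_assoc[symmetric] inner_transpose del: transpose_matrix_vector)
  have "sym_pos_def P" unfolding sym_pos_def_def Pq
  proof safe
    show "transpose P = P" by (simp add: P_def matrix_transpose_mul)
    fix x :: "real^'r" assume "x \<noteq> 0"
    then have "V *v x \<noteq> 0" by (metis V_def inv matrix_inv_mult_vec(1) matrix_vector_mult_0_right)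
    then show "(V *v x) \<bullet> (V *v x) > 0" by simp
  qed
  note spdP = this
  have detP: "sqrt (det P) = 1 / det W"
  proof -
    have "det W * det V = 1" using matrix_inv_mult(1)[OF inv] by (metis V_def det_I det_mul)
    then have "det V = 1 / det W" using detW by (simp add: field_simps)
    then show ?thesis using detW by (simp add: P_def det_mul real_sqrt_divide)
  qed
  have inner: "(\<integral>\<^sup>+y. G u (?v y) \<partial>?P) =
     ennreal (sqrt (pi / c) ^ card J * det W) * (indicator {0<..} u * ennreal
         (u powr (- (\<kappa> - card J / 2)) * exp (- (c / u))))" for u
  proof (cases "u > 0")
    case True
    have "G u (?v y) = ennreal (u powr (- \<kappa>) * exp (- (c / u))) * ennreal
        (exp (- (c / u) * ((?v y + 0) \<bullet> (P *v (?v y + 0)))))" for y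
      using True unfolding G_def Pq by (simp add: ennreal_mult[symmetric] exp_add[symmetric]
          add_divide_distrib algebra_simps)
    then have "(\<integral>\<^sup>+y. G u (?v y) \<partial>?P) =
      ennreal (u powr (- \<kappa>) * exp (- (c / u))) * (\<integral>\<^sup>+y. ennreal
          (exp (- (c / u) * ((?v y + 0) \<bullet> (P *v (?v y + 0))))) \<partial>?P)"
      by (simp add: nn_integral_cmult)
    also have "\<dots> = ennreal (u powr (- \<kappa>) * exp (- (c / u))) * ennreal (sqrt (pi / (c / u)) ^ card
        J / sqrt (det P))"
      using True c by (subst gaussian_integral_id_outside[OF _ J(2) _ pidJ spdP]) auto
    also have "\<dots> = ennreal (u powr (- \<kappa>) * exp (- (c / u)) * (sqrt (pi / c * u) ^ card J * det W))"
      using True c detW by (subst ennreal_mult[symmetric]) (auto simp: detP)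
    also have "sqrt (pi / c * u) ^ card J = sqrt (pi / c) ^ card J * u powr (card J / 2)"
    proof -
      have "sqrt u ^ card J = u powr (card J / 2)"
        using True by (simp add: powr_half_sqrt[symmetric] powr_realpow[symmetric] powr_powr)
      then show ?thesis by (simp only: real_sqrt_mult power_mult_distrib)
    qed
    finally have 1: "(\<integral>\<^sup>+y. G u (?v y) \<partial>?P) =
      ennreal (u powr (- \<kappa>) * exp (- (c / u)) * (sqrt (pi / c) ^ card J * u powr (card J / 2) * det W))" .
    have 2: "u powr (- (\<kappa> - card J / 2)) = u powr (- \<kappa>) * u powr (card J / 2)"
      by (simp add: powr_add[symmetric])
    show ?thesis unfolding 1 2 using True c detW
      by (simp add: ennreal_mult[symmetric] mult_ac)
  qed (simp add: G_def)
  have "?L = (\<integral>\<^sup>+y. \<integral>\<^sup>+t. inv_wishart \<kappa> c (bordered W (?v (y(h j := t))) ((y(h j := t)) (h j))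
      j) \<partial>lborel \<partial>?P)"
    unfolding image_insert
  proof (rule lborel_product.product_nn_integral_insert)
    show "finite (h ` J)" "h j \<notin> h ` J" using hj by auto
    have "(\<lambda>y. bordered W (?v y) (y (h j)) j) \<in> borel_measurable (\<Pi>\<^sub>M i\<in>insert (h j) (h ` J). lborel)"
    proof (intro borel_measurable_vec)
      have [measurable]: "(\<lambda>y. ?v y $ k :: real) \<in> borel_measurable (\<Pi>\<^sub>M i\<in>insert (h j)
          (h ` J). lborel)" for k
        by (cases "k \<in> J") (auto simp: supp_vec_def)
      fix i k
      show "(\<lambda>y. bordered W (?v y) (y (h j)) j $ i $ k)
          \<in> borel_measurable (\<Pi>\<^sub>M i\<in>insert (h j) (h ` J). lborel)"
        unfolding bordered_def by (cases "i = j"; cases "k = j") auto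
    qed
    then show "(\<lambda>y. inv_wishart \<kappa> c (bordered W (?v y) (y (h j)) j))
        \<in> borel_measurable (\<Pi>\<^sub>M i\<in>insert (h j) (h ` J). lborel)"
      by measurable
  qed
  also have "\<dots> \<le> (\<integral>\<^sup>+y. \<integral>\<^sup>+t. ennreal A * G (t - ?v y \<bullet> (V *v ?v y)) (?v y) \<partial>lborel \<partial>?P)"
    unfolding upd fun_upd_same by (intro nn_integral_mono le)
  also have "\<dots> = (\<integral>\<^sup>+y. \<integral>\<^sup>+t. ennreal A * G t (?v y) \<partial>lborel \<partial>?P)"
  proof (rule nn_integral_cong)
    fix y :: "'b \<Rightarrow> real"
    let ?d = "- (?v y \<bullet> (V *v ?v y))"
    have "(\<integral>\<^sup>+t. ennreal A * G t (?v y) \<partial>lborel) = (\<integral>\<^sup>+t. ennreal A * G t (?v y) \<partial>distr lborel borel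
        ((+) ?d))"
      by (simp only: lborel_distr_plus)
    also have "\<dots> = (\<integral>\<^sup>+t. ennreal A * G (?d + t) (?v y) \<partial>lborel)"
      by (rule nn_integral_distr) measurable
    finally show "(\<integral>\<^sup>+t. ennreal A * G (t - ?v y \<bullet> (V *v ?v y)) (?v y) \<partial>lborel)
        = (\<integral>\<^sup>+t. ennreal A * G t (?v y) \<partial>lborel)"
      by simp
  qed
  also have "\<dots> = (\<integral>\<^sup>+t. \<integral>\<^sup>+y. ennreal A * G t (?v y) \<partial>?P \<partial>lborel)"
  proof (rule pair_sigma_finite.Fubini')
    show "pair_sigma_finite (lborel :: real measure) ?P"
      by (intro pair_sigma_finite.intro sigma_finite_lborel lborel_product.sigma_finite) simp
  qed measurable
  also have "\<dots> = (\<integral>\<^sup>+t. ennreal A * (ennreal (sqrt (pi / c) ^ card J * det W) *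
      (indicator {0<..} t * ennreal (t powr (- (\<kappa> - card J / 2)) * exp (- (c / t))))) \<partial>lborel)"
    by (intro nn_integral_cong, subst nn_integral_cmult, measurable) (simp only: inner)
  also have "\<dots> = ennreal A * (ennreal (sqrt (pi / c) ^ card J * det W) * ?I)"
    by (simp add: nn_integral_cmult)
  also have "\<dots> = (ennreal A * ennreal (sqrt (pi / c) ^ card J * det W)) * ?I" by (simp add: mult.assoc)
  also have "ennreal A * ennreal (sqrt (pi / c) ^ card J * det W)
      = ennreal (det W powr (- (\<kappa> - 1)) * exp (- c * trace V)) * ennreal (exp c * sqrt (pi / c) ^ card J)"
  proof -
    have 1: "det W powr (- (\<kappa> - 1)) = det W powr (- \<kappa>) * det W"
      using detW powr_add[of "det W" "- \<kappa>" 1] by simp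
    have 2: "exp (- c * (trace V - 1)) = exp (- c * trace V) * exp c"
      by (simp add: exp_add[symmetric] algebra_simps)
    show ?thesis unfolding A_def 1 2 using detW c by (simp add: ennreal_mult[symmetric] mult_ac)
  qed
  also have "\<dots> * ?I = inv_wishart (\<kappa> - 1) c W * (ennreal (exp c * sqrt (pi / c) ^ card J) * ?I)"
    using spd by (simp add: inv_wishart_def V_def mult.assoc)
  finally show ?thesis .
qed

text \<open>
  Indices are added in increasing order, so that the new column lies on and above the diagonal. Both the
  exponent and the size decrease by one in a step, which preserves \<open>\<kappa> > card J\<close>.
\<close>

lemma inv_wishart_integral_finite_upper_pairs:
  fixes J :: "'r::{finite,linorder} set" and \<kappa> :: real
  assumes "finite J" "\<kappa> > card J" "c > 0"
  shows "(\<integral>\<^sup>+s. inv_wishart \<kappa> c (sym_mat J s) \<partial>(\<Pi>\<^sub>M c\<in>upper_pairs J. lborel)) < \<infinity>"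
  using assms
proof (induction J arbitrary: \<kappa> rule: finite_linorder_max_induct)
  case empty
  have "upper_pairs {} = {}" by (simp add: upper_pairs_def)
  then show ?case unfolding \<open>upper_pairs {} = {}\<close>
    by (simp add: PiM_empty nn_integral_count_space_finite inv_wishart_def indicator_def)
next
  case (insert j J)
  define h :: "'r \<Rightarrow> 'r \<times> 'r" where "h = (\<lambda>i. (i, j))"
  have j: "j \<notin> J" using insert.hyps by auto
  have h: "inj h" by (auto simp: h_def inj_def)
  have \<kappa>: "\<kappa> > card J + 1" using insert.prems insert.hyps j by simp
  have up: "upper_pairs (insert j J) = upper_pairs J \<union> h ` insert j J"
    using insert.hyps by (auto simp: upper_pairs_def h_def)
  have disj: "upper_pairs J \<inter> h ` insert j J = {}"
    using j by (auto simp: upper_pairs_def h_def)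
  let ?I = "\<integral>\<^sup>+u. indicator {0<..} u * ennreal (u powr (- (\<kappa> - card J / 2)) * exp (- (c / u))) \<partial>lborel"
  let ?C = "ennreal (exp c * sqrt (pi / c) ^ card J) * ?I"
  have "card J / 2 \<le> card J" by simp
  then have I: "?I < \<infinity>" using \<kappa> insert.prems by (intro inverse_gamma_integral_finite) linarith+
  have C: "?C < \<infinity>" using I by (simp add: ennreal_mult_less_top)
  have eq: "sym_mat (insert j J) (merge (upper_pairs J) (h ` insert j J) (x, y))
      = bordered (sym_mat J x) (supp_vec J h y) (y (h j)) j" for x y
  proof (subst vec_eq_iff, intro allI, subst vec_eq_iff, intro allI)
    fix i k
    have 2: "(i, j) \<notin> upper_pairs J" for i using j by (simp add: upper_pairs_def)
    have 3: "min i j = i" "max i j = j" "min j i = i" "max j i = j" if "i \<in> J" for i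
        using insert.hyps that by (auto simp: min_def max_def)
    have m: "sym_mat (insert j J) z $ i $ k = (if i \<in> insert j J \<and> k
        \<in> insert j J then z (min i k, max i k) else if i = k then 1 else 0)" for z
      by (simp add: sym_mat_def)
    show "sym_mat (insert j J) (merge (upper_pairs J) (h ` insert j J) (x, y)) $ i $ k =
      bordered (sym_mat J x) (supp_vec J h y) (y (h j)) j $ i $ k"
    proof (cases "i = j \<or> k = j")
      case True
      then show ?thesis unfolding m using j 2
        by (auto simp: bordered_def supp_vec_def merge_def 3 h_def sym_mat_def)
    next
      case False
      have "i \<in> J \<Longrightarrow> k \<in> J \<Longrightarrow> (min i k, max i k) \<in> upper_pairs J"
        by (auto simp: upper_pairs_def min_def max_def)
      then show ?thesis unfolding m using False by (auto simp: bordered_def merge_def sym_mat_def)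
    qed
  qed
  have "(\<integral>\<^sup>+s. inv_wishart \<kappa> c (sym_mat (insert j J) s) \<partial>(\<Pi>\<^sub>M c\<in>upper_pairs (insert j J). lborel)) =
     (\<integral>\<^sup>+x. \<integral>\<^sup>+y. inv_wishart \<kappa> c (sym_mat (insert j J) (merge (upper_pairs J) (h ` insert j J) (x, y)))
       \<partial>(\<Pi>\<^sub>M c\<in>h ` insert j J. lborel) \<partial>(\<Pi>\<^sub>M c\<in>upper_pairs J. lborel))"
    unfolding up
  proof (rule lborel_product.product_nn_integral_fold[OF disj])
    show "(\<lambda>s. inv_wishart \<kappa> c (sym_mat (insert j J) s))
        \<in> borel_measurable (\<Pi>\<^sub>M c\<in>upper_pairs J \<union> h ` insert j J. lborel)"
      unfolding up[symmetric] by measurable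
  qed auto
  also have "\<dots> \<le> (\<integral>\<^sup>+x. inv_wishart (\<kappa> - 1) c (sym_mat J x) * ?C \<partial>(\<Pi>\<^sub>M c\<in>upper_pairs J. lborel))"
    unfolding eq
  proof (intro nn_integral_mono inv_wishart_bordered_integral[OF j h])
    fix x show "id_outside J (sym_mat J x)" "transpose (sym_mat J x) = sym_mat J x"
      by (auto simp: id_outside_def sym_mat_def transpose_def vec_eq_iff min.commute max.commute)
  qed (use insert.prems in auto)
  also have "\<dots> = (\<integral>\<^sup>+x. inv_wishart (\<kappa> - 1) c (sym_mat J x) \<partial>(\<Pi>\<^sub>M c\<in>upper_pairs J. lborel)) * ?C"
    by (rule nn_integral_multc) measurable
  also have "\<dots> < \<infinity>" using insert.IH[of "\<kappa> - 1"] \<kappa> insert.prems C by (simp add: ennreal_mult_less_top)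
  finally show ?case .
qed

section \<open>Lebesgue measure on the positive definite matrices\<close>

lemma space_lborel_spd: "space lborel_spd = {\<Sigma>. sym_pos_def \<Sigma>}"
  by (simp add: lborel_spd_def space_restrict_space)

lemma sets_lborel_spd: "sets lborel_spd = sets (restrict_space borel {\<Sigma>. sym_pos_def \<Sigma>})"
  unfolding lborel_spd_def by (rule sets_restrict_space_cong) simp

lemma measurable_lborel_spd_borel: "s \<in> M \<rightarrow>\<^sub>M lborel_spd \<Longrightarrow> s \<in> borel_measurable M"
  unfolding measurable_cong_sets[OF refl sets_lborel_spd] by (simp add: measurable_restrict_space2_iff)

lemma measurable_id_lborel_spd[measurable]: "(\<lambda>\<Sigma>. \<Sigma>) \<in> borel_measurable lborel_spd"
  by (rule measurable_lborel_spd_borel) simp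

lemma nn_integral_lborel_spd:
  assumes [measurable]: "f \<in> borel_measurable borel"
  shows "(\<integral>\<^sup>+\<Sigma>. f \<Sigma> \<partial>lborel_spd) =
    (\<integral>\<^sup>+s. f (sym_mat UNIV s) * indicator {\<Sigma>. sym_pos_def \<Sigma>} (sym_mat UNIV s) \<partial>(\<Pi>\<^sub>M c\<in>upper_pairs
        (UNIV :: 'r::{finite,linorder} set). lborel))"
proof -
  have up: "{(i, j). i \<le> j} = upper_pairs (UNIV :: 'r set)" by (auto simp: upper_pairs_def)
  have f: "(\<lambda>s :: 'r \<times> 'r \<Rightarrow> real. (\<chi> i j. s (min i j, max i j))) = sym_mat UNIV"
      by (simp add: sym_mat_def fun_eq_iff)
  have m: "(\<lambda>\<Sigma>. f \<Sigma> * indicator {\<Sigma>. sym_pos_def \<Sigma>} \<Sigma>) \<in> borel_measurable borel" by measurable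
  show ?thesis
    unfolding lborel_spd_def up f
    by (subst nn_integral_restrict_space) (simp_all add: nn_integral_distr m)
qed

lemma inv_wishart_integral_finite:
  assumes "\<kappa> > real CARD('r)" "c > 0"
  shows "(\<integral>\<^sup>+\<Sigma>. ennreal (det \<Sigma> powr (- \<kappa>) * exp (- c * trace
      (matrix_inv \<Sigma>))) \<partial>(lborel_spd :: ('r::{finite,linorder}, 'r) rmat measure)) < \<infinity>"
  using inv_wishart_integral_finite_upper_pairs[of "UNIV :: 'r set" \<kappa> c] assms
  by (subst nn_integral_lborel_spd) (simp_all add: inv_wishart_def mult.commute)

text \<open>The sets where the inverse Wishart density is at least \<open>1 / (n + 1)\<close> have finite measure.\<close>

lemma sigma_finite_lborel_spd: "sigma_finite_measure (lborel_spd :: ('r::{finite,linorder}, 'r) rmat measure)"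
proof
  let ?M = "lborel_spd :: ('r, 'r) rmat measure"
  define f where "f \<Sigma> = ennreal (det \<Sigma> powr (- (real CARD('r) + 1)) * exp (- 1 * trace (matrix_inv \<Sigma>)))"
    for \<Sigma> :: "('r, 'r) rmat"
  have f[measurable]: "f \<in> borel_measurable ?M" unfolding f_def by measurable
  have fin: "(\<integral>\<^sup>+\<Sigma>. f \<Sigma> \<partial>?M) < \<infinity>" unfolding f_def by (rule inv_wishart_integral_finite) auto
  define A where "A n = {\<Sigma> \<in> space ?M. 1 \<le> of_nat (Suc n) * f \<Sigma>}" for n
  have "emeasure ?M (A n) \<noteq> \<infinity>" for n
  proof -
    have "emeasure ?M (A n) \<le> of_nat (Suc n) * (\<integral>\<^sup>+\<Sigma>. f \<Sigma> \<partial>?M)"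
      using nn_integral_Markov_inequality[of f "space ?M" ?M "of_nat (Suc n)"]
          by (simp add: A_def del: of_nat_Suc)
    also have "\<dots> < \<infinity>" using fin by (simp add: ennreal_mult_less_top of_nat_less_top del: of_nat_Suc)
    finally show ?thesis by simp
  qed
  moreover have "\<exists>n. \<Sigma> \<in> A n" if \<Sigma>: "\<Sigma> \<in> space ?M" for \<Sigma>
  proof -
    define r where "r = det \<Sigma> powr (- (real CARD('r) + 1)) * exp (- 1 * trace (matrix_inv \<Sigma>))"
    have r: "r > 0" using \<Sigma> det_sym_pos_def[of \<Sigma>] by (simp add: r_def space_lborel_spd)
    obtain n where "1 / real (Suc n) < r" using nat_approx_posE[OF r] .
    then have "1 \<le> ennreal (real (Suc n) * r)" by (simp add: field_simps)
    also have "\<dots> = of_nat (Suc n) * f \<Sigma>"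
    proof -
      have "f \<Sigma> = ennreal r" by (simp only: f_def r_def)
      then show ?thesis using r by (simp add: ennreal_mult ennreal_of_nat_eq_real_of_nat del: of_nat_Suc)
    qed
    finally show ?thesis using \<Sigma> by (auto simp: A_def)
  qed
  moreover have "A n \<in> sets ?M" for n unfolding A_def by measurable
  ultimately show "\<exists>F. countable F \<and> F \<subseteq> sets ?M \<and> \<Union> F = space ?M \<and> (\<forall>a\<in>F. emeasure ?M a \<noteq> \<infinity>)"
    by (intro exI[of _ "range A"]) (auto simp: A_def)
qed

text \<open>
  A symmetric matrix whose entries differ from those of the identity by at most \<open>1 / (2 N\<^sup>2)\<close>, with \<open>N\<close> its
  size, is positive definite. In the coordinates on and above the diagonal these matrices form a box.
\<close>

lemma emeasure_lborel_spd_pos: "emeasure lborel_spd (space lborel_spd :: ('r::{finite,linorder}, 'r)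
    rmat set) > 0"
proof -
  let ?N = "real CARD('r)"
  define \<epsilon> where "\<epsilon> = 1 / (2 * ?N\<^sup>2)"
  have \<epsilon>: "\<epsilon> > 0" by (simp add: \<epsilon>_def)
  define d where "d = (\<lambda>(i, j). if i = (j::'r) then 1 else (0::real))"
  let ?U = "upper_pairs (UNIV :: 'r set)"
  let ?P = "\<Pi>\<^sub>M c\<in>?U. (lborel :: real measure)"
  let ?E = "\<Pi>\<^sub>E c\<in>?U. {d c - \<epsilon>..d c + \<epsilon>}"
  have spd: "sym_pos_def (sym_mat UNIV s)" if s: "s \<in> ?E" for s
    unfolding sym_pos_def_def
  proof safe
    show "transpose (sym_mat UNIV s) = sym_mat UNIV s"
      by (auto simp: sym_mat_def transpose_def vec_eq_iff min.commute max.commute)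
    fix x :: "'r rvec" assume "x \<noteq> 0"
    let ?F = "sym_mat UNIV s - mat 1"
    have F: "\<bar>?F $ i $ j\<bar> \<le> \<epsilon>" for i j
    proof -
      have "(min i j, max i j) \<in> ?U" by (auto simp: upper_pairs_def min_def max_def)
      then have "s (min i j, max i j) \<in> {d (min i j, max i j) - \<epsilon>..d (min i j, max i j) + \<epsilon>}" using s
          by (auto simp: PiE_iff)
      moreover have "d (min i j, max i j) = (if i = j then 1 else 0)" by (auto simp: d_def min_def max_def)
      ultimately show ?thesis by (auto simp: sym_mat_def mat_def abs_le_iff)
    qed
    have "\<bar>x \<bullet> (?F *v x)\<bar> \<le> (\<Sum>i\<in>UNIV. \<Sum>j\<in>UNIV. \<bar>x $ i * (?F $ i $ j * x $ j)\<bar>)"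
      unfolding inner_vec_def matrix_vector_mult_def
      by (auto simp: sum_distrib_left intro!: order_trans[OF sum_abs] sum_mono)
    also have "\<dots> \<le> (\<Sum>i\<in>(UNIV::'r set). \<Sum>j\<in>(UNIV::'r set). \<epsilon> * (x \<bullet> x))"
    proof (intro sum_mono)
      fix i j
      have "\<bar>x $ i * (?F $ i $ j * x $ j)\<bar> = \<bar>?F $ i $ j\<bar> * (\<bar>x $ i\<bar> * \<bar>x $ j\<bar>)" by (simp add: abs_mult)
      also have "\<dots> \<le> \<epsilon> * (norm x * norm x)"
        using F[of i j] \<epsilon> by (intro mult_mono component_le_norm_cart) auto
      finally show "\<bar>x $ i * (?F $ i $ j * x $ j)\<bar> \<le> \<epsilon> * (x \<bullet> x)"
        by (simp add: dot_square_norm power2_eq_square)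
    qed
    also have "\<dots> = (x \<bullet> x) / 2" by (simp add: \<epsilon>_def power2_eq_square)
    finally have "\<bar>x \<bullet> (?F *v x)\<bar> \<le> (x \<bullet> x) / 2" .
    moreover have "x \<bullet> (sym_mat UNIV s *v x) = x \<bullet> x + x \<bullet> (?F *v x)"
      by (simp add: matrix_vector_mult_diff_rdistrib inner_diff_right)
    moreover have "x \<bullet> x > 0" using \<open>x \<noteq> 0\<close> by simp
    ultimately show "x \<bullet> (sym_mat UNIV s *v x) > 0" by linarith
  qed
  have fin: "finite ?U" by simp
  have "0 < (\<Prod>c\<in>?U. ennreal (2 * \<epsilon>))" using \<epsilon> by (simp add: ennreal_power)
  also have "\<dots> = (\<Prod>c\<in>?U. emeasure lborel {d c - \<epsilon>..d c + \<epsilon>})"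
    using \<epsilon> by (intro prod.cong) auto
  also have "\<dots> = emeasure ?P ?E"
    by (rule lborel_product.emeasure_PiM[symmetric]) (auto simp: fin)
  also have "\<dots> = (\<integral>\<^sup>+s. indicator ?E s \<partial>?P)"
    by (subst nn_integral_indicator) (auto intro!: sets_PiM_I_finite)
  also have "\<dots> \<le> (\<integral>\<^sup>+s. 1 * indicator {\<Sigma>. sym_pos_def \<Sigma>} (sym_mat UNIV s) \<partial>?P)"
    using spd by (intro nn_integral_mono) (auto simp: indicator_def)
  also have "\<dots> = (\<integral>\<^sup>+\<Sigma>. 1 \<partial>(lborel_spd :: ('r, 'r) rmat measure))"
    by (rule nn_integral_lborel_spd[symmetric]) simp
  finally show ?thesis by simp
qed

section \<open>Doeblin minorization and images of Markov kernels\<close>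

lemma in_prob_algebraD:
  assumes "\<mu> \<in> space (prob_algebra S)"
  shows "prob_space \<mu>" "sets \<mu> = sets S" "space \<mu> = space S"
  using assms by (auto simp: space_prob_algebra dest: sets_eq_imp_space_eq)

lemma measurable_kernel_pow:
  assumes "K \<in> S \<rightarrow>\<^sub>M prob_algebra S"
  shows "kernel_pow S K h \<in> S \<rightarrow>\<^sub>M prob_algebra S"
proof (induction h)
  case (Suc h)
  then show ?case using assms by (simp add: measurable_bind_prob_space)
qed simp

lemma kernel_pow_Suc_left:
  assumes K: "K \<in> S \<rightarrow>\<^sub>M prob_algebra S" and x: "x \<in> space S"
  shows "kernel_pow S K (Suc h) x = bind (K x) (kernel_pow S K h)"
proof (induction h)
  case 0
  have "sets (K x) = sets S"
    using K x by (auto dest: measurable_space simp: space_prob_algebra)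
  then show ?case using bind_return[OF measurable_prob_algebraD[OF K] x] by (simp add: bind_return'')
next
  case (Suc h)
  have s: "sets (K x) = sets S"
    using K x by (auto dest: measurable_space simp: space_prob_algebra)
  have "kernel_pow S K (Suc (Suc h)) x = bind (kernel_pow S K (Suc h) x) K" by simp
  also have "\<dots> = bind (bind (K x) (kernel_pow S K h)) K" by (simp only: Suc)
  also have "\<dots> = bind (K x) (\<lambda>y. bind (kernel_pow S K h y) K)"
    using measurable_prob_algebraD[OF measurable_kernel_pow[OF K, of h]] measurable_prob_algebraD[OF K]
    by (intro bind_assoc) (auto simp: s cong: measurable_cong_sets)
  finally show ?case by simp
qed

lemma measure_bind_prob_algebra:
  assumes \<mu>: "\<mu> \<in> space (prob_algebra S)" and K: "K \<in> S \<rightarrow>\<^sub>M prob_algebra S'" and A: "A \<in> sets S'"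
  shows "measure (bind \<mu> K) A = (\<integral>x. measure (K x) A \<partial>\<mu>)"
proof -
  have s: "sets \<mu> = sets S" "space \<mu> = space S" by (rule in_prob_algebraD[OF \<mu>])+
  have [measurable]: "(\<lambda>x. measure (K x) A) \<in> borel_measurable \<mu>"
    using measurable_compose[OF measurable_prob_algebraD[OF K] measurable_measure_subprob_algebra[OF A]] s
    by (simp cong: measurable_cong_sets)
  have "emeasure (bind \<mu> K) A = (\<integral>\<^sup>+x. ennreal (measure (K x) A) \<partial>\<mu>)"
    unfolding emeasure_bind_prob_algebra[OF \<mu> K A]
  proof (rule nn_integral_cong)
    fix x assume "x \<in> space \<mu>"
    then have "prob_space (K x)" using K s by (auto dest: measurable_space simp: space_prob_algebra)
    then show "emeasure (K x) A = ennreal (measure (K x) A)"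
      by (simp add: finite_measure.emeasure_eq_measure prob_space.finite_measure)
  qed
  then show ?thesis unfolding measure_def[of "bind \<mu> K"]
    by (simp add: integral_eq_nn_integral)
qed

text \<open>
  Doeblin's contraction: the common part \<open>\<epsilon> \<nu>\<close> of the two measures contributes the same amount to both
  integrals, and only the remaining mass \<open>1 - \<epsilon>\<close> can see the oscillation of \<open>f\<close>.
\<close>

lemma minorized_integral_diff_le:
  fixes f :: "'a \<Rightarrow> real"
  assumes \<mu>: "\<mu> \<in> space (prob_algebra S)" "\<mu>' \<in> space (prob_algebra S)" and \<nu>: "\<nu> \<in> space (prob_algebra S)"
    and \<epsilon>: "0 \<le> \<epsilon>" "\<epsilon> \<le> 1"
    and minor: "\<And>g. g \<in> borel_measurable S \<Longrightarrow> ennreal \<epsilon> * (\<integral>\<^sup>+x. g x \<partial>\<nu>) \<le> (\<integral>\<^sup>+x. g x \<partial>\<mu>)"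
      "\<And>g. g \<in> borel_measurable S \<Longrightarrow> ennreal \<epsilon> * (\<integral>\<^sup>+x. g x \<partial>\<nu>) \<le> (\<integral>\<^sup>+x. g x \<partial>\<mu>')"
    and f: "f \<in> borel_measurable S" and c: "\<And>x y. x \<in> space S \<Longrightarrow> y \<in> space S \<Longrightarrow> f x - f y \<le> c"
  shows "(\<integral>x. f x \<partial>\<mu>) - (\<integral>x. f x \<partial>\<mu>') \<le> (1 - \<epsilon>) * c"
proof -
  interpret \<mu>: prob_space \<mu> using \<mu> by (simp add: space_prob_algebra)
  interpret \<mu>': prob_space \<mu>' using \<mu> by (simp add: space_prob_algebra)
  interpret \<nu>: prob_space \<nu> using \<nu> by (simp add: space_prob_algebra)
  have s: "sets \<mu> = sets S" "sets \<mu>' = sets S" "sets \<nu> = sets S" "space \<mu> = space S" "space \<mu>'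
      = space S" "space \<nu> = space S"
    using \<mu> \<nu> by (auto simp: space_prob_algebra dest: sets_eq_imp_space_eq)
  have [measurable]: "f \<in> borel_measurable \<mu>" "f \<in> borel_measurable \<mu>'" "f \<in> borel_measurable \<nu>"
    using f s by (simp_all cong: measurable_cong_sets)
  obtain z where z: "z \<in> space S" using \<mu>.not_empty s by auto
  have bdd: "bdd_above (f ` space S)" "bdd_below (f ` space S)"
    using c[OF _ z] c[OF z]
    by (auto intro!: bdd_aboveI2[of _ _ "f z + c"] bdd_belowI2[of _ "f z - c"] simp: algebra_simps)
  define lo where "lo = (INF x\<in>space S. f x)"
  define hi where "hi = (SUP x\<in>space S. f x)"
  have lo: "lo \<le> f x" and hi: "f x \<le> hi" if "x \<in> space S" for x
    using that bdd by (auto simp: lo_def hi_def intro: cINF_lower cSUP_upper)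
  have "hi \<le> c + lo"
    unfolding hi_def
  proof (rule cSUP_least)
    fix x assume x: "x \<in> space S"
    have "f x - c \<le> lo" unfolding lo_def using z c[OF x] by (intro cINF_greatest) (auto simp: algebra_simps)
    then show "f x \<le> c + lo" by simp
  qed (use z in auto)
  then have hl: "hi - lo \<le> c" by simp
  have int: "integrable \<mu> f" "integrable \<mu>' f" "integrable \<nu> f"
    using lo hi by (auto intro!: \<mu>.integrable_const_bound[of _ "max \<bar>lo\<bar>
        \<bar>hi\<bar>"] \<mu>'.integrable_const_bound[of _ "max \<bar>lo\<bar> \<bar>hi\<bar>"] \<nu>.integrable_const_bound[of _ "max \<bar>lo\<bar>
            \<bar>hi\<bar>"] AE_I2 simp: s abs_le_iff) (smt (verit) lo hi)+
  have real_minor: "\<epsilon> * (\<integral>x. g x \<partial>\<nu>) \<le> (\<integral>x. g x \<partial>M)"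
    if "integrable M g" "integrable \<nu> g" "\<And>x. x \<in> space S \<Longrightarrow> 0 \<le> g x" "space M = space S" "sets M = sets S"
       and min: "\<And>g. g \<in> borel_measurable S \<Longrightarrow> ennreal \<epsilon> * (\<integral>\<^sup>+x. g x \<partial>\<nu>) \<le> (\<integral>\<^sup>+x. g x \<partial>M)"
           for g :: "'a \<Rightarrow> real" and M
  proof -
    have g: "g \<in> borel_measurable S" using that(1,5) by (auto cong: measurable_cong_sets)
    then have "ennreal \<epsilon> * (\<integral>\<^sup>+x. ennreal (g x) \<partial>\<nu>) \<le> (\<integral>\<^sup>+x. ennreal (g x) \<partial>M)" by (intro min) measurable
    moreover have "(\<integral>\<^sup>+x. ennreal (g x) \<partial>\<nu>) = ennreal (\<integral>x. g x \<partial>\<nu>)"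
      using that s by (intro nn_integral_eq_integral AE_I2) auto
    moreover have "(\<integral>\<^sup>+x. ennreal (g x) \<partial>M) = ennreal (\<integral>x. g x \<partial>M)"
      using that s by (intro nn_integral_eq_integral AE_I2) auto
    moreover have "0 \<le> (\<integral>x. g x \<partial>M)" using that by (intro integral_nonneg_AE AE_I2) auto
    ultimately show ?thesis using \<epsilon> by (simp add: ennreal_mult'[symmetric])
  qed
  have ps: "measure \<mu> (space S) = 1" "measure \<mu>' (space S) = 1" "measure \<nu> (space S) = 1"
    using \<mu>.prob_space \<mu>'.prob_space \<nu>.prob_space by (simp_all add: s)
  have 1: "\<epsilon> * ((\<integral>x. f x \<partial>\<nu>) - lo) \<le> (\<integral>x. f x \<partial>\<mu>') - lo"
    using real_minor[of \<mu>' "\<lambda>x. f x - lo"] int lo s minor by (simp add: ps)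
  have 2: "\<epsilon> * (hi - (\<integral>x. f x \<partial>\<nu>)) \<le> hi - (\<integral>x. f x \<partial>\<mu>)"
    using real_minor[of \<mu> "\<lambda>x. hi - f x"] int hi s minor by (simp add: ps)
  have "(\<integral>x. f x \<partial>\<mu>) - (\<integral>x. f x \<partial>\<mu>') \<le> (1 - \<epsilon>) * (hi - lo)"
    using 1 2 by (simp add: algebra_simps)
  also have "\<dots> \<le> (1 - \<epsilon>) * c" using hl \<epsilon> by (intro mult_left_mono) auto
  finally show ?thesis .
qed

lemma tv_norm_diff_le:
  assumes "\<And>A. A \<in> sets \<nu> \<Longrightarrow> \<bar>measure \<mu> A - measure \<nu> A\<bar> \<le> b"
  shows "tv_norm_diff \<mu> \<nu> \<le> 2 * b"
proof -
  have ne: "sets \<nu> \<noteq> {}" by (metis empty_iff sets.empty_sets)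
  have *: "measure \<mu> A - measure \<nu> A \<le> b" "- b \<le> measure \<mu> A - measure \<nu> A" if "A \<in> sets \<nu>" for A
    using assms[OF that] by linarith+
  have "(SUP A\<in>sets \<nu>. measure \<mu> A - measure \<nu> A) \<le> b"
    using * ne by (intro cSUP_least) auto
  moreover have "- b \<le> (INF A\<in>sets \<nu>. measure \<mu> A - measure \<nu> A)"
    using * ne by (intro cINF_greatest) auto
  ultimately show ?thesis by (simp add: tv_norm_diff_def)
qed

text \<open>
  The bound on the oscillation of \<open>x \<mapsto> K\<^sup>h(x, A)\<close> is multiplied by \<open>1 - \<delta>\<close> in every second step. Invariance
  writes \<open>\<pi> A\<close> as an average of this function, so its oscillation bounds the distance to \<open>\<pi>\<close>.
\<close>

lemma geometrically_ergodic_of_two_step_minorization: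
  assumes K: "K \<in> S \<rightarrow>\<^sub>M prob_algebra S" and \<pi>: "\<pi> \<in> space (prob_algebra S)" and inv: "bind \<pi> K = \<pi>"
    and \<nu>: "\<nu> \<in> space (prob_algebra S)" and \<epsilon>: "\<epsilon> > 0"
    and minor: "\<And>x g. x \<in> space S \<Longrightarrow> g \<in> borel_measurable S \<Longrightarrow>
      ennreal \<epsilon> * (\<integral>\<^sup>+z. g z \<partial>\<nu>) \<le> (\<integral>\<^sup>+y. (\<integral>\<^sup>+z. g z \<partial>K y) \<partial>K x)"
  shows "geometrically_ergodic S K \<pi>"
proof -
  \<comment> \<open>The cap at one half keeps the rate positive, so that the odd powers can be absorbed by \<open>2 / \<rho>\<close>.\<close>
  define \<delta> where "\<delta> = min \<epsilon> (1/2)"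
  have \<delta>: "0 < \<delta>" "\<delta> \<le> 1/2" "\<delta> \<le> \<epsilon>" using \<epsilon> by (auto simp: \<delta>_def)
  have pow: "kernel_pow S K h \<in> S \<rightarrow>\<^sub>M prob_algebra S" for h using K by (rule measurable_kernel_pow)
  have Kx: "K x \<in> space (prob_algebra S)" if "x \<in> space S" for x using K that by (rule measurable_space)
  have sK: "sets (K x) = sets S" "space (K x) = space S" if "x \<in> space S" for x
    using Kx[OF that] by (auto simp: space_prob_algebra dest: sets_eq_imp_space_eq)
  have KK: "(\<lambda>x. bind (K x) K) \<in> S \<rightarrow>\<^sub>M prob_algebra S" using K K by (rule measurable_bind_prob_space)
  have pow2: "kernel_pow S K (Suc (Suc h)) x = bind (bind (K x) K) (kernel_pow S K h)"
      if x: "x \<in> space S" for x h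
  proof -
    have "kernel_pow S K (Suc (Suc h)) x = bind (K x) (kernel_pow S K (Suc h))"
      using K x by (rule kernel_pow_Suc_left)
    also have "\<dots> = bind (K x) (\<lambda>y. bind (K y) (kernel_pow S K h))"
      using kernel_pow_Suc_left[OF K] sK[OF x] by (intro bind_cong) auto
    also have "\<dots> = bind (bind (K x) K) (kernel_pow S K h)"
      using measurable_prob_algebraD[OF pow[of h]] measurable_prob_algebraD[OF K] sK[OF x]
      by (intro bind_assoc[symmetric]) (auto cong: measurable_cong_sets)
    finally show ?thesis .
  qed
  have min2: "ennreal \<delta> * (\<integral>\<^sup>+z. g z \<partial>\<nu>) \<le> (\<integral>\<^sup>+z. g z \<partial>(bind (K x) K))"
    if x: "x \<in> space S" and g: "g \<in> borel_measurable S" for x g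
  proof -
    have "ennreal \<delta> * (\<integral>\<^sup>+z. g z \<partial>\<nu>) \<le> ennreal \<epsilon> * (\<integral>\<^sup>+z. g z \<partial>\<nu>)"
      using \<delta> by (intro mult_right_mono ennreal_leI) auto
    also have "\<dots> \<le> (\<integral>\<^sup>+y. (\<integral>\<^sup>+z. g z \<partial>K y) \<partial>K x)" using x g by (rule minor)
    also have "\<dots> = (\<integral>\<^sup>+z. g z \<partial>(bind (K x) K))"
      using g measurable_prob_algebraD[OF K] sK[OF x]
      by (intro nn_integral_bind[symmetric]) (auto cong: measurable_cong_sets)
    finally show ?thesis .
  qed
  have osc: "measure (kernel_pow S K h x) A - measure (kernel_pow S K h y) A \<le> (1 - \<delta>) ^ (h div 2)"
    if A: "A \<in> sets S" and "x \<in> space S" "y \<in> space S" for h A x y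
    using that(2,3)
  proof (induction h arbitrary: x y rule: induct_nat_012)
    case (ge2 h)
    have x: "bind (K x) K \<in> space (prob_algebra S)" "bind (K y) K \<in> space (prob_algebra S)"
      using measurable_space[OF KK] ge2.prems by auto
    have "(\<lambda>x. measure (kernel_pow S K h x) A) \<in> borel_measurable S"
      using measurable_compose[OF measurable_prob_algebraD[OF pow] measurable_measure_subprob_algebra[OF A]] .
    then have "(\<integral>z. measure (kernel_pow S K h z) A \<partial>(bind (K x) K)) - (\<integral>z. measure (kernel_pow S K h z)
        A \<partial>(bind (K y) K)) \<le> (1 - \<delta>) * (1 - \<delta>) ^ (h div 2)"
      using \<delta> min2 ge2 by (intro minorized_integral_diff_le[OF x \<nu>]) auto
    then show ?case using ge2.prems by (simp only: pow2 measure_bind_prob_algebra[OF x(1) pow A]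
        measure_bind_prob_algebra[OF x(2) pow A]) simp
  next
    case 0
    have "prob_space (return S x)" using 0(1) by (rule prob_space_return)
    then have "measure (return S x) A \<le> 1" by (rule prob_space.prob_le_1)
    then have "measure (return S x) A - measure (return S y) A \<le> 1"
        using measure_nonneg[of "return S y" A] by linarith
    then show ?case by simp
  next
    case 1
    have "prob_space (kernel_pow S K 1 x)" using measurable_space[OF pow[of 1] 1(1)]
        by (simp add: space_prob_algebra)
    then have "measure (kernel_pow S K 1 x) A \<le> 1" by (rule prob_space.prob_le_1)
    then have "measure (kernel_pow S K 1 x) A - measure (kernel_pow S K 1 y) A \<le> 1"
      using measure_nonneg[of "kernel_pow S K 1 y" A] by linarith
    then show ?case by simp
  qed
  have powinv: "bind \<pi> (kernel_pow S K h) = \<pi>" for h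
  proof (induction h)
    case 0 then show ?case using \<pi> by (simp add: bind_return'' space_prob_algebra)
  next
    case (Suc h)
    have "bind \<pi> (kernel_pow S K (Suc h)) = bind (bind \<pi> (kernel_pow S K h)) K"
      unfolding kernel_pow.simps using \<pi> measurable_prob_algebraD[OF pow[of h]] measurable_prob_algebraD[OF K]
      by (intro bind_assoc[symmetric]) (auto simp: space_prob_algebra cong: measurable_cong_sets)
    then show ?case using Suc inv by simp
  qed
  have s\<pi>: "sets \<pi> = sets S" "space \<pi> = space S" by (rule in_prob_algebraD[OF \<pi>])+
  interpret \<pi>: prob_space \<pi> using \<pi> by (simp add: space_prob_algebra)
  have dist: "\<bar>measure (kernel_pow S K h x) A - measure \<pi> A\<bar> \<le> (1 - \<delta>) ^ (h div 2)"
    if A: "A \<in> sets S" and x: "x \<in> space S" for h A x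
  proof -
    let ?f = "\<lambda>y. measure (kernel_pow S K h y) A"
    have [measurable]: "?f \<in> borel_measurable \<pi>"
      using measurable_compose[OF measurable_prob_algebraD[OF pow] measurable_measure_subprob_algebra[OF
          A]] s\<pi> by (simp cong: measurable_cong_sets)
    have "prob_space (kernel_pow S K h y)" if "y \<in> space S" for y using measurable_space[OF pow that]
        by (simp add: space_prob_algebra)
    then have int: "integrable \<pi> ?f"
      using s\<pi> by (intro \<pi>.integrable_const_bound[of _ 1] AE_I2) (auto intro: prob_space.prob_le_1)
    have "measure \<pi> A = (\<integral>y. ?f y \<partial>\<pi>)"
      using measure_bind_prob_algebra[OF \<pi> pow A, of h] powinv by simp
    then have "?f x - measure \<pi> A = (\<integral>y. ?f x - ?f y \<partial>\<pi>)" using int by (simp add: \<pi>.prob_space)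
    moreover have "(\<integral>y. ?f x - ?f y \<partial>\<pi>) \<le> (\<integral>y. (1 - \<delta>) ^ (h div 2) \<partial>\<pi>)"
      using int osc[OF A x] s\<pi> by (intro integral_mono) auto
    moreover have "(\<integral>y. - ((1 - \<delta>) ^ (h div 2)) \<partial>\<pi>) \<le> (\<integral>y. ?f x - ?f y \<partial>\<pi>)"
      using int osc[OF A _ x, of _ h] s\<pi> by (intro integral_mono) (auto simp: algebra_simps)
    ultimately show ?thesis by (simp add: \<pi>.prob_space abs_le_iff)
  qed
  define \<rho> where "\<rho> = sqrt (1 - \<delta>)"
  have \<rho>: "0 < \<rho>" "\<rho> < 1" "1 - \<delta> = \<rho>\<^sup>2" using \<delta> by (simp_all add: \<rho>_def)
  have rate: "(1 - \<delta>) ^ (h div 2) \<le> \<rho> ^ h / \<rho>" if "h \<ge> 1" for h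
  proof -
    have "(1 - \<delta>) ^ (h div 2) = \<rho> ^ (2 * (h div 2))" by (simp add: \<rho>(3) power_mult)
    also have "\<dots> \<le> \<rho> ^ (h - 1)" using \<rho> by (intro power_decreasing) auto
    also have "\<dots> = \<rho> ^ h / \<rho>" using that \<rho>(1) by (simp add: power_diff)
    finally show ?thesis .
  qed
  show ?thesis unfolding geometrically_ergodic_def
  proof (intro conjI K \<pi> inv exI[of _ \<rho>] exI[of _ "\<lambda>_. 2 / \<rho>"] ballI allI impI)
    fix x :: 'a and h :: nat assume "x \<in> space S" "1 \<le> h"
    then have "tv_norm_diff (kernel_pow S K h x) \<pi> \<le> 2 * (1 - \<delta>) ^ (h div 2)"
      using dist by (intro tv_norm_diff_le) (auto simp: s\<pi>)
    also have "\<dots> \<le> 2 / \<rho> * \<rho> ^ h" using rate[OF \<open>1 \<le> h\<close>] by simp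
    finally show "tv_norm_diff (kernel_pow S K h x) \<pi> \<le> 2 / \<rho> * \<rho> ^ h" .
  qed (use \<rho> in auto)
qed

lemma tv_norm_diff_distr_le:
  assumes \<mu>: "\<mu> \<in> space (prob_algebra S)" "\<nu> \<in> space (prob_algebra S)" and f: "f \<in> S \<rightarrow>\<^sub>M S'"
  shows "tv_norm_diff (distr \<mu> S' f) (distr \<nu> S' f) \<le> tv_norm_diff \<mu> \<nu>"
proof -
  interpret \<mu>: prob_space \<mu> using \<mu> by (simp add: space_prob_algebra)
  interpret \<nu>: prob_space \<nu> using \<mu> by (simp add: space_prob_algebra)
  have s: "sets \<mu> = sets S" "sets \<nu> = sets S" "space \<mu> = space S" "space \<nu> = space S"
    using in_prob_algebraD[OF \<mu>(1)] in_prob_algebraD[OF \<mu>(2)] by auto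
  let ?d = "\<lambda>A. measure \<mu> A - measure \<nu> A"
  have b: "-1 \<le> ?d A" "?d A \<le> 1" for A
    using \<mu>.prob_le_1[of A] \<nu>.prob_le_1[of A] measure_nonneg[of \<mu> A] measure_nonneg[of \<nu> A] by linarith+
  have bdd: "bdd_above (?d ` sets \<nu>)" "bdd_below (?d ` sets \<nu>)"
    using b by (auto intro: bdd_aboveI2[of _ _ 1] bdd_belowI2[of _ "-1"])
  have m: "measure (distr \<mu> S' f) A - measure (distr \<nu> S' f) A = ?d (f -` A \<inter> space S)" if "A \<in> sets S'" for A
    using f that s by (simp add: measure_distr cong: measurable_cong_sets)
  have pre: "f -` A \<inter> space S \<in> sets \<nu>" if "A \<in> sets S'" for A
    using f that s by (simp add: measurable_sets)
  have ne: "sets S' \<noteq> {}" by (metis empty_iff sets.empty_sets)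
  have "(SUP A\<in>sets S'. measure (distr \<mu> S' f) A - measure (distr \<nu> S' f) A) \<le> (SUP A\<in>sets \<nu>. ?d A)"
    using ne bdd pre by (intro cSUP_least) (auto simp: m intro: cSUP_upper)
  moreover have "(INF A\<in>sets \<nu>. ?d A) \<le> (INF A\<in>sets S'. measure (distr \<mu> S' f) A - measure (distr \<nu> S' f) A)"
    using ne bdd pre by (intro cINF_greatest) (auto simp: m intro: cINF_lower)
  ultimately show ?thesis by (simp add: tv_norm_diff_def)
qed

text \<open>
  If \<open>f\<close> maps a chain to a chain, then all powers of the kernels correspond, and the sets in \<open>S'\<close> are tested
  through their preimages. The section \<open>s\<close> provides a starting point above each point of \<open>S'\<close>.
\<close>

lemma geometrically_ergodic_image:
  assumes erg: "geometrically_ergodic S K \<pi>"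
    and f: "f \<in> S \<rightarrow>\<^sub>M S'" and s: "s \<in> S' \<rightarrow>\<^sub>M S" and fs: "\<And>x'. x' \<in> space S' \<Longrightarrow> f (s x') = x'"
    and K': "\<And>x. x \<in> space S \<Longrightarrow> K' (f x) = distr (K x) S' f" and \<pi>': "\<pi>' = distr \<pi> S' f"
  shows "geometrically_ergodic S' K' \<pi>'"
proof -
  have K: "K \<in> S \<rightarrow>\<^sub>M prob_algebra S" and \<pi>: "\<pi> \<in> space (prob_algebra S)" and inv: "bind \<pi> K = \<pi>"
    using erg by (auto simp: geometrically_ergodic_def)
  have "\<exists>\<rho> M. 0 \<le> \<rho> \<and> \<rho> < 1 \<and> (\<forall>x\<in>space S. 0 \<le> M x) \<and>
      (\<forall>x\<in>space S. \<forall>h\<ge>1. tv_norm_diff (kernel_pow S K h x) \<pi> \<le> M x * \<rho> ^ h)"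
    using erg unfolding geometrically_ergodic_def by blast
  then obtain \<rho> M where \<rho>: "0 \<le> \<rho>" "\<rho> < 1" and M: "\<And>x. x \<in> space S \<Longrightarrow> 0 \<le> M x"
    and rate: "\<And>x h. x \<in> space S \<Longrightarrow> h \<ge> 1 \<Longrightarrow> tv_norm_diff (kernel_pow S K h x) \<pi> \<le> M x * \<rho> ^ h"
    by blast
  have s\<pi>: "sets \<pi> = sets S" "space \<pi> = space S" by (rule in_prob_algebraD[OF \<pi>])+
  have distr: "(\<lambda>\<mu>. distr \<mu> S' f) \<in> prob_algebra S \<rightarrow>\<^sub>M prob_algebra S'"
    using f by (rule measurable_distr_prob_space)
  have "(\<lambda>x'. distr (K (s x')) S' f) \<in> S' \<rightarrow>\<^sub>M prob_algebra S'"
    by (rule measurable_compose[OF measurable_compose[OF s K] distr])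
  moreover have "distr (K (s x')) S' f = K' x'" if "x' \<in> space S'" for x'
    using K'[of "s x'"] fs that measurable_space[OF s that] by simp
  ultimately have K'm: "K' \<in> S' \<rightarrow>\<^sub>M prob_algebra S'" by (simp cong: measurable_cong)
  have \<pi>'m: "\<pi>' \<in> space (prob_algebra S')" unfolding \<pi>' by (rule measurable_space[OF distr \<pi>])
  have push: "bind (distr \<mu> S' f) K' = distr (bind \<mu> K) S' f" if \<mu>: "\<mu> \<in> space (prob_algebra S)" for \<mu>
  proof -
    have s\<mu>: "sets \<mu> = sets S" "space \<mu> = space S" by (rule in_prob_algebraD[OF \<mu>])+
    have ne: "space \<mu> \<noteq> {}" using \<mu> by (auto simp: space_prob_algebra intro!: prob_space.not_empty)
    have "bind (distr \<mu> S' f) K' = bind \<mu> (\<lambda>x. K' (f x))"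
      using f s\<mu> ne measurable_prob_algebraD[OF K'm] by (intro bind_distr) (auto cong: measurable_cong_sets)
    also have "\<dots> = bind \<mu> (\<lambda>x. distr (K x) S' f)" using K' s\<mu> by (intro bind_cong) auto
    also have "\<dots> = distr (bind \<mu> K) S' f"
      using f s\<mu> ne measurable_prob_algebraD[OF K]
          by (intro distr_bind[symmetric]) (auto cong: measurable_cong_sets)
    finally show ?thesis .
  qed
  have pow: "kernel_pow S' K' h (f x) = distr (kernel_pow S K h x) S' f" if x: "x \<in> space S" for h x
  proof (induction h)
    case 0 show ?case using f x by (simp add: distr_return)
  next
    case (Suc h)
    then show ?case using push[OF measurable_space[OF measurable_kernel_pow[OF K] x]] by simp
  qed
  show ?thesis unfolding geometrically_ergodic_def
  proof (intro conjI K'm \<pi>'m exI[of _ \<rho>] exI[of _ "\<lambda>x'. M (s x')"] \<rho> ballI allI impI)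
    show "bind \<pi>' K' = \<pi>'" unfolding \<pi>' push[OF \<pi>] inv ..
    fix x' assume x': "x' \<in> space S'"
    then have sx: "s x' \<in> space S" by (rule measurable_space[OF s])
    then show "0 \<le> M (s x')" by (rule M)
    fix h :: nat assume h: "1 \<le> h"
    have "kernel_pow S' K' h x' = distr (kernel_pow S K h (s x')) S' f"
      using pow[OF sx, of h] fs[OF x'] by simp
    then have "tv_norm_diff (kernel_pow S' K' h x') \<pi>' \<le> tv_norm_diff (kernel_pow S K h (s x')) \<pi>"
      unfolding \<pi>' using tv_norm_diff_distr_le[OF measurable_space[OF measurable_kernel_pow[OF K] sx] \<pi>
          f] by simp
    also have "\<dots> \<le> M (s x') * \<rho> ^ h" using sx h by (rule rate)
    finally show "tv_norm_diff (kernel_pow S' K' h x') \<pi>' \<le> M (s x') * \<rho> ^ h" .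
  qed
qed

section \<open>The collapsed Gibbs sampler of a general density\<close>

interpretation spd: sigma_finite_measure "lborel_spd :: ('r::{finite,linorder}, 'r) rmat measure"
  by (rule sigma_finite_lborel_spd)

interpretation vec_spd: pair_sigma_finite "lborel :: 'a::euclidean_space measure"
    "lborel_spd :: ('r::{finite,linorder}, 'r) rmat measure"
  by standard

text \<open>
  The integral over \<open>B\<close> always comes first, as in the definition of the densities; the two orders of the
  outer integrals serve the conditioning on \<open>\<alpha>\<close> and on \<open>\<Sigma>\<close>.
\<close>

lemma nn_integral_lborel_Theta:
  assumes F[measurable]: "F \<in> borel_measurable (lborel_Theta :: (('k::finite) rvec \<times>
      ('p::finite, 'r::{finite,linorder}) rmat \<times> ('r, 'r) rmat) measure)"
  shows "(\<integral>\<^sup>+z. F z \<partial>lborel_Theta) = (\<integral>\<^sup>+\<alpha>. \<integral>\<^sup>+\<Sigma>. \<integral>\<^sup>+B. F (\<alpha>, B, \<Sigma>) \<partial>lborel \<partial>lborel_spd \<partial>lborel)"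
    and "(\<integral>\<^sup>+z. F z \<partial>lborel_Theta) = (\<integral>\<^sup>+\<Sigma>. \<integral>\<^sup>+\<alpha>. \<integral>\<^sup>+B. F (\<alpha>, B, \<Sigma>) \<partial>lborel \<partial>lborel \<partial>lborel_spd)"
proof -
  have "(\<integral>\<^sup>+z. F z \<partial>lborel_Theta) = (\<integral>\<^sup>+\<alpha>. \<integral>\<^sup>+z. F (\<alpha>, z) \<partial>(lborel \<Otimes>\<^sub>M lborel_spd) \<partial>lborel)"
    by (rule vec_spd.P.nn_integral_fst[symmetric]) measurable
  also have "\<dots> = (\<integral>\<^sup>+\<alpha>. \<integral>\<^sup>+\<Sigma>. \<integral>\<^sup>+B. F (\<alpha>, B, \<Sigma>) \<partial>lborel \<partial>lborel_spd \<partial>lborel)"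
    by (intro nn_integral_cong vec_spd.nn_integral_snd[symmetric]) measurable
  finally show 1: "(\<integral>\<^sup>+z. F z \<partial>lborel_Theta) = (\<integral>\<^sup>+\<alpha>. \<integral>\<^sup>+\<Sigma>. \<integral>\<^sup>+B. F (\<alpha>, B, \<Sigma>) \<partial>lborel \<partial>lborel_spd \<partial>lborel)" .
  also have "\<dots> = (\<integral>\<^sup>+\<Sigma>. \<integral>\<^sup>+\<alpha>. \<integral>\<^sup>+B. F (\<alpha>, B, \<Sigma>) \<partial>lborel \<partial>lborel \<partial>lborel_spd)"
    by (rule vec_spd.Fubini'[symmetric]) measurable
  finally show "(\<integral>\<^sup>+z. F z \<partial>lborel_Theta) = (\<integral>\<^sup>+\<Sigma>. \<integral>\<^sup>+\<alpha>. \<integral>\<^sup>+B. F (\<alpha>, B, \<Sigma>) \<partial>lborel \<partial>lborel \<partial>lborel_spd)" .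
qed

lemma ennreal_mult_divide_cancel: "x \<noteq> 0 \<Longrightarrow> x \<noteq> \<infinity> \<Longrightarrow> x * (y / x) = (y :: ennreal)"
  by (simp add: ennreal_times_divide mult.commute[of x] ennreal_mult_divide_eq)

lemma ennreal_divide_self_pos: "0 < x \<Longrightarrow> x \<noteq> \<infinity> \<Longrightarrow> x / x = (1 :: ennreal)"
  using ennreal_mult_divide_eq[of x 1] by simp

lemma nn_integral_lborel_pos:
  fixes f :: "'a::euclidean_space \<Rightarrow> ennreal"
  assumes [measurable]: "f \<in> borel_measurable borel" and "\<And>x. f x > 0"
  shows "(\<integral>\<^sup>+x. f x \<partial>lborel) > 0"
proof -
  have "\<not> (AE x in (lborel :: 'a measure). False)" by (simp add: eventually_False ae_filter_eq_bot_iff)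
  moreover have "f x = 0 \<Longrightarrow> False" for x using assms(2)[of x] by simp
  ultimately have "\<not> (AE x in (lborel :: 'a measure). f x = 0)" using eventually_mono by blast
  then show ?thesis by (simp add: nn_integral_0_iff_AE zero_less_iff_neq_zero)
qed

lemma nn_integral_lborel_spd_pos:
  fixes f :: "('r::{finite,linorder}, 'r) rmat \<Rightarrow> ennreal"
  assumes [measurable]: "f \<in> borel_measurable lborel_spd" and "\<And>\<Sigma>. \<Sigma> \<in> space lborel_spd \<Longrightarrow> f \<Sigma> > 0"
  shows "(\<integral>\<^sup>+\<Sigma>. f \<Sigma> \<partial>lborel_spd) > 0"
proof -
  have "\<not> (AE \<Sigma> in (lborel_spd :: ('r, 'r) rmat measure). f \<Sigma> = 0)"
  proof
    assume "AE \<Sigma> in lborel_spd. f \<Sigma> = 0"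
    then have "AE \<Sigma> in (lborel_spd :: ('r, 'r) rmat measure). False"
    proof (rule AE_mp, intro AE_I2 impI)
      fix \<Sigma> :: "('r, 'r) rmat" assume "\<Sigma> \<in> space lborel_spd" "f \<Sigma> = 0"
      then show False using assms(2)[of \<Sigma>] by simp
    qed
    then show False using emeasure_lborel_spd_pos[where 'r='r]
        by (simp add: eventually_False ae_filter_eq_bot_iff)
  qed
  then show ?thesis by (simp add: nn_integral_0_iff_AE zero_less_iff_neq_zero)
qed

text \<open>
  Positivity and finiteness hold pointwise, not just almost everywhere, so that no division below meets
  \<open>0\<close> or \<open>\<infinity>\<close> at a positive definite \<open>\<Sigma>\<close>.
\<close>

locale collapsed_gibbs =
  fixes g :: "('k::finite) rvec \<Rightarrow> ('p::finite, 'r::{finite,linorder}) rmat \<Rightarrow> ('r, 'r) rmat \<Rightarrow> real"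
  assumes g_measurable: "(\<lambda>(\<alpha>, B, \<Sigma>). g \<alpha> B \<Sigma>) \<in> borel_measurable lborel_Theta"
    and g_pos: "\<And>\<alpha> B \<Sigma>. \<Sigma> \<in> space lborel_spd \<Longrightarrow> g \<alpha> B \<Sigma> > 0"
    and B_finite: "\<And>\<alpha> \<Sigma>. \<Sigma> \<in> space lborel_spd \<Longrightarrow> unnorm_alpha_Sigma g \<alpha> \<Sigma> < \<infinity>"
    and Sigma_finite: "\<And>\<alpha>. (\<integral>\<^sup>+ \<Sigma>. unnorm_alpha_Sigma g \<alpha> \<Sigma> \<partial>lborel_spd) < \<infinity>"
    and alpha_finite: "\<And>\<Sigma>. \<Sigma> \<in> space lborel_spd \<Longrightarrow> (\<integral>\<^sup>+ \<alpha>. unnorm_alpha_Sigma g \<alpha> \<Sigma> \<partial>lborel) < \<infinity>"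
    and total_finite: "(\<integral>\<^sup>+ \<alpha>. \<integral>\<^sup>+ \<Sigma>. unnorm_alpha_Sigma g \<alpha> \<Sigma> \<partial>lborel_spd \<partial>lborel) < \<infinity>"
begin

abbreviation "u \<equiv> unnorm_alpha_Sigma g"
abbreviation "fS \<equiv> dens_Sigma_given_alpha g"
abbreviation "fa \<equiv> dens_alpha_given_Sigma g"
abbreviation "fB \<equiv> dens_B_given_alpha_Sigma g"
definition "marg_alpha \<alpha> = (\<integral>\<^sup>+ \<Sigma>. u \<alpha> \<Sigma> \<partial>lborel_spd)"
definition "marg_Sigma \<Sigma> = (\<integral>\<^sup>+ \<alpha>. u \<alpha> \<Sigma> \<partial>lborel)"
definition "total_mass = (\<integral>\<^sup>+ \<alpha>. marg_alpha \<alpha> \<partial>lborel)"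

lemma measurable_g[measurable (raw)]:
  assumes "f \<in> M \<rightarrow>\<^sub>M borel" "b \<in> M \<rightarrow>\<^sub>M borel" "s \<in> M \<rightarrow>\<^sub>M lborel_spd"
  shows "(\<lambda>x. g (f x) (b x) (s x)) \<in> borel_measurable M"
proof -
  have "(\<lambda>x. (f x, b x, s x)) \<in> M \<rightarrow>\<^sub>M lborel_Theta" using assms by measurable
  from measurable_compose[OF this g_measurable] show ?thesis by simp
qed

lemma measurable_u[measurable (raw)]:
  assumes [measurable]: "f \<in> M \<rightarrow>\<^sub>M borel" "s \<in> M \<rightarrow>\<^sub>M lborel_spd"
  shows "(\<lambda>x. u (f x) (s x)) \<in> borel_measurable M"
  unfolding unnorm_alpha_Sigma_def by measurable

lemma measurable_marg_alpha[measurable]: "marg_alpha \<in> borel_measurable borel"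
  unfolding marg_alpha_def by measurable

lemma measurable_marg_Sigma[measurable]: "marg_Sigma \<in> borel_measurable lborel_spd"
  unfolding marg_Sigma_def by measurable

lemma measurable_fS[measurable (raw)]:
  assumes [measurable]: "f \<in> M \<rightarrow>\<^sub>M borel" "s \<in> M \<rightarrow>\<^sub>M lborel_spd"
  shows "(\<lambda>x. fS (f x) (s x)) \<in> borel_measurable M"
  unfolding dens_Sigma_given_alpha_def marg_alpha_def[symmetric] by measurable

lemma measurable_fa[measurable (raw)]:
  assumes [measurable]: "f \<in> M \<rightarrow>\<^sub>M borel" "s \<in> M \<rightarrow>\<^sub>M lborel_spd"
  shows "(\<lambda>x. fa (s x) (f x)) \<in> borel_measurable M"
  unfolding dens_alpha_given_Sigma_def marg_Sigma_def[symmetric] by measurable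

lemma measurable_fB[measurable (raw)]:
  assumes [measurable]: "f \<in> M \<rightarrow>\<^sub>M borel" "b \<in> M \<rightarrow>\<^sub>M borel" "s \<in> M \<rightarrow>\<^sub>M lborel_spd"
  shows "(\<lambda>x. fB (f x) (s x) (b x)) \<in> borel_measurable M"
  unfolding dens_B_given_alpha_Sigma_def by measurable

lemma u_pos: "\<Sigma> \<in> space lborel_spd \<Longrightarrow> u \<alpha> \<Sigma> > 0"
  unfolding unnorm_alpha_Sigma_def by (rule nn_integral_lborel_pos) (measurable, simp add: g_pos)

lemma marg_Sigma_pos: "\<Sigma> \<in> space lborel_spd \<Longrightarrow> marg_Sigma \<Sigma> > 0"
  unfolding marg_Sigma_def by (rule nn_integral_lborel_pos) (measurable, simp add: u_pos)

lemma marg_alpha_pos: "marg_alpha \<alpha> > 0"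
  unfolding marg_alpha_def by (rule nn_integral_lborel_spd_pos) (measurable, simp add: u_pos)

lemma total_mass_pos: "total_mass > 0"
  unfolding total_mass_def by (rule nn_integral_lborel_pos) (measurable, simp add: marg_alpha_pos)

lemma marginals_finite: "marg_alpha \<alpha> \<noteq> \<infinity>" "total_mass \<noteq> \<infinity>" "\<Sigma> \<in> space lborel_spd \<Longrightarrow> marg_Sigma \<Sigma> \<noteq> \<infinity>" "\<Sigma>
    \<in> space lborel_spd \<Longrightarrow> u \<alpha> \<Sigma> \<noteq> \<infinity>"
  using Sigma_finite[of \<alpha>] total_finite alpha_finite[of \<Sigma>] B_finite[of \<Sigma> \<alpha>]
      by (auto simp: marg_alpha_def total_mass_def marg_Sigma_def)

lemma fS_eq: "fS \<alpha> \<Sigma> = u \<alpha> \<Sigma> / marg_alpha \<alpha>" by (simp add: dens_Sigma_given_alpha_def marg_alpha_def)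
lemma fa_eq: "fa \<Sigma> \<alpha> = u \<alpha> \<Sigma> / marg_Sigma \<Sigma>" by (simp add: dens_alpha_given_Sigma_def marg_Sigma_def)

lemma fS_prob: "(\<integral>\<^sup>+\<Sigma>. fS \<alpha> \<Sigma> \<partial>lborel_spd) = 1"
  unfolding fS_eq using marg_alpha_pos[of \<alpha>] marginals_finite
  by (subst nn_integral_divide) (simp_all add: marg_alpha_def[symmetric] ennreal_divide_self_pos)

lemma fa_prob: "\<Sigma> \<in> space lborel_spd \<Longrightarrow> (\<integral>\<^sup>+\<alpha>. fa \<Sigma> \<alpha> \<partial>lborel) = 1"
  unfolding fa_eq using marg_Sigma_pos[of \<Sigma>] marginals_finite
  by (subst nn_integral_divide) (simp_all add: marg_Sigma_def[symmetric] ennreal_divide_self_pos)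

lemma fB_prob: "\<Sigma> \<in> space lborel_spd \<Longrightarrow> (\<integral>\<^sup>+B. fB \<alpha> \<Sigma> B \<partial>lborel) = 1"
  unfolding dens_B_given_alpha_Sigma_def using u_pos[of \<Sigma> \<alpha>] marginals_finite
  by (subst nn_integral_divide) (simp_all add: unnorm_alpha_Sigma_def[symmetric] ennreal_divide_self_pos)

text \<open>The conditional expectation of \<open>F\<close> given \<open>\<Sigma>\<close> under the posterior.\<close>

definition "cond_mean F \<Sigma> = (\<integral>\<^sup>+\<alpha>. fa \<Sigma> \<alpha> * (\<integral>\<^sup>+B. fB \<alpha> \<Sigma> B * F (\<alpha>, B, \<Sigma>) \<partial>lborel) \<partial>lborel)"

lemma measurable_cond_mean:
  assumes [measurable]: "F \<in> borel_measurable lborel_Theta"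
  shows "cond_mean F \<in> borel_measurable lborel_spd"
  unfolding cond_mean_def by measurable

lemma nn_integral_draw_alpha_B:
  assumes [measurable]: "\<phi> \<in> borel_measurable lborel_spd" "F \<in> borel_measurable lborel_Theta"
  shows "(\<integral>\<^sup>+z. F z \<partial>density lborel_Theta (\<lambda>(\<alpha>, B, \<Sigma>). \<phi> \<Sigma> * fa \<Sigma> \<alpha> * fB \<alpha> \<Sigma> B)) =
    (\<integral>\<^sup>+\<Sigma>. \<phi> \<Sigma> * cond_mean F \<Sigma> \<partial>lborel_spd)"
proof -
  have "(\<integral>\<^sup>+z. F z \<partial>density lborel_Theta (\<lambda>(\<alpha>, B, \<Sigma>). \<phi> \<Sigma> * fa \<Sigma> \<alpha> * fB \<alpha> \<Sigma> B)) =
     (\<integral>\<^sup>+z. (case z of (\<alpha>, B, \<Sigma>) \<Rightarrow> \<phi> \<Sigma> * fa \<Sigma> \<alpha> * fB \<alpha> \<Sigma> B) * F z \<partial>lborel_Theta)"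
    by (rule nn_integral_density) measurable
  also have "\<dots> = (\<integral>\<^sup>+\<Sigma>. \<integral>\<^sup>+\<alpha>. \<integral>\<^sup>+B. \<phi> \<Sigma> * fa \<Sigma> \<alpha> * fB \<alpha> \<Sigma> B * F (\<alpha>, B, \<Sigma>) \<partial>lborel \<partial>lborel \<partial>lborel_spd)"
    by (subst nn_integral_lborel_Theta(2)) simp_all
  also have "\<dots> = (\<integral>\<^sup>+\<Sigma>. \<integral>\<^sup>+\<alpha>. \<phi> \<Sigma> * (fa \<Sigma> \<alpha> * (\<integral>\<^sup>+B. fB \<alpha> \<Sigma> B * F (\<alpha>, B, \<Sigma>) \<partial>lborel)) \<partial>lborel \<partial>lborel_spd)"
    by (intro nn_integral_cong) (simp add: mult.assoc nn_integral_cmult)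
  also have "\<dots> = (\<integral>\<^sup>+\<Sigma>. \<phi> \<Sigma> * cond_mean F \<Sigma> \<partial>lborel_spd)"
    unfolding cond_mean_def by (intro nn_integral_cong nn_integral_cmult) measurable
  finally show ?thesis .
qed

lemma nn_integral_K_C:
  assumes "F \<in> borel_measurable lborel_Theta"
  shows "(\<integral>\<^sup>+z. F z \<partial>K_C g (\<alpha>', B', \<Sigma>')) = (\<integral>\<^sup>+\<Sigma>. fS \<alpha>' \<Sigma> * cond_mean F \<Sigma> \<partial>lborel_spd)"
  unfolding K_C_def case_prod_conv by (rule nn_integral_draw_alpha_B[OF _ assms]) measurable

lemma sets_K_C: "sets (K_C g z) = sets lborel_Theta"
  by (cases z) (simp add: K_C_def)

lemma cond_mean_const: "\<Sigma> \<in> space lborel_spd \<Longrightarrow> cond_mean (\<lambda>_. 1) \<Sigma> = 1"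
  unfolding cond_mean_def by (simp add: fB_prob fa_prob)

lemma prob_space_K_C: "prob_space (K_C g z)"
proof (cases z)
  case (fields \<alpha>' B' \<Sigma>')
  have "(\<integral>\<^sup>+z. 1 \<partial>K_C g (\<alpha>', B', \<Sigma>')) = (\<integral>\<^sup>+\<Sigma>. fS \<alpha>' \<Sigma> \<partial>lborel_spd)"
    by (subst nn_integral_K_C) (auto intro!: nn_integral_cong simp: cond_mean_const)
  then show ?thesis unfolding fields by (intro prob_spaceI) (simp add: fS_prob)
qed

lemma measurable_K_C: "K_C g \<in> lborel_Theta \<rightarrow>\<^sub>M prob_algebra lborel_Theta"
proof (intro measurable_prob_algebraI prob_space_K_C measurable_subprob_algebra sets_K_C)
  fix z show "subprob_space (K_C g z)" using prob_space_K_C by (rule prob_space_imp_subprob_space)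
next
  fix A :: "('k rvec \<times> ('p, 'r) rmat \<times> ('r, 'r) rmat) set" assume A[measurable]: "A \<in> sets lborel_Theta"
  have "emeasure (K_C g z) A = (\<integral>\<^sup>+\<Sigma>. fS (fst z) \<Sigma> * cond_mean (indicator A) \<Sigma> \<partial>lborel_spd)" for z
    using nn_integral_K_C[of "indicator A" "fst z" "fst (snd z)" "snd (snd z)"] A sets_K_C by simp
  moreover have [measurable]: "cond_mean (indicator A) \<in> borel_measurable lborel_spd"
      by (rule measurable_cond_mean) measurable
  ultimately show "(\<lambda>z. emeasure (K_C g z) A) \<in> borel_measurable lborel_Theta" by simp
qed

lemma posterior_eq: "posterior g = density lborel_Theta (\<lambda>(\<alpha>, B, \<Sigma>). ennreal (g \<alpha> B \<Sigma>) / total_mass)"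
proof -
  have "(\<integral>\<^sup>+ (\<alpha>, B, \<Sigma>). ennreal (g \<alpha> B \<Sigma>) \<partial>lborel_Theta) = total_mass"
    by (subst nn_integral_lborel_Theta(1)) (simp_all add: total_mass_def marg_alpha_def
        unnorm_alpha_Sigma_def)
  then show ?thesis by (simp add: posterior_def)
qed

lemma posterior_eq_draw_alpha_B:
  "posterior g = density lborel_Theta (\<lambda>(\<alpha>, B, \<Sigma>). marg_Sigma \<Sigma> / total_mass * fa \<Sigma> \<alpha> * fB \<alpha> \<Sigma> B)"
  unfolding posterior_eq
proof (rule density_cong)
  show "AE z in lborel_Theta. (case z of (\<alpha>, B, \<Sigma>) \<Rightarrow> ennreal (g \<alpha> B \<Sigma>) / total_mass) =
      (case z of (\<alpha>, B, \<Sigma>) \<Rightarrow> marg_Sigma \<Sigma> / total_mass * fa \<Sigma> \<alpha> * fB \<alpha> \<Sigma> B)"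
  proof (intro AE_I2, clarify)
    fix \<alpha> :: "'k rvec" and B :: "('p, 'r) rmat" and \<Sigma> :: "('r, 'r) rmat"
    assume "(\<alpha>, B, \<Sigma>) \<in> space lborel_Theta"
    then have \<Sigma>: "\<Sigma> \<in> space lborel_spd" by (simp add: space_pair_measure)
    have "marg_Sigma \<Sigma> / total_mass * fa \<Sigma> \<alpha> * fB \<alpha> \<Sigma> B = (marg_Sigma \<Sigma> * fa \<Sigma> \<alpha>) * fB \<alpha> \<Sigma> B / total_mass"
      by (simp add: divide_ennreal_def mult_ac)
    also have "marg_Sigma \<Sigma> * fa \<Sigma> \<alpha> = u \<alpha> \<Sigma>"
      unfolding fa_eq using marg_Sigma_pos[OF \<Sigma>] marginals_finite(3)[OF \<Sigma>]
          by (intro ennreal_mult_divide_cancel) auto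
    also have "u \<alpha> \<Sigma> * fB \<alpha> \<Sigma> B = ennreal (g \<alpha> B \<Sigma>)"
      unfolding dens_B_given_alpha_Sigma_def using u_pos[OF \<Sigma>, of \<alpha>] marginals_finite(4)[OF \<Sigma>]
      by (intro ennreal_mult_divide_cancel) auto
    finally show "ennreal (g \<alpha> B \<Sigma>) / total_mass = marg_Sigma \<Sigma> / total_mass * fa \<Sigma> \<alpha> * fB \<alpha> \<Sigma> B" ..
  qed
qed measurable

lemma nn_integral_posterior:
  assumes "F \<in> borel_measurable lborel_Theta"
  shows "(\<integral>\<^sup>+z. F z \<partial>posterior g) = (\<integral>\<^sup>+\<Sigma>. marg_Sigma \<Sigma> / total_mass * cond_mean F \<Sigma> \<partial>lborel_spd)"
  unfolding posterior_eq_draw_alpha_B by (rule nn_integral_draw_alpha_B[OF _ assms]) measurable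

lemma sets_posterior: "sets (posterior g) = sets lborel_Theta"
  by (simp add: posterior_def)

lemma prob_space_posterior: "prob_space (posterior g)"
proof (rule prob_spaceI)
  have "(\<integral>\<^sup>+z. 1 \<partial>posterior g) = (\<integral>\<^sup>+\<Sigma>. marg_Sigma \<Sigma> / total_mass \<partial>lborel_spd)"
    by (subst nn_integral_posterior) (auto intro!: nn_integral_cong simp: cond_mean_const)
  also have "\<dots> = (\<integral>\<^sup>+\<Sigma>. marg_Sigma \<Sigma> \<partial>lborel_spd) / total_mass" by (rule nn_integral_divide) measurable
  also have "(\<integral>\<^sup>+\<Sigma>. marg_Sigma \<Sigma> \<partial>lborel_spd) = total_mass"
      unfolding marg_Sigma_def total_mass_def marg_alpha_def
    by (rule vec_spd.Fubini') measurable
  finally show "emeasure (posterior g) (space (posterior g)) = 1"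
    using total_mass_pos marginals_finite by (simp add: ennreal_divide_self_pos)
qed

lemma posterior_in_prob_algebra: "posterior g \<in> space (prob_algebra lborel_Theta)"
  using prob_space_posterior sets_posterior by (simp add: space_prob_algebra)

text \<open>
  Starting from the posterior, the draw of \<open>\<Sigma>\<close> given \<open>\<alpha>\<close> has the marginal law of \<open>\<Sigma>\<close>, since
  \<open>marg_alpha \<alpha> * fS \<alpha> \<Sigma> = u \<alpha> \<Sigma>\<close>; the draws of \<open>\<alpha>\<close> and \<open>B\<close> restore the joint law.
\<close>

lemma posterior_invariant: "bind (posterior g) (K_C g) = posterior g"
proof (rule measure_eqI)
  have ne: "space (posterior g) \<noteq> {}" using prob_space_posterior by (rule prob_space.not_empty)
  have K: "K_C g \<in> posterior g \<rightarrow>\<^sub>M subprob_algebra lborel_Theta"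
    using measurable_prob_algebraD[OF measurable_K_C] sets_posterior by (simp cong: measurable_cong_sets)
  show s: "sets (bind (posterior g) (K_C g)) = sets (posterior g)"
    using sets_bind[OF _ ne, of "K_C g" lborel_Theta] by (simp add: sets_K_C sets_posterior)
  fix A assume "A \<in> sets (bind (posterior g) (K_C g))"
  then have A[measurable]: "A \<in> sets lborel_Theta" using s sets_posterior by simp
  have [measurable]: "cond_mean (indicator A) \<in> borel_measurable lborel_spd"
      by (rule measurable_cond_mean) measurable
  let ?H = "\<lambda>\<alpha>. \<integral>\<^sup>+\<Sigma>. fS \<alpha> \<Sigma> * cond_mean (indicator A) \<Sigma> \<partial>lborel_spd"
  have H: "emeasure (K_C g z) A = ?H (fst z)" for z
    using nn_integral_K_C[of "indicator A" "fst z" "fst (snd z)" "snd (snd z)"] A sets_K_C by simp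
  have "emeasure (bind (posterior g) (K_C g)) A = (\<integral>\<^sup>+z. ?H (fst z) \<partial>posterior g)"
    by (simp add: emeasure_bind[OF ne K A] H)
  also have "\<dots> = (\<integral>\<^sup>+z. (case z of (\<alpha>, B, \<Sigma>) \<Rightarrow> ennreal (g \<alpha> B \<Sigma>) / total_mass) * ?H (fst z) \<partial>lborel_Theta)"
    unfolding posterior_eq by (rule nn_integral_density) measurable
  also have "\<dots> = (\<integral>\<^sup>+\<alpha>. \<integral>\<^sup>+\<Sigma>. \<integral>\<^sup>+B. ennreal (g \<alpha> B \<Sigma>) * (?H \<alpha> / total_mass) \<partial>lborel \<partial>lborel_spd \<partial>lborel)"
    by (subst nn_integral_lborel_Theta(1)) (simp_all add: ennreal_divide_times)
  also have "\<dots> = (\<integral>\<^sup>+\<alpha>. marg_alpha \<alpha> * (?H \<alpha> / total_mass) \<partial>lborel)"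
  proof -
    have "(\<integral>\<^sup>+\<Sigma>. \<integral>\<^sup>+B. ennreal (g \<alpha> B \<Sigma>) * c \<partial>lborel \<partial>lborel_spd) = marg_alpha \<alpha> * c" for \<alpha> c
    proof -
      have "(\<integral>\<^sup>+\<Sigma>. \<integral>\<^sup>+B. ennreal (g \<alpha> B \<Sigma>) * c \<partial>lborel \<partial>lborel_spd) = (\<integral>\<^sup>+\<Sigma>. u \<alpha> \<Sigma> * c \<partial>lborel_spd)"
        unfolding unnorm_alpha_Sigma_def by (intro nn_integral_cong nn_integral_multc) measurable
      also have "\<dots> = marg_alpha \<alpha> * c" unfolding marg_alpha_def by (rule nn_integral_multc) measurable
      finally show ?thesis .
    qed
    then show ?thesis by simp
  qed
  also have "\<dots> = (\<integral>\<^sup>+\<alpha>. (\<integral>\<^sup>+\<Sigma>. marg_alpha \<alpha> * (fS \<alpha> \<Sigma> * cond_mean (indicator A)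
      \<Sigma>) \<partial>lborel_spd) / total_mass \<partial>lborel)"
    by (intro nn_integral_cong) (simp add: nn_integral_cmult ennreal_times_divide)
  also have "\<dots> = (\<integral>\<^sup>+\<alpha>. (\<integral>\<^sup>+\<Sigma>. u \<alpha> \<Sigma> * cond_mean (indicator A) \<Sigma> \<partial>lborel_spd) / total_mass \<partial>lborel)"
    using marg_alpha_pos marginals_finite(1) unfolding fS_eq
    by (simp add: mult.assoc[symmetric] ennreal_mult_divide_cancel less_imp_neq[symmetric])
  also have "\<dots> = (\<integral>\<^sup>+\<alpha>. (\<integral>\<^sup>+\<Sigma>. u \<alpha> \<Sigma> * cond_mean (indicator A) \<Sigma> / total_mass \<partial>lborel_spd) \<partial>lborel)"
    by (intro nn_integral_cong) (simp add: nn_integral_divide)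
  also have "\<dots> = (\<integral>\<^sup>+\<Sigma>. (\<integral>\<^sup>+\<alpha>. u \<alpha> \<Sigma> * cond_mean (indicator A) \<Sigma> / total_mass \<partial>lborel) \<partial>lborel_spd)"
    by (rule vec_spd.Fubini'[symmetric]) measurable
  also have "\<dots> = (\<integral>\<^sup>+\<Sigma>. marg_Sigma \<Sigma> / total_mass * cond_mean (indicator A) \<Sigma> \<partial>lborel_spd)"
    unfolding marg_Sigma_def by (intro nn_integral_cong) (simp add: nn_integral_divide nn_integral_multc
        ennreal_divide_times ennreal_times_divide mult.commute)
  also have "\<dots> = emeasure (posterior g) A"
    using nn_integral_posterior[of "indicator A"] A sets_posterior by simp
  finally show "emeasure (bind (posterior g) (K_C g)) A = emeasure (posterior g) A" .
qed

text \<open>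
  From any start the first step reaches \<open>S\<close> with probability at least one half, and from \<open>S\<close> the second
  step dominates \<open>\<epsilon>\<close> times the law \<open>\<nu>\<close> that draws \<open>\<Sigma>\<close> from \<open>\<eta>\<close> and then \<open>\<alpha>\<close> and \<open>B\<close> as the sampler
  does.
\<close>

lemma geometrically_ergodic_K_C:
  fixes \<epsilon> :: real and S :: "'k rvec set" and \<eta> :: "('r, 'r) rmat \<Rightarrow> ennreal"
  assumes S[measurable]: "S \<in> sets borel" and \<eta>[measurable]: "\<eta>
      \<in> borel_measurable lborel_spd" and \<eta>1: "(\<integral>\<^sup>+\<Sigma>. \<eta> \<Sigma> \<partial>lborel_spd) = 1"
    and \<epsilon>: "\<epsilon> > 0" and minor: "\<And>\<alpha> \<Sigma>. \<alpha> \<in> S \<Longrightarrow> \<Sigma> \<in> space lborel_spd \<Longrightarrow> ennreal \<epsilon> * \<eta> \<Sigma> \<le> fS \<alpha> \<Sigma>"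
    and tight: "\<And>\<Sigma>. \<Sigma> \<in> space lborel_spd \<Longrightarrow> marg_Sigma \<Sigma> \<le> 2 * (\<integral>\<^sup>+\<alpha>. u \<alpha> \<Sigma> * indicator S \<alpha> \<partial>lborel)"
  shows "geometrically_ergodic lborel_Theta (K_C g) (posterior g)"
proof -
  define \<nu> where "\<nu> = density lborel_Theta (\<lambda>(\<alpha>, B, \<Sigma>). \<eta> \<Sigma> * fa \<Sigma> \<alpha> * fB \<alpha> \<Sigma> B)"
  have \<nu>_int: "(\<integral>\<^sup>+z. F z \<partial>\<nu>) = (\<integral>\<^sup>+\<Sigma>. \<eta> \<Sigma> * cond_mean F \<Sigma> \<partial>lborel_spd)"
    if "F \<in> borel_measurable lborel_Theta" for F
    unfolding \<nu>_def using \<eta> that by (rule nn_integral_draw_alpha_B)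
  have "(\<integral>\<^sup>+z. 1 \<partial>\<nu>) = (\<integral>\<^sup>+\<Sigma>. \<eta> \<Sigma> \<partial>lborel_spd)"
    by (subst \<nu>_int) (auto intro!: nn_integral_cong simp: cond_mean_const)
  then have "prob_space \<nu>" by (intro prob_spaceI) (simp add: \<eta>1)
  then have \<nu>: "\<nu> \<in> space (prob_algebra lborel_Theta)" by (simp add: space_prob_algebra \<nu>_def)
  have half: "1 \<le> 2 * (\<integral>\<^sup>+\<alpha>. fa \<Sigma> \<alpha> * indicator S \<alpha> \<partial>lborel)" if \<Sigma>: "\<Sigma> \<in> space lborel_spd" for \<Sigma>
  proof -
    have "1 = marg_Sigma \<Sigma> / marg_Sigma \<Sigma>" using marg_Sigma_pos[OF \<Sigma>] marginals_finite(3)[OF \<Sigma>]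
        by (simp add: ennreal_divide_self_pos)
    also have "\<dots> \<le> 2 * (\<integral>\<^sup>+\<alpha>. u \<alpha> \<Sigma> * indicator S \<alpha> \<partial>lborel) / marg_Sigma \<Sigma>"
        by (intro divide_right_mono_ennreal tight \<Sigma>)
    also have "\<dots> = 2 * (\<integral>\<^sup>+\<alpha>. u \<alpha> \<Sigma> * indicator S \<alpha> / marg_Sigma \<Sigma> \<partial>lborel)"
      using \<Sigma> by (simp add: nn_integral_divide ennreal_times_divide)
    also have "\<dots> = 2 * (\<integral>\<^sup>+\<alpha>. fa \<Sigma> \<alpha> * indicator S \<alpha> \<partial>lborel)"
      unfolding fa_eq by (simp add: ennreal_divide_times ennreal_times_divide mult.commute)
    finally show ?thesis .
  qed
  show ?thesis
  proof (rule geometrically_ergodic_of_two_step_minorization[OF measurable_K_C posterior_in_prob_algebra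
      posterior_invariant \<nu>])
    show "\<epsilon> / 2 > 0" using \<epsilon> by simp
  next
    fix x :: "'k rvec \<times> ('p, 'r) rmat \<times> ('r, 'r) rmat" and F :: "'k rvec \<times> ('p, 'r) rmat \<times> ('r, 'r) rmat
        \<Rightarrow> ennreal"
    assume F[measurable]: "F \<in> borel_measurable lborel_Theta"
    obtain \<alpha>' B' \<Sigma>' where x: "x = (\<alpha>', B', \<Sigma>')" by (cases x)
    have [measurable]: "cond_mean F \<in> borel_measurable lborel_spd" by (rule measurable_cond_mean) measurable
    define t where "t = (\<integral>\<^sup>+z. F z \<partial>\<nu>)"
    have low: "ennreal \<epsilon> * t * indicator S (fst y) \<le> (\<integral>\<^sup>+z. F z \<partial>K_C g y)" for y
    proof (cases "fst y \<in> S")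
      case True
      have "ennreal \<epsilon> * t = (\<integral>\<^sup>+\<Sigma>. ennreal \<epsilon> * (\<eta> \<Sigma> * cond_mean F \<Sigma>) \<partial>lborel_spd)"
        unfolding t_def by (simp add: \<nu>_int nn_integral_cmult)
      also have "\<dots> \<le> (\<integral>\<^sup>+\<Sigma>. fS (fst y) \<Sigma> * cond_mean F \<Sigma> \<partial>lborel_spd)"
        using minor[OF True] by (intro nn_integral_mono) (simp add: mult.assoc[symmetric] mult_right_mono)
      also have "\<dots> = (\<integral>\<^sup>+z. F z \<partial>K_C g y)"
        using nn_integral_K_C[of F "fst y" "fst (snd y)" "snd (snd y)"] by simp
      finally show ?thesis using True by simp
    qed simp
    have [measurable]: "(\<lambda>y. ennreal \<epsilon> * t * indicator S (fst y)) \<in> borel_measurable lborel_Theta"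
        by measurable
    have "ennreal (\<epsilon> / 2) * t = (\<integral>\<^sup>+\<Sigma>. fS \<alpha>' \<Sigma> * (ennreal (\<epsilon> / 2) * t) \<partial>lborel_spd)"
      by (simp add: nn_integral_multc fS_prob)
    also have "\<dots> \<le> (\<integral>\<^sup>+\<Sigma>. fS \<alpha>' \<Sigma> * cond_mean (\<lambda>y. ennreal \<epsilon> * t * indicator S (fst y)) \<Sigma> \<partial>lborel_spd)"
    proof (intro nn_integral_mono mult_left_mono)
      fix \<Sigma> :: "('r, 'r) rmat" assume \<Sigma>: "\<Sigma> \<in> space lborel_spd"
      have "ennreal (\<epsilon> / 2) * t * 1 \<le> ennreal (\<epsilon> / 2) * t * (2 * (\<integral>\<^sup>+\<alpha>. fa \<Sigma> \<alpha> * indicator S \<alpha> \<partial>lborel))"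
        by (intro mult_left_mono half \<Sigma>) simp
      also have "\<dots> = ennreal \<epsilon> * t * (\<integral>\<^sup>+\<alpha>. fa \<Sigma> \<alpha> * indicator S \<alpha> \<partial>lborel)"
      proof -
        have "ennreal (\<epsilon> / 2) * 2 = ennreal \<epsilon>"
          using \<epsilon> ennreal_mult[of "\<epsilon> / 2" 2] by simp
        moreover have "ennreal (\<epsilon> / 2) * t * (2 * c) = (ennreal (\<epsilon> / 2) * 2) * t * c" for c
          by (simp only: mult_ac)
        ultimately show ?thesis by simp
      qed
      also have "\<dots> = cond_mean (\<lambda>y. ennreal \<epsilon> * t * indicator S (fst y)) \<Sigma>"
      proof -
        have "cond_mean (\<lambda>y. ennreal \<epsilon> * t * indicator S (fst y)) \<Sigma>
            = (\<integral>\<^sup>+\<alpha>. fa \<Sigma> \<alpha> * (ennreal \<epsilon> * t * indicator S \<alpha>) \<partial>lborel)"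
          unfolding cond_mean_def using \<Sigma> by (simp add: nn_integral_multc fB_prob)
        also have "\<dots> = (\<integral>\<^sup>+\<alpha>. (ennreal \<epsilon> * t) * (fa \<Sigma> \<alpha> * indicator S \<alpha>) \<partial>lborel)"
          by (simp only: mult_ac)
        also have "\<dots> = ennreal \<epsilon> * t * (\<integral>\<^sup>+\<alpha>. fa \<Sigma> \<alpha> * indicator S \<alpha> \<partial>lborel)"
          using \<Sigma> by (intro nn_integral_cmult) measurable
        finally show ?thesis ..
      qed
      finally show "ennreal (\<epsilon> / 2) * t \<le> cond_mean (\<lambda>y. ennreal \<epsilon> * t * indicator S (fst y)) \<Sigma>" by simp
    qed simp
    also have "\<dots> = (\<integral>\<^sup>+y. ennreal \<epsilon> * t * indicator S (fst y) \<partial>K_C g x)"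
      unfolding x by (rule nn_integral_K_C[symmetric]) measurable
    also have "\<dots> \<le> (\<integral>\<^sup>+y. (\<integral>\<^sup>+z. F z \<partial>K_C g y) \<partial>K_C g x)" by (intro nn_integral_mono low)
    finally show "ennreal (\<epsilon> / 2) * (\<integral>\<^sup>+z. F z \<partial>\<nu>) \<le> (\<integral>\<^sup>+y. (\<integral>\<^sup>+z. F z \<partial>K_C g y) \<partial>K_C g x)" unfolding t_def .
  qed
qed

lemma mat_1_spd: "mat 1 \<in> space (lborel_spd :: ('r, 'r) rmat measure)"
  by (simp add: space_lborel_spd sym_pos_def_def)

lemma K_G_eq_distr: "K_G g (\<alpha>', \<Sigma>') = distr (K_C g (\<alpha>', B', \<Sigma>')) lborel_alpha_Sigma (\<lambda>(\<alpha>, B, \<Sigma>). (\<alpha>, \<Sigma>))"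
proof (rule measure_eqI)
  show "sets (K_G g (\<alpha>', \<Sigma>')) = sets (distr (K_C g (\<alpha>', B', \<Sigma>')) lborel_alpha_Sigma (\<lambda>(\<alpha>, B, \<Sigma>). (\<alpha>, \<Sigma>)))"
    by (simp add: K_G_def)
  fix A assume "A \<in> sets (K_G g (\<alpha>', \<Sigma>'))"
  then have A[measurable]: "A \<in> sets lborel_alpha_Sigma" by (simp add: K_G_def)
  have proj: "(\<lambda>(\<alpha>, B, \<Sigma>). (\<alpha>, \<Sigma>)) \<in> K_C g (\<alpha>', B', \<Sigma>') \<rightarrow>\<^sub>M lborel_alpha_Sigma"
    unfolding measurable_cong_sets[OF sets_K_C refl] by measurable
  have "emeasure (distr (K_C g (\<alpha>', B', \<Sigma>')) lborel_alpha_Sigma (\<lambda>(\<alpha>, B, \<Sigma>). (\<alpha>, \<Sigma>))) A =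
     (\<integral>\<^sup>+z. indicator A z \<partial>distr (K_C g (\<alpha>', B', \<Sigma>')) lborel_alpha_Sigma (\<lambda>(\<alpha>, B, \<Sigma>). (\<alpha>, \<Sigma>)))"
    using A by (intro nn_integral_indicator[symmetric]) simp
  also have "\<dots> = (\<integral>\<^sup>+z. indicator A (case z of (\<alpha>, B, \<Sigma>) \<Rightarrow> (\<alpha>, \<Sigma>)) \<partial>K_C g (\<alpha>', B', \<Sigma>'))"
    by (rule nn_integral_distr[OF proj]) measurable
  also have "\<dots> = (\<integral>\<^sup>+\<Sigma>. fS \<alpha>' \<Sigma> * (\<integral>\<^sup>+\<alpha>. fa \<Sigma> \<alpha> * indicator A (\<alpha>, \<Sigma>) \<partial>lborel) \<partial>lborel_spd)"
    by (subst nn_integral_K_C) (auto intro!: nn_integral_cong simp: cond_mean_def nn_integral_multc fB_prob)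
  also have "\<dots> = (\<integral>\<^sup>+\<Sigma>. (\<integral>\<^sup>+\<alpha>. fa \<Sigma> \<alpha> * fS \<alpha>' \<Sigma> * indicator A (\<alpha>, \<Sigma>) \<partial>lborel) \<partial>lborel_spd)"
    by (intro nn_integral_cong) (simp add: nn_integral_cmult[symmetric] mult_ac)
  also have "\<dots> = (\<integral>\<^sup>+z. (case z of (\<alpha>, \<Sigma>) \<Rightarrow> fa \<Sigma> \<alpha> * fS \<alpha>' \<Sigma>) * indicator A z \<partial>lborel_alpha_Sigma)"
    by (subst vec_spd.nn_integral_snd[symmetric]) (simp_all)
  also have "\<dots> = emeasure (K_G g (\<alpha>', \<Sigma>')) A"
    unfolding K_G_def case_prod_conv by (rule emeasure_density[symmetric]) measurable
  finally show "emeasure (K_G g (\<alpha>', \<Sigma>')) A = emeasure (distr (K_C g (\<alpha>', B', \<Sigma>')) lborel_alpha_Sigma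
      (\<lambda>(\<alpha>, B, \<Sigma>). (\<alpha>, \<Sigma>))) A" ..
qed

lemma K_A_eq_distr: "K_A g \<alpha>' = distr (K_G g (\<alpha>', \<Sigma>')) lborel fst"
proof (rule measure_eqI)
  show "sets (K_A g \<alpha>') = sets (distr (K_G g (\<alpha>', \<Sigma>')) lborel fst)"
    by (simp add: K_A_def)
  fix A assume "A \<in> sets (K_A g \<alpha>')"
  then have A[measurable]: "A \<in> sets borel" by (simp add: K_A_def)
  have fst: "fst \<in> K_G g (\<alpha>', \<Sigma>') \<rightarrow>\<^sub>M lborel" by (simp add: K_G_def)
  have "emeasure (distr (K_G g (\<alpha>', \<Sigma>')) lborel fst) A
      = (\<integral>\<^sup>+z. indicator A z \<partial>distr (K_G g (\<alpha>', \<Sigma>')) lborel fst)"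
    using A by (intro nn_integral_indicator[symmetric]) simp
  also have "\<dots> = (\<integral>\<^sup>+z. indicator A (fst z) \<partial>K_G g (\<alpha>', \<Sigma>'))"
    by (rule nn_integral_distr[OF fst]) measurable
  also have "\<dots> = (\<integral>\<^sup>+z. (case z of (\<alpha>, \<Sigma>) \<Rightarrow> fa \<Sigma> \<alpha> * fS \<alpha>' \<Sigma>) * indicator A (fst z) \<partial>lborel_alpha_Sigma)"
    unfolding K_G_def case_prod_conv by (rule nn_integral_density) measurable
  also have "\<dots> = (\<integral>\<^sup>+\<alpha>. (\<integral>\<^sup>+\<Sigma>. fa \<Sigma> \<alpha> * fS \<alpha>' \<Sigma> * indicator A \<alpha> \<partial>lborel_spd) \<partial>lborel)"
    by (subst spd.nn_integral_fst[symmetric]) simp_all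
  also have "\<dots> = (\<integral>\<^sup>+\<alpha>. (\<integral>\<^sup>+\<Sigma>. fa \<Sigma> \<alpha> * fS \<alpha>' \<Sigma> \<partial>lborel_spd) * indicator A \<alpha> \<partial>lborel)"
    by (intro nn_integral_cong) (simp add: nn_integral_multc)
  also have "\<dots> = emeasure (K_A g \<alpha>') A"
    unfolding K_A_def case_prod_conv by (rule emeasure_density[symmetric]) auto
  finally show "emeasure (K_A g \<alpha>') A = emeasure (distr (K_G g (\<alpha>', \<Sigma>')) lborel fst) A" ..
qed

lemma geometrically_ergodic_K_G:
  assumes "geometrically_ergodic lborel_Theta (K_C g) (posterior g)"
  shows "geometrically_ergodic lborel_alpha_Sigma (K_G g) (posterior_alpha_Sigma g)"
  using assms
proof (rule geometrically_ergodic_image[where f = "\<lambda>(\<alpha>, B, \<Sigma>). (\<alpha>, \<Sigma>)" and s = "\<lambda>(\<alpha>, \<Sigma>). (\<alpha>, 0, \<Sigma>)"])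
  fix x :: "'k rvec \<times> ('p, 'r) rmat \<times> ('r, 'r) rmat"
  show "K_G g (case x of (\<alpha>, B, \<Sigma>) \<Rightarrow> (\<alpha>, \<Sigma>)) = distr (K_C g x) lborel_alpha_Sigma (\<lambda>(\<alpha>, B, \<Sigma>). (\<alpha>, \<Sigma>))"
    by (cases x) (simp add: K_G_eq_distr[symmetric])
qed (auto simp: posterior_alpha_Sigma_def)

lemma geometrically_ergodic_K_A:
  assumes "geometrically_ergodic lborel_alpha_Sigma (K_G g) (posterior_alpha_Sigma g)"
  shows "geometrically_ergodic lborel (K_A g) (posterior_alpha g)"
  using assms
proof (rule geometrically_ergodic_image[where f = fst and s = "\<lambda>\<alpha>. (\<alpha>, mat 1)"])
  fix x :: "'k rvec \<times> ('r, 'r) rmat"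
  show "K_A g (fst x) = distr (K_G g x) lborel fst"
    using K_A_eq_distr[of "fst x" "snd x"] by simp
  show "(\<lambda>\<alpha>. (\<alpha>, mat 1) :: 'k rvec \<times> ('r, 'r) rmat) \<in> lborel \<rightarrow>\<^sub>M lborel_alpha_Sigma"
    by (intro measurable_Pair measurable_const mat_1_spd) auto
  have "(\<lambda>(\<alpha>, B, \<Sigma>). (\<alpha>, \<Sigma>)) \<in> posterior g \<rightarrow>\<^sub>M lborel_alpha_Sigma"
    unfolding measurable_cong_sets[OF sets_posterior refl] by measurable
  moreover have "fst \<circ> (\<lambda>(\<alpha>, B, \<Sigma>). (\<alpha>, \<Sigma>)) = (\<lambda>(\<alpha> :: 'k rvec, B :: ('p, 'r) rmat, \<Sigma> :: ('r, 'r) rmat). \<alpha>)"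
    by auto
  ultimately show "posterior_alpha g = distr (posterior_alpha_Sigma g) lborel fst"
    unfolding posterior_alpha_def posterior_alpha_Sigma_def by (subst distr_distr) simp_all
qed auto

end

section \<open>Tails of Gaussian densities with a degenerate quadratic form\<close>

lemma borel_measurable_apply2:
  fixes q :: "'a::second_countable_topology \<Rightarrow> 'b::second_countable_topology \<Rightarrow> 'c::topological_space"
  assumes q: "(\<lambda>z. q (fst z) (snd z)) \<in> borel_measurable borel"
    and [measurable]: "f \<in> borel_measurable M" "h \<in> borel_measurable M"
  shows "(\<lambda>x. q (f x) (h x)) \<in> borel_measurable M"
proof -
  have "(\<lambda>x. (f x, h x)) \<in> borel_measurable M" by measurable
  from measurable_compose[OF this q] show ?thesis by simp
qed

lemma nn_integral_lborel_affine:
  fixes t :: "'a::euclidean_space"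
  assumes [measurable]: "f \<in> borel_measurable borel" and "c \<noteq> 0"
  shows "(\<integral>\<^sup>+x. f x \<partial>lborel) = ennreal (\<bar>c\<bar> ^ DIM('a)) * (\<integral>\<^sup>+x. f (t + c *\<^sub>R x) \<partial>lborel)"
  by (subst lborel_affine[OF \<open>c \<noteq> 0\<close>, of t])
    (simp add: nn_integral_density nn_integral_distr nn_integral_cmult)

lemma sym_pos_def_form_diff_bounds:
  fixes C :: "real^'k^'k"
  assumes "sym_pos_def C"
  shows "(y - d) \<bullet> (C *v (y - d)) \<le> 2 * (y \<bullet> (C *v y)) + 2 * (d \<bullet> (C *v d))"
    and "y \<bullet> (C *v y) / 2 - d \<bullet> (C *v d) \<le> (y - d) \<bullet> (C *v (y - d))"
proof -
  have nn: "0 \<le> x \<bullet> (C *v x)" for x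
    using assms by (cases "x = 0") (auto simp: sym_pos_def_def intro: less_imp_le)
  have sym: "d \<bullet> (C *v y) = y \<bullet> (C *v d)"
    using assms sym_matrix_inner[of C d y] by (simp add: sym_pos_def_def inner_commute)
  show "(y - d) \<bullet> (C *v (y - d)) \<le> 2 * (y \<bullet> (C *v y)) + 2 * (d \<bullet> (C *v d))"
    using nn[of "y + d"]
    by (simp add: matrix_vector_mult_diff_distrib matrix_vector_right_distrib inner_add_left
        inner_add_right inner_diff_left inner_diff_right sym)
  show "y \<bullet> (C *v y) / 2 - d \<bullet> (C *v d) \<le> (y - d) \<bullet> (C *v (y - d))"
    using nn[of "y - 2 *\<^sub>R d"]
    by (simp add: matrix_vector_mult_diff_distrib matrix_vector_mult_scaleR inner_diff_left
        inner_diff_right sym)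
qed

definition gauss_mass ::
  "real^'k^'k \<Rightarrow> real^'k \<Rightarrow> (real^'k \<Rightarrow> 'b::euclidean_space \<Rightarrow> real) \<Rightarrow> (real^'k) set \<Rightarrow> ennreal" where
  "gauss_mass C d q S = (\<integral>\<^sup>+y. indicator S y *
     (\<integral>\<^sup>+b. ennreal (exp (- (1/2) * ((y - d) \<bullet> (C *v (y - d))) - (1/2) * q y b)) \<partial>lborel) \<partial>lborel)"

text \<open>
  Up to constants depending on \<open>C\<close> and \<open>d\<close>, the mass outside the ball is at most \<open>exp (- c \<rho>\<^sup>2 / 8)\<close> times
  the integral of \<open>exp (- Q y / 8 - q / 2)\<close>, where \<open>Q\<close> is the form of \<open>C\<close>, and the total mass is at least
  the integral of \<open>exp (- Q y - q / 2)\<close>. The substitution by the factor \<open>s = 1 / sqrt 8\<close> turns the latter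
  integrand into \<open>exp (- Q y / 8 - q / 16)\<close>, which is at least the former, whatever \<open>q\<close> is. So \<open>\<rho>\<close>
  depends on \<open>C\<close>, \<open>d\<close> and the dimensions alone.
\<close>

lemma gaussian_mass_outside_ball:
  fixes C :: "real^'k^'k" and d :: "real^'k"
  assumes C: "sym_pos_def C"
  obtains \<rho> where "\<rho> \<ge> 0"
    "\<forall>q :: real^'k \<Rightarrow> 'b::euclidean_space \<Rightarrow> real.
      (\<lambda>z. q (fst z) (snd z)) \<in> borel_measurable borel \<longrightarrow> (\<forall>y b. 0 \<le> q y b) \<longrightarrow>
      (\<forall>s y b. q (s *\<^sub>R y) (s *\<^sub>R b) = s\<^sup>2 * q y b) \<longrightarrow>
      2 * gauss_mass C d q (- cball 0 \<rho>) \<le> gauss_mass C d q UNIV"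
proof -
  obtain c where c: "c > 0" "\<And>x. c * (x \<bullet> x) \<le> x \<bullet> (C *v x)" using sym_pos_def_lower_bound[OF C] by blast
  have nn: "0 \<le> x \<bullet> (C *v x)" for x using c(1) c(2)[of x]
      by (meson inner_ge_zero mult_nonneg_nonneg less_imp_le order_trans)
  define e where "e = d \<bullet> (C *v d)"
  define s :: real where "s = 1 / sqrt 8"
  have s: "s > 0" "s\<^sup>2 = 1/8" by (simp_all add: s_def power_divide)
  define p where "p = s ^ DIM(real^'k) * s ^ DIM('b)"
  have p: "p > 0" using s by (simp add: p_def)
  \<comment> \<open>The value of \<open>c * \<rho>\<^sup>2 / 8\<close> at which the bound on the mass outside is half of the bound on the total
      mass.\<close>
  define \<tau> where "\<tau> = 3 / 2 * e + ln (2 / p)"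
  define \<rho> where "\<rho> = sqrt (8 * \<bar>\<tau>\<bar> / c)"
  have \<rho>: "\<rho> \<ge> 0" using c by (simp add: \<rho>_def)
  have \<rho>2: "c * \<rho>\<^sup>2 / 8 = \<bar>\<tau>\<bar>" using c by (simp add: \<rho>_def)
  have key: "2 * exp (e / 2 - c * \<rho>\<^sup>2 / 8) \<le> exp (- e) * p"
  proof -
    have "2 * exp (e / 2 - c * \<rho>\<^sup>2 / 8) \<le> 2 * exp (e / 2 - \<tau>)" unfolding \<rho>2 by simp
    also have "\<dots> = 2 * exp (- e - ln (2 / p))" by (simp add: \<tau>_def)
    also have "\<dots> = exp (- e) * p" using p by (simp add: exp_diff)
    finally show ?thesis .
  qed
  show ?thesis
  proof (rule that[OF \<rho>], intro allI impI)
    fix q :: "real^'k \<Rightarrow> 'b \<Rightarrow> real"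
    assume qm: "(\<lambda>z. q (fst z) (snd z)) \<in> borel_measurable borel" and "\<forall>y b. 0 \<le> q y b"
      and "\<forall>s y b. q (s *\<^sub>R y) (s *\<^sub>R b) = s\<^sup>2 * q y b"
    note q0 = this(2)[rule_format] and q2 = this(3)[rule_format]
    note [measurable (raw)] = borel_measurable_apply2[OF qm]
    let ?Q = "\<lambda>y. y \<bullet> (C *v y)"
    let ?f = "\<lambda>y b. ennreal (exp (- (1/2) * ?Q (y - d) - (1/2) * q y b))"
    let ?h = "\<lambda>y b. ennreal (exp (- (1/8) * ?Q y - (1/2) * q y b))"
    have low: "ennreal (exp (- e) * p) * (\<integral>\<^sup>+y. \<integral>\<^sup>+b. ?h y b \<partial>lborel \<partial>lborel)
        \<le> (\<integral>\<^sup>+y. \<integral>\<^sup>+b. ?f y b \<partial>lborel \<partial>lborel)"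
    proof -
      let ?k = "\<lambda>y b. ennreal (exp (- ?Q y - (1/2) * q y b))"
      have "?h y b \<le> ?k (0 + s *\<^sub>R y) (0 + s *\<^sub>R b)" for y b
        using q0[of y b] by (simp add: q2 matrix_vector_mult_scaleR s(2) power2_eq_square[symmetric]
            mult.assoc[symmetric])
      then have "ennreal p * (\<integral>\<^sup>+y. \<integral>\<^sup>+b. ?h y b \<partial>lborel \<partial>lborel) \<le>
          ennreal p * (\<integral>\<^sup>+y. \<integral>\<^sup>+b. ?k (0 + s *\<^sub>R y) (0 + s *\<^sub>R b) \<partial>lborel \<partial>lborel)"
        by (intro mult_left_mono nn_integral_mono) auto
      also have "\<dots> = ennreal (\<bar>s\<bar> ^ DIM(real^'k)) * (\<integral>\<^sup>+y. ennreal (\<bar>s\<bar> ^ DIM('b)) *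
          (\<integral>\<^sup>+b. ?k (0 + s *\<^sub>R y) (0 + s *\<^sub>R b) \<partial>lborel) \<partial>lborel)"
        using s by (simp add: nn_integral_cmult p_def ennreal_mult mult.assoc)
      also have "\<dots> = ennreal (\<bar>s\<bar> ^ DIM(real^'k)) * (\<integral>\<^sup>+y. (\<integral>\<^sup>+b. ?k (0 + s *\<^sub>R y) b \<partial>lborel) \<partial>lborel)"
        using s by (subst nn_integral_lborel_affine[of "\<lambda>b. ?k (0 + s *\<^sub>R _) b" s 0, symmetric]) auto
      also have "\<dots> = (\<integral>\<^sup>+y. (\<integral>\<^sup>+b. ?k y b \<partial>lborel) \<partial>lborel)"
        using s by (subst nn_integral_lborel_affine[of "\<lambda>y. \<integral>\<^sup>+b. ?k y b \<partial>lborel" s 0, symmetric]) auto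
      finally have 1: "ennreal p * (\<integral>\<^sup>+y. \<integral>\<^sup>+b. ?h y b \<partial>lborel \<partial>lborel)
          \<le> (\<integral>\<^sup>+y. (\<integral>\<^sup>+b. ?k y b \<partial>lborel) \<partial>lborel)" .
      have "ennreal (exp (- e)) * ?k y b \<le> ?f y b" for y b
        using sym_pos_def_form_diff_bounds(1)[OF C, of y d]
            by (simp add: ennreal_mult[symmetric] exp_add[symmetric] e_def)
      then have "(\<integral>\<^sup>+y. (\<integral>\<^sup>+b. ennreal (exp (- e)) * ?k y b \<partial>lborel) \<partial>lborel)
          \<le> (\<integral>\<^sup>+y. \<integral>\<^sup>+b. ?f y b \<partial>lborel \<partial>lborel)"
        by (intro nn_integral_mono)
      moreover have "(\<integral>\<^sup>+y. (\<integral>\<^sup>+b. ennreal (exp (- e)) * ?k y b \<partial>lborel) \<partial>lborel)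
          = ennreal (exp (- e)) * (\<integral>\<^sup>+y. (\<integral>\<^sup>+b. ?k y b \<partial>lborel) \<partial>lborel)"
        by (simp add: nn_integral_cmult)
      ultimately have 2: "ennreal (exp (- e)) * (\<integral>\<^sup>+y. (\<integral>\<^sup>+b. ?k y b \<partial>lborel) \<partial>lborel)
          \<le> (\<integral>\<^sup>+y. \<integral>\<^sup>+b. ?f y b \<partial>lborel \<partial>lborel)" by simp
      have "ennreal (exp (- e) * p) * (\<integral>\<^sup>+y. \<integral>\<^sup>+b. ?h y b \<partial>lborel \<partial>lborel)
          = ennreal (exp (- e)) * (ennreal p * (\<integral>\<^sup>+y. \<integral>\<^sup>+b. ?h y b \<partial>lborel \<partial>lborel))"
        using p by (simp add: ennreal_mult mult.assoc)
      also have "\<dots> \<le> ennreal (exp (- e)) * (\<integral>\<^sup>+y. (\<integral>\<^sup>+b. ?k y b \<partial>lborel) \<partial>lborel)"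
          by (intro mult_left_mono 1) simp
      also note 2
      finally show ?thesis .
    qed
    have out: "indicator (- cball 0 \<rho>) y * (\<integral>\<^sup>+b. ?f y b \<partial>lborel)
        \<le> ennreal (exp (e / 2 - c * \<rho>\<^sup>2 / 8)) * (\<integral>\<^sup>+b. ?h y b \<partial>lborel)" for y
    proof (cases "y \<in> cball 0 \<rho>")
      case False
      then have "\<rho>\<^sup>2 \<le> (norm y)\<^sup>2" using \<rho> by (intro power_mono) auto
      then have "c * \<rho>\<^sup>2 \<le> c * (y \<bullet> y)" using c by (intro mult_left_mono) (auto simp: dot_square_norm)
      then have "c * \<rho>\<^sup>2 \<le> ?Q y" using c(2)[of y] by simp
      then have "- (1/2) * ?Q (y - d) \<le> e / 2 - c * \<rho>\<^sup>2 / 8 - (1/8) * ?Q y"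
        using sym_pos_def_form_diff_bounds(2)[OF C, of y d] by (simp add: e_def)
      then have "?f y b \<le> ennreal (exp (e / 2 - c * \<rho>\<^sup>2 / 8)) * ?h y b" for b
        by (simp add: ennreal_mult[symmetric] exp_add[symmetric])
      then have "(\<integral>\<^sup>+b. ?f y b \<partial>lborel) \<le> (\<integral>\<^sup>+b. ennreal (exp (e / 2 - c * \<rho>\<^sup>2 / 8)) * ?h y b \<partial>lborel)"
        by (rule nn_integral_mono)
      then show ?thesis using False by (simp add: nn_integral_cmult)
    qed simp
    have "2 * (\<integral>\<^sup>+y. indicator (- cball 0 \<rho>) y * (\<integral>\<^sup>+b. ?f y b \<partial>lborel) \<partial>lborel) \<le>
       2 * (\<integral>\<^sup>+y. ennreal (exp (e / 2 - c * \<rho>\<^sup>2 / 8)) * (\<integral>\<^sup>+b. ?h y b \<partial>lborel) \<partial>lborel)"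
      by (intro mult_left_mono nn_integral_mono out) simp
    also have "\<dots> = ennreal (2 * exp (e / 2 - c * \<rho>\<^sup>2 / 8)) * (\<integral>\<^sup>+y. \<integral>\<^sup>+b. ?h y b \<partial>lborel \<partial>lborel)"
      by (simp add: nn_integral_cmult ennreal_mult mult.assoc)
    also have "\<dots> \<le> ennreal (exp (- e) * p) * (\<integral>\<^sup>+y. \<integral>\<^sup>+b. ?h y b \<partial>lborel \<partial>lborel)"
      using key by (intro mult_right_mono ennreal_leI) auto
    also note low
    finally show "2 * gauss_mass C d q (- cball 0 \<rho>) \<le> gauss_mass C d q UNIV" by (simp add: gauss_mass_def)
  qed
qed

section \<open>Least squares and block matrices\<close>

lemma least_squares_vec:
  fixes M :: "real^'c^'n"
  obtains x where "\<And>z. (M *v z) \<bullet> (v - M *v x) = 0"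
proof -
  have sub: "subspace (range ((*v) M))"
    by (rule linear_subspace_image) auto
  obtain y z where y: "y \<in> span (range ((*v) M))" and z: "\<And>w. w
      \<in> span (range ((*v) M)) \<Longrightarrow> orthogonal z w" and v: "v = y + z"
    using orthogonal_subspace_decomp_exists[of "range ((*v) M)" v] by metis
  have "y \<in> range ((*v) M)" using y sub by (metis span_eq_iff)
  then obtain x where x: "y = M *v x" by auto
  have "(M *v w) \<bullet> (v - M *v x) = 0" for w
    using z[of "M *v w"] v x by (simp add: span_base orthogonal_def inner_commute)
  then show ?thesis by (rule that)
qed

text \<open>The normal equations, solved column by column through orthogonal projection.\<close>

lemma least_squares:
  fixes M :: "real^'c^'n" and Y :: "real^'r^'n"
  obtains B :: "real^'r^'c" where "\<And>z w. (M *v z) \<bullet> ((Y - M ** B) *v w) = 0"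
proof -
  have "\<exists>x. \<forall>z. (M *v z) \<bullet> (column j Y - M *v x) = 0" for j
    using least_squares_vec[of M "column j Y"] by metis
  then obtain x where x: "\<And>j z. (M *v z) \<bullet> (column j Y - M *v x j) = 0" by metis
  define B where "B = (\<chi> i j. x j $ i)"
  have "(Y - M ** B) *v w = (\<Sum>j\<in>UNIV. w $ j *\<^sub>R (column j Y - M *v x j))" for w
    by (simp add: vec_eq_iff matrix_vector_mult_def matrix_matrix_mult_def column_def B_def mult.commute)
  then have "(M *v z) \<bullet> ((Y - M ** B) *v w) = 0" for z w by (simp add: inner_sum_right x)
  then show ?thesis by (rule that)
qed

lemma sum_UNIV_sum_type:
  fixes f :: "'a::finite + 'b::finite \<Rightarrow> real"
  shows "(\<Sum>c\<in>UNIV. f c) = (\<Sum>i\<in>UNIV. f (Inl i)) + (\<Sum>j\<in>UNIV. f (Inr j))"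
  unfolding UNIV_Plus_UNIV[symmetric] by (subst sum.Plus) auto

lemma hcat_mult_vec: "hcat M N *v x = M *v (\<chi> i. x $ Inl i) + N *v (\<chi> j. x $ Inr j)"
  for M :: "real^'a::finite^'n" and N :: "real^'b::finite^'n"
  by (simp add: vec_eq_iff matrix_vector_mult_def hcat_def sum_UNIV_sum_type)

lemma hcat_mult_mat: "hcat M N ** B = M ** (\<chi> i. B $ Inl i) + N ** (\<chi> j. B $ Inr j)"
  for M :: "real^'a::finite^'n" and N :: "real^'b::finite^'n"
  by (simp add: vec_eq_iff matrix_matrix_mult_def hcat_def sum_UNIV_sum_type)

lemma inner_sum_type: "x \<bullet> x = (\<chi> i. x $ Inl i) \<bullet> (\<chi> i. x $ Inl i) + (\<chi> j. x $ Inr j) \<bullet> (\<chi> j. x $ Inr j)"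
  for x :: "real^('a::finite + 'b::finite)"
  by (simp add: inner_vec_def sum_UNIV_sum_type)

lemma mult_vec_norm_le: "(M *v x) \<bullet> (M *v x) \<le> (M \<bullet> M) * (x \<bullet> x)" for M :: "real^'c^'n"
proof -
  have "(M *v x) \<bullet> (M *v x) = (\<Sum>i\<in>UNIV. (M $ i \<bullet> x)\<^sup>2)"
    by (simp add: inner_vec_def matrix_vector_mult_def power2_eq_square)
  also have "\<dots> \<le> (\<Sum>i\<in>UNIV. (M $ i \<bullet> M $ i) * (x \<bullet> x))"
    by (intro sum_mono Cauchy_Schwarz_ineq)
  also have "\<dots> = (M \<bullet> M) * (x \<bullet> x)" by (simp add: inner_vec_def[of M M] sum_distrib_right)
  finally show ?thesis .
qed

lemma inner_diff_le_twice_sum: "(a - b) \<bullet> (a - b) \<le> 2 * (a \<bullet> a) + 2 * (b \<bullet> b)" for a b :: "'a::real_inner"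
  using inner_ge_zero[of "a + b"] by (simp add: inner_add_left inner_add_right inner_diff_left
      inner_diff_right inner_commute)

section \<open>The posterior of the vector autoregression\<close>

lemma borel_measurable_matrix_matrix_mult[measurable (raw)]:
  fixes A :: "'a \<Rightarrow> real^'m^'n" and B :: "'a \<Rightarrow> real^'k^'m"
  assumes "A \<in> borel_measurable M" "B \<in> borel_measurable M"
  shows "(\<lambda>s. A s ** B s) \<in> borel_measurable M"
  by (intro borel_measurable_vec)
    (auto simp: matrix_matrix_mult_def intro!: borel_measurable_sum borel_measurable_times
        borel_measurable_vec_nth assms)

declare borel_measurable_vec_nth[measurable (raw)]

lemma borel_measurable_transpose[measurable (raw)]:
  fixes A :: "'a \<Rightarrow> real^'m^'n"
  assumes "A \<in> borel_measurable M"
  shows "(\<lambda>s. transpose (A s)) \<in> borel_measurable M"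
  by (intro borel_measurable_vec) (auto simp: transpose_def intro!: borel_measurable_vec_nth assms)

lemma borel_measurable_col_unstack[measurable (raw)]:
  fixes f :: "'a \<Rightarrow> real^('c::finite \<times> 'k::finite)"
  assumes "f \<in> borel_measurable M"
  shows "(\<lambda>s. col_unstack (f s)) \<in> borel_measurable M"
  by (intro borel_measurable_vec) (auto simp: col_unstack_def intro!: borel_measurable_vec_nth assms)

lemma borel_measurable_prior_alpha[measurable]: "prior_alpha m C \<in> borel_measurable borel"
  unfolding prior_alpha_def by measurable

lemma ennreal_inverse_antimono: "x \<le> y \<Longrightarrow> inverse y \<le> inverse (x :: ennreal)"
proof (cases "x = 0 \<or> y = \<infinity>")
  case False
  assume "x \<le> y"
  moreover from this False obtain r s where "x = ennreal r" "y = ennreal s" "0 < r" "0 \<le> s"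
    by (cases x; cases y) (auto simp: top_unique less_le)
  ultimately show ?thesis by (auto simp: inverse_ennreal intro!: ennreal_leI le_imp_inverse_le)
qed auto

text \<open>
  Either set of conditions on the data and the prior yields the estimate \<open>coercive\<close> and the bound
  \<open>df\<close>. The matrix \<open>B0 \<alpha>\<close> is a centre for the integration over \<open>B\<close> and may depend on \<open>\<alpha>\<close>
  without restriction.
\<close>

locale var_posterior =
  fixes Y :: "('n::finite, 'r::{finite,linorder}) rmat"
    and Z :: "('n, 'q::finite \<times> 'r) rmat"
    and X :: "('n, 'p::finite) rmat"
    and m :: "('r \<times> 'q \<times> 'r) rvec"
    and C :: "('r \<times> 'q \<times> 'r, 'r \<times> 'q \<times> 'r) rmat"
    and D :: "('r, 'r) rmat"
    and a c :: real
    and B0 :: "('r \<times> 'q \<times> 'r) rvec \<Rightarrow> ('p, 'r) rmat"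
  assumes C: "sym_pos_def C" and c: "c > 0"
    and coercive: "\<And>\<alpha> B w. c * (w \<bullet> w + ((B - B0 \<alpha>) *v w) \<bullet> ((B - B0 \<alpha>) *v w)) \<le>
      ((Y - Z ** col_unstack \<alpha> - X ** B) *v w) \<bullet> ((Y - Z ** col_unstack \<alpha> - X ** B) *v w) + w \<bullet> (D *v w)"
    and df: "real CARD('n) + a - real CARD('p) > 2 * real CARD('r)"
begin

definition "resid \<alpha> B = Y - Z ** col_unstack \<alpha> - X ** B"

text \<open>
  Summed over the rows of a factor of \<open>\<Sigma>\<^sup>-\<^sup>1\<close>, this form is the exponent of the likelihood and of the prior
  of \<open>\<Sigma>\<close>.
\<close>

definition "rform \<alpha> B w = (resid \<alpha> B *v w) \<bullet> (resid \<alpha> B *v w) + w \<bullet> (D *v w)"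

abbreviation "g \<equiv> unnorm_posterior Y Z X m C D a"

definition "k0 = (2 * pi) powr (- (real CARD('n) * real CARD('r) / 2))"

lemma k0: "k0 > 0" by (simp add: k0_def)

lemma prior_alpha_pos: "prior_alpha m C \<alpha> > 0" by (simp add: prior_alpha_def)

lemma prior_alpha_le_1: "prior_alpha m C \<alpha> \<le> 1"
proof -
  have "(\<alpha> - m) \<bullet> (C *v (\<alpha> - m)) \<ge> 0"
    using C by (cases "\<alpha> - m = 0") (auto simp: sym_pos_def_def simp del: right_minus_eq intro: less_imp_le)
  then show ?thesis by (simp add: prior_alpha_def)
qed

lemma posterior_density_eq:
  fixes R :: "('r, 'r) rmat"
  assumes \<Sigma>: "sym_pos_def \<Sigma>" and R: "matrix_inv \<Sigma> = transpose R ** R"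
  shows "g \<alpha> B \<Sigma> = k0 * det \<Sigma> powr (- ((real CARD('n) + a) / 2)) * prior_alpha m C \<alpha> *
    exp (- (1/2) * (\<Sum>i\<in>UNIV. rform \<alpha> B (row i R)))"
proof -
  have 1: "trace (matrix_inv \<Sigma> ** (transpose (resid \<alpha> B) ** resid \<alpha> B))
      = (\<Sum>i\<in>UNIV. (resid \<alpha> B *v row i R) \<bullet> (resid \<alpha> B *v row i R))"
    unfolding R by (subst trace_mul_sym) (simp only: trace_mult_gram inner_gram)
  have 2: "trace (D ** matrix_inv \<Sigma>) = (\<Sum>i\<in>UNIV. row i R \<bullet> (D *v row i R))"
    unfolding R by (rule trace_mult_gram)
  have 3: "det \<Sigma> powr (- (real CARD('n) / 2)) * det \<Sigma> powr (- (a / 2))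
      = det \<Sigma> powr (- ((real CARD('n) + a) / 2))"
    by (simp add: powr_add[symmetric] add_divide_distrib)
  show ?thesis
    unfolding unnorm_posterior_def likelihood_def prior_Sigma_def resid_def[symmetric] rform_def 1 2
        sum.distrib 3[symmetric] k0_def
    by (simp add: exp_add[symmetric] ring_distribs)
qed

lemma g_pos: "\<Sigma> \<in> space lborel_spd \<Longrightarrow> g \<alpha> B \<Sigma> > 0"
  unfolding unnorm_posterior_def likelihood_def prior_Sigma_def
  using prior_alpha_pos[of \<alpha>] det_sym_pos_def[of \<Sigma>] by (simp add: space_lborel_spd)

lemma g_measurable: "(\<lambda>(\<alpha>, B, \<Sigma>). g \<alpha> B \<Sigma>) \<in> borel_measurable lborel_Theta"
proof -
  have [measurable]: "(\<lambda>z. snd (snd z)) \<in> borel_measurable (lborel_Theta :: (('r \<times> 'q \<times> 'r) rvec \<times>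
      ('p, 'r) rmat \<times> ('r, 'r) rmat) measure)"
    by (rule measurable_lborel_spd_borel) measurable
  show ?thesis
    unfolding unnorm_posterior_def likelihood_def prior_Sigma_def case_prod_beta by measurable
qed

text \<open>
  \<open>W\<close> bounds the density with \<open>B\<close> integrated out, up to the prior of \<open>\<alpha>\<close> and the constant \<open>k1\<close>. The
  integration over \<open>B\<close> contributes \<open>det \<Sigma>\<close> to the power \<open>p / 2\<close>, hence the exponent \<open>\<kappa>\<close>.
\<close>

definition "\<kappa> = (real CARD('n) + a - real CARD('p)) / 2"
definition W :: "('r, 'r) rmat \<Rightarrow> ennreal" where
  "W \<Sigma> = ennreal (det \<Sigma> powr (- \<kappa>) * exp (- (c / 2) * trace (matrix_inv \<Sigma>)))"
definition "k1 = k0 * (sqrt (2 * pi / c) ^ CARD('r)) ^ CARD('p)"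

lemma measurable_W[measurable]: "W \<in> borel_measurable lborel_spd"
  unfolding W_def by measurable

lemma W_integral_finite: "(\<integral>\<^sup>+\<Sigma>. W \<Sigma> \<partial>lborel_spd) < \<infinity>"
  unfolding W_def using df c by (intro inv_wishart_integral_finite) (simp_all add: \<kappa>_def)

lemma unnorm_alpha_Sigma_le:
  assumes "\<Sigma> \<in> space lborel_spd"
  shows "unnorm_alpha_Sigma g \<alpha> \<Sigma> \<le> ennreal (k1 * prior_alpha m C \<alpha>) * W \<Sigma>"
proof -
  have \<Sigma>: "sym_pos_def \<Sigma>" using assms by (simp add: space_lborel_spd)
  let ?V = "matrix_inv \<Sigma>"
  let ?q = "\<lambda>B :: ('p, 'r) rmat. \<Sum>j\<in>UNIV. B $ j \<bullet> (?V *v B $ j)"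
  have V: "sym_pos_def ?V" using \<Sigma> by (rule sym_pos_def_matrix_inv)
  obtain R :: "('r, 'r) rmat" where R: "?V = transpose R ** R" using sym_pos_def_factor[OF V] .
  have d: "det \<Sigma> > 0" using \<Sigma> by (rule det_sym_pos_def)
  have dV: "det ?V = 1 / det \<Sigma>"
    using matrix_inv_mult(1)[OF sym_pos_def_invertible[OF \<Sigma>]] d det_mul[of \<Sigma> ?V] by (simp add: field_simps)
  define A where "A = k0 * det \<Sigma> powr (- ((real CARD('n) + a) / 2)) * prior_alpha m C \<alpha> * exp
      (- (c / 2) * trace ?V)"
  have A: "A > 0" using k0 d prior_alpha_pos by (simp add: A_def)
  have tr: "trace ?V = (\<Sum>i\<in>UNIV. row i R \<bullet> row i R)"
    using trace_mult_gram[of "mat 1" R] by (simp add: R)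
  have le: "g \<alpha> B \<Sigma> \<le> A * exp (- (c / 2) * ?q (B - B0 \<alpha>))" for B
  proof -
    have "c * (trace ?V + ?q (B - B0 \<alpha>)) =
      (\<Sum>i\<in>UNIV. c * (row i R \<bullet> row i R + ((B - B0 \<alpha>) *v row i R) \<bullet> ((B - B0 \<alpha>) *v row i R)))"
      unfolding tr unfolding R sum_norm_rows_swap[symmetric]
          by (simp add: sum.distrib sum_distrib_left distrib_left)
    also have "\<dots> \<le> (\<Sum>i\<in>UNIV. rform \<alpha> B (row i R))"
      unfolding rform_def resid_def by (intro sum_mono coercive)
    finally have "exp (- (1/2) * (\<Sum>i\<in>UNIV. rform \<alpha> B (row i R))) \<le>
       exp (- (c / 2) * trace ?V) * exp (- (c / 2) * ?q (B - B0 \<alpha>))"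
      unfolding exp_add[symmetric] by (simp add: algebra_simps)
    then show ?thesis unfolding posterior_density_eq[OF \<Sigma> R] A_def using k0 d prior_alpha_pos[of \<alpha>]
      by (simp only: mult.assoc) (intro mult_left_mono, auto simp: less_imp_le)
  qed
  have "unnorm_alpha_Sigma g \<alpha> \<Sigma> \<le>
     (\<integral>\<^sup>+B. ennreal A * ennreal (exp (- (c / 2) * ?q (B - B0 \<alpha>))) \<partial>lborel)"
    unfolding unnorm_alpha_Sigma_def using le A
    by (intro nn_integral_mono) (auto simp: ennreal_mult[symmetric] less_imp_le intro!: ennreal_leI)
  also have "\<dots> = ennreal A * (\<integral>\<^sup>+B. ennreal (exp (- (c / 2) * ?q (B - B0 \<alpha>))) \<partial>lborel)"
    by (rule nn_integral_cmult) measurable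
  also have "(\<integral>\<^sup>+B. ennreal (exp (- (c / 2) * ?q (B - B0 \<alpha>))) \<partial>lborel) =
     (\<integral>\<^sup>+(B::('p, 'r) rmat). ennreal (exp (- (c / 2) * ?q B)) \<partial>lborel)"
  proof -
    have m: "(\<lambda>B::('p, 'r) rmat. ennreal (exp (- (c / 2) * ?q (B - B0 \<alpha>)))) \<in> borel_measurable borel"
      by measurable
    show ?thesis by (subst nn_integral_lborel_affine[OF m, of 1 "B0 \<alpha>"]) simp_all
  qed
  also have "\<dots> = ennreal ((sqrt (pi / (c / 2)) ^ CARD('r) / sqrt (det ?V)) ^ CARD('p))"
    using c by (intro gaussian_integral_matrix V) simp
  also have "(sqrt (pi / (c / 2)) ^ CARD('r) / sqrt (det ?V)) ^ CARD('p)
      = (sqrt (2 * pi / c) ^ CARD('r)) ^ CARD('p) * det \<Sigma> powr (real CARD('p) / 2)"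
  proof -
    have "sqrt (det \<Sigma>) ^ CARD('p) = det \<Sigma> powr (real CARD('p) / 2)"
      using d by (simp add: powr_half_sqrt[symmetric] powr_realpow[symmetric] powr_powr)
    moreover have "sqrt (pi / (c / 2)) ^ CARD('r) / sqrt (det ?V)
        = sqrt (2 * pi / c) ^ CARD('r) * sqrt (det \<Sigma>)"
      using d by (simp add: dV real_sqrt_divide mult.commute)
    ultimately show ?thesis by (simp only: power_mult_distrib)
  qed
  also have "ennreal A * ennreal ((sqrt (2 * pi / c) ^ CARD('r)) ^ CARD('p) * det \<Sigma> powr
      (real CARD('p) / 2)) = ennreal (k1 * prior_alpha m C \<alpha>) * W \<Sigma>"
  proof -
    have "det \<Sigma> powr (- \<kappa>) = det \<Sigma> powr (- ((real CARD('n) + a) / 2)) * det \<Sigma> powr (real CARD('p) / 2)"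
    proof -
      have "- \<kappa> = - ((real CARD('n) + a) / 2) + real CARD('p) / 2" by (simp add: \<kappa>_def field_simps)
      then show ?thesis by (simp only: powr_add)
    qed
    then have "A * ((sqrt (2 * pi / c) ^ CARD('r)) ^ CARD('p) * det \<Sigma> powr (real CARD('p) / 2)) =
       (k1 * prior_alpha m C \<alpha>) * (det \<Sigma> powr (- \<kappa>) * exp (- (c / 2) * trace ?V))"
      unfolding A_def k1_def by (simp only: mult_ac)
    moreover have "0 \<le> k1 * prior_alpha m C \<alpha>" using k0 c prior_alpha_pos[of \<alpha>] by (simp add: k1_def)
    ultimately show ?thesis using A unfolding W_def by (simp add: ennreal_mult'[symmetric])
  qed
  finally show ?thesis .
qed

lemma prior_alpha_integral_finite: "(\<integral>\<^sup>+\<alpha>. ennreal (prior_alpha m C \<alpha>) \<partial>lborel) < \<infinity>"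
proof -
  have "(\<integral>\<^sup>+\<alpha>. ennreal (prior_alpha m C \<alpha>) \<partial>lborel)
      = (\<integral>\<^sup>+\<alpha>. ennreal (exp (- (1/2) * (\<alpha> \<bullet> (C *v \<alpha>)))) \<partial>lborel)"
    unfolding prior_alpha_def by (subst nn_integral_lborel_affine[of _ 1 m]) auto
  then show ?thesis using gaussian_integral_vec[OF _ C, of "1/2"] by simp
qed

lemma k1: "k1 \<ge> 0" using k0 c by (simp add: k1_def)

lemma Sigma_integral_le: "(\<integral>\<^sup>+ \<Sigma>. unnorm_alpha_Sigma g \<alpha> \<Sigma> \<partial>lborel_spd)
    \<le> ennreal (k1 * prior_alpha m C \<alpha>) * (\<integral>\<^sup>+\<Sigma>. W \<Sigma> \<partial>lborel_spd)"
proof -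
  have "(\<integral>\<^sup>+ \<Sigma>. unnorm_alpha_Sigma g \<alpha> \<Sigma> \<partial>lborel_spd)
      \<le> (\<integral>\<^sup>+ \<Sigma>. ennreal (k1 * prior_alpha m C \<alpha>) * W \<Sigma> \<partial>lborel_spd)"
    by (intro nn_integral_mono unnorm_alpha_Sigma_le)
  also have "\<dots> = ennreal (k1 * prior_alpha m C \<alpha>) * (\<integral>\<^sup>+\<Sigma>. W \<Sigma> \<partial>lborel_spd)"
    by (rule nn_integral_cmult) measurable
  finally show ?thesis .
qed

sublocale collapsed_gibbs g
proof
  have k: "(\<integral>\<^sup>+\<alpha>. ennreal (k1 * prior_alpha m C \<alpha>) \<partial>lborel) < \<infinity>"
    using prior_alpha_integral_finite k1 by (simp add: ennreal_mult' nn_integral_cmult ennreal_mult_less_top)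
  show "(\<lambda>(\<alpha>, B, \<Sigma>). g \<alpha> B \<Sigma>) \<in> borel_measurable lborel_Theta" by (rule g_measurable)
  show "\<And>\<alpha> B \<Sigma>. \<Sigma> \<in> space lborel_spd \<Longrightarrow> g \<alpha> B \<Sigma> > 0" by (rule g_pos)
  have W: "W \<Sigma> < \<infinity>" for \<Sigma> :: "('r, 'r) rmat" by (simp add: W_def)
  show "unnorm_alpha_Sigma g \<alpha> \<Sigma> < \<infinity>" if "\<Sigma> \<in> space lborel_spd" for \<alpha> \<Sigma>
    using W by (intro le_less_trans[OF unnorm_alpha_Sigma_le[OF that]]) (simp add: ennreal_mult_less_top)
  show "(\<integral>\<^sup>+ \<Sigma>. unnorm_alpha_Sigma g \<alpha> \<Sigma> \<partial>lborel_spd) < \<infinity>" for \<alpha>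
    using W_integral_finite by (intro le_less_trans[OF Sigma_integral_le]) (simp add: ennreal_mult_less_top)
  show "(\<integral>\<^sup>+ \<alpha>. unnorm_alpha_Sigma g \<alpha> \<Sigma> \<partial>lborel) < \<infinity>" if \<Sigma>: "\<Sigma> \<in> space lborel_spd" for \<Sigma>
  proof -
    have "(\<integral>\<^sup>+ \<alpha>. unnorm_alpha_Sigma g \<alpha> \<Sigma> \<partial>lborel) \<le> (\<integral>\<^sup>+ \<alpha>. ennreal (k1 * prior_alpha m C \<alpha>) * W \<Sigma> \<partial>lborel)"
      by (intro nn_integral_mono unnorm_alpha_Sigma_le \<Sigma>)
    also have "\<dots> < \<infinity>" using W k by (simp add: nn_integral_multc ennreal_mult_less_top)
    finally show ?thesis .
  qed
  have "(\<integral>\<^sup>+ \<alpha>. \<integral>\<^sup>+ \<Sigma>. unnorm_alpha_Sigma g \<alpha> \<Sigma> \<partial>lborel_spd \<partial>lborel)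
      \<le> (\<integral>\<^sup>+ \<alpha>. ennreal (k1 * prior_alpha m C \<alpha>) * (\<integral>\<^sup>+\<Sigma>. W \<Sigma> \<partial>lborel_spd) \<partial>lborel)"
    by (intro nn_integral_mono Sigma_integral_le)
  also have "\<dots> < \<infinity>" using W_integral_finite k by (simp add: nn_integral_multc ennreal_mult_less_top)
  finally show "(\<integral>\<^sup>+ \<alpha>. \<integral>\<^sup>+ \<Sigma>. unnorm_alpha_Sigma g \<alpha> \<Sigma> \<partial>lborel_spd \<partial>lborel) < \<infinity>" .
qed

text \<open>
  Orthogonality of the least squares residuals splits the exponent into a term depending on \<open>\<Sigma>\<close> alone, the
  prior of \<open>\<alpha>\<close> and a quadratic form in \<open>(\<alpha> - \<alpha>0, B - B1)\<close>.
\<close>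

lemma alpha_given_Sigma_tight:
  obtains \<alpha>0 \<rho> where "\<rho> \<ge> 0"
    "\<And>\<Sigma>. \<Sigma> \<in> space lborel_spd \<Longrightarrow> marg_Sigma \<Sigma> \<le> 2 * (\<integral>\<^sup>+\<alpha>. u \<alpha> \<Sigma> * indicator (cball \<alpha>0 \<rho>) \<alpha> \<partial>lborel)"
proof -
  obtain BB :: "('q \<times> 'r + 'p, 'r) rmat" where BB: "\<And>z w. (hcat Z X *v z) \<bullet> ((Y - hcat Z X ** BB) *v w) = 0"
    using least_squares[of "hcat Z X" Y] by metis
  define A1 where "A1 = (\<chi> i. BB $ Inl i)"
  define B1 where "B1 = (\<chi> i. BB $ Inr i)"
  define \<alpha>0 where "\<alpha>0 = col_stack A1"
  have E0: "resid \<alpha>0 B1 = Y - hcat Z X ** BB" by (simp add: resid_def \<alpha>0_def hcat_mult_mat A1_def B1_def)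
  have orth: "(Z *v x + X *v z) \<bullet> (resid \<alpha>0 B1 *v w) = 0" for x z w
    using BB[of "\<chi> i. case i of Inl i \<Rightarrow> x $ i | Inr j \<Rightarrow> z $ j" w] by (simp add: hcat_mult_vec E0)
  define h where "h y b w = Z *v (col_unstack y *v w) + X *v (b *v w)" for y and b :: "('p, 'r) rmat" and w
  have Eh: "resid (\<alpha>0 + y) (B1 + b) *v w = resid \<alpha>0 B1 *v w - h y b w" for y b w
  proof -
    have "col_unstack (\<alpha>0 + y) = col_unstack \<alpha>0 + col_unstack y" by (simp add: col_unstack_def vec_eq_iff)
    then show ?thesis unfolding resid_def h_def
      by (simp add: matrix_add_ldistrib matrix_vector_mult_diff_rdistrib matrix_vector_mult_add_rdistrib
          matrix_vector_mul_assoc)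
  qed
  have Eq: "(resid (\<alpha>0 + y) (B1 + b) *v w) \<bullet> (resid (\<alpha>0 + y) (B1 + b) *v w)
      = (resid \<alpha>0 B1 *v w) \<bullet> (resid \<alpha>0 B1 *v w) + h y b w \<bullet> h y b w" for y b w
    unfolding Eh using orth[of "col_unstack y *v w" "b *v w" w] unfolding h_def[symmetric]
    by (simp add: inner_diff_left inner_diff_right inner_commute)
  have hs: "h (s *\<^sub>R y) (s *\<^sub>R b) w = s *\<^sub>R h y b w" for s y b w
  proof -
    have "col_unstack (s *\<^sub>R y) = s *\<^sub>R col_unstack y" by (simp add: col_unstack_def vec_eq_iff)
    then show ?thesis unfolding h_def by (simp add: scaleR_matrix_vector_assoc[symmetric]
        matrix_vector_mult_scaleR scaleR_add_right)
  qed
  define d where "d = m - \<alpha>0"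
  obtain \<rho> where \<rho>: "\<rho> \<ge> 0" and "\<forall>q :: ('r \<times> 'q \<times> 'r) rvec \<Rightarrow> ('p, 'r) rmat \<Rightarrow> real.
      (\<lambda>z. q (fst z) (snd z)) \<in> borel_measurable borel \<longrightarrow> (\<forall>y b. 0 \<le> q y b) \<longrightarrow>
      (\<forall>s y b. q (s *\<^sub>R y) (s *\<^sub>R b) = s\<^sup>2 * q y b) \<longrightarrow>
      2 * gauss_mass C d q (- cball 0 \<rho>) \<le> gauss_mass C d q UNIV"
    using gaussian_mass_outside_ball[OF C, of d, where 'b = "('p, 'r) rmat"] .
  note out = this(2)[rule_format]
  show ?thesis
  proof (rule that[OF \<rho>])
    fix \<Sigma> :: "('r, 'r) rmat" assume \<Sigma>: "\<Sigma> \<in> space lborel_spd"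
    then have spd: "sym_pos_def \<Sigma>" by (simp add: space_lborel_spd)
    obtain T :: "('r, 'r) rmat" where T: "matrix_inv \<Sigma> = transpose T ** T"
        using sym_pos_def_factor[OF sym_pos_def_matrix_inv[OF spd]] .
    define q where "q y b = (\<Sum>i\<in>UNIV. h y b (row i T) \<bullet> h y b (row i T))" for y b
    define k where "k = k0 * det \<Sigma> powr (- ((real CARD('n) + a) / 2)) *
       exp (- (1/2) * (\<Sum>i\<in>UNIV. rform \<alpha>0 B1 (row i T)))"
    have k: "k > 0" using k0 det_sym_pos_def[OF spd] by (simp add: k_def)
    have qm: "(\<lambda>z. q (fst z) (snd z)) \<in> borel_measurable borel"
      unfolding q_def h_def borel_prod[symmetric] by measurable
    note [measurable (raw)] = borel_measurable_apply2[OF qm]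
    have q0: "0 \<le> q y b" for y b unfolding q_def by (intro sum_nonneg) simp
    have q2: "q (s *\<^sub>R y) (s *\<^sub>R b) = s\<^sup>2 * q y b" for s y b
      unfolding q_def hs by (simp add: sum_distrib_left power2_eq_square mult.assoc)
    let ?G = "\<lambda>y b. ennreal (exp (- (1/2) * ((y - d) \<bullet> (C *v (y - d))) - (1/2) * q y b))"
    have g: "ennreal (g (\<alpha>0 + y) (B1 + b) \<Sigma>) = ennreal k * ?G y b" for y b
    proof -
      have "g (\<alpha>0 + y) (B1 + b) \<Sigma> = k * exp (- (1/2) * ((y - d) \<bullet> (C *v (y - d))) - (1/2) * q y b)"
      proof -
        have "\<alpha>0 + y - m = y - d" by (simp add: d_def)
        then have p: "prior_alpha m C (\<alpha>0 + y) = exp (- (1/2) * ((y - d) \<bullet> (C *v (y - d))))"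
          unfolding prior_alpha_def by (simp only:)
        have s: "(\<Sum>i\<in>UNIV. rform (\<alpha>0 + y) (B1 + b) (row i T)) =
          (\<Sum>i\<in>UNIV. rform \<alpha>0 B1 (row i T)) + q y b"
          unfolding q_def rform_def Eq by (simp add: sum.distrib)
        have e: "exp (- (1/2) * (x + z)) = exp (- (1/2) * x) * exp (- (1/2) * z)" for x z :: real
          by (simp only: distrib_left exp_add)
        have e2: "exp (x - (1/2) * z) = exp x * exp (- (1/2) * z)" for x z :: real
          using exp_add[of x "- (1/2) * z"] by simp
        show ?thesis unfolding posterior_density_eq[OF spd T] s p k_def e e2 by (simp only: mult_ac)
      qed
      then show ?thesis using k by (simp add: ennreal_mult less_imp_le)
    qed
    have u_eq: "u (\<alpha>0 + y) \<Sigma> = ennreal k * (\<integral>\<^sup>+b. ?G y b \<partial>lborel)" for y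
    proof -
      have "u (\<alpha>0 + y) \<Sigma> = (\<integral>\<^sup>+b. ennreal (g (\<alpha>0 + y) (B1 + b) \<Sigma>) \<partial>lborel)"
        unfolding unnorm_alpha_Sigma_def using \<Sigma> by (subst nn_integral_lborel_affine[of _ 1 B1]) auto
      also have "\<dots> = ennreal k * (\<integral>\<^sup>+b. ?G y b \<partial>lborel)" unfolding g by (rule nn_integral_cmult) measurable
      finally show ?thesis .
    qed
    have shift: "(\<integral>\<^sup>+\<alpha>. u \<alpha> \<Sigma> * indicator S (\<alpha> - \<alpha>0) \<partial>lborel) = ennreal k * gauss_mass C d q S"
      if [measurable]: "S \<in> sets borel" for S
    proof -
      have "(\<integral>\<^sup>+\<alpha>. u \<alpha> \<Sigma> * indicator S (\<alpha> - \<alpha>0) \<partial>lborel) = (\<integral>\<^sup>+y. u (\<alpha>0 + y) \<Sigma> * indicator S y \<partial>lborel)"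
        using \<Sigma> by (subst nn_integral_lborel_affine[of _ 1 \<alpha>0]) auto
      also have "\<dots> = (\<integral>\<^sup>+y. ennreal k * (indicator S y * (\<integral>\<^sup>+b. ?G y b \<partial>lborel)) \<partial>lborel)"
        unfolding u_eq by (simp only: mult_ac)
      also have "\<dots> = ennreal k * gauss_mass C d q S"
        unfolding gauss_mass_def by (rule nn_integral_cmult) measurable
      finally show ?thesis .
    qed
    have tot: "marg_Sigma \<Sigma> = ennreal k * gauss_mass C d q UNIV"
      using shift[of UNIV] by (simp add: marg_Sigma_def)
    have ball: "indicator (cball 0 \<rho>) (\<alpha> - \<alpha>0) = (indicator (cball \<alpha>0 \<rho>) \<alpha> :: ennreal)" for \<alpha>
      by (simp add: indicator_def dist_norm norm_minus_commute)
    have split: "marg_Sigma \<Sigma> = (\<integral>\<^sup>+\<alpha>. u \<alpha> \<Sigma> * indicator (cball \<alpha>0 \<rho>) \<alpha> \<partial>lborel) + (\<integral>\<^sup>+\<alpha>. u \<alpha> \<Sigma> *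
        indicator (- cball 0 \<rho>) (\<alpha> - \<alpha>0) \<partial>lborel)"
      unfolding marg_Sigma_def ball[symmetric] using \<Sigma>
      by (subst nn_integral_add[symmetric]) (auto intro!: nn_integral_cong simp: indicator_def)
    have "2 * (\<integral>\<^sup>+\<alpha>. u \<alpha> \<Sigma> * indicator (- cball 0 \<rho>) (\<alpha> - \<alpha>0) \<partial>lborel)
        = ennreal k * (2 * gauss_mass C d q (- cball 0 \<rho>))"
      by (subst shift) (auto simp: mult.left_commute)
    also have "\<dots> \<le> marg_Sigma \<Sigma>" unfolding tot by (intro mult_left_mono out qm q0 q2) simp
    finally have o: "2 * (\<integral>\<^sup>+\<alpha>. u \<alpha> \<Sigma> * indicator (- cball 0 \<rho>) (\<alpha> - \<alpha>0) \<partial>lborel) \<le> marg_Sigma \<Sigma>" .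
    have "a \<le> 2 * x" if "a = x + y" "2 * y \<le> a" "a \<noteq> \<infinity>" for a x y :: ennreal
    proof -
      have "2 * y \<le> x + y" using that by simp
      then have "y + y \<le> x + y" by (simp add: mult_2)
      then have "y \<le> x" using that(1,3) by (simp add: ennreal_add_left_cancel_le add.commute[of x y])
      then show ?thesis unfolding that(1) mult_2 by (rule add_left_mono)
    qed
    from this[OF split o marginals_finite(3)[OF \<Sigma>]] show "marg_Sigma \<Sigma>
        \<le> 2 * (\<integral>\<^sup>+\<alpha>. u \<alpha> \<Sigma> * indicator (cball \<alpha>0 \<rho>) \<alpha> \<partial>lborel)" .
  qed
qed

text \<open>
  On \<open>S\<close> the prior of \<open>\<alpha>\<close> is bounded away from zero and \<open>Y - Z A\<close> is bounded, so \<open>b1 * \<eta>0\<close> is a lower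
  bound of the numerators \<open>u \<alpha> \<Sigma>\<close> that is free of \<open>\<alpha>\<close>. The normalizing constants are at most \<open>N1\<close>.
\<close>

lemma Sigma_given_alpha_minorization:
  fixes S :: "('r \<times> 'q \<times> 'r) rvec set"
  assumes S: "compact S" "S \<noteq> {}"
  obtains \<eta> \<epsilon> where "\<eta> \<in> borel_measurable lborel_spd" "(\<integral>\<^sup>+\<Sigma>. \<eta> \<Sigma> \<partial>lborel_spd) = 1" "\<epsilon> > 0"
    "\<And>\<alpha> \<Sigma>. \<alpha> \<in> S \<Longrightarrow> \<Sigma> \<in> space lborel_spd \<Longrightarrow> ennreal \<epsilon> * \<eta> \<Sigma> \<le> fS \<alpha> \<Sigma>"
proof -
  obtain b1 where b1: "b1 > 0" "\<And>\<alpha>. \<alpha> \<in> S \<Longrightarrow> b1 \<le> prior_alpha m C \<alpha>"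
  proof -
    have "continuous_on S (prior_alpha m C)" unfolding prior_alpha_def matrix_vector_mult_def
      by (intro continuous_intros)
    then obtain z where "z \<in> S" "\<And>\<alpha>. \<alpha> \<in> S \<Longrightarrow> prior_alpha m C z \<le> prior_alpha m C \<alpha>"
      using continuous_attains_inf[OF S, of "prior_alpha m C"] by blast
    then show ?thesis using that prior_alpha_pos by blast
  qed
  let ?M = "\<lambda>\<alpha>. Y - Z ** col_unstack \<alpha>"
  obtain b2 where b2: "\<And>\<alpha>. \<alpha> \<in> S \<Longrightarrow> ?M \<alpha> \<bullet> ?M \<alpha> \<le> b2"
  proof -
    have "continuous_on S (\<lambda>\<alpha>. ?M \<alpha> \<bullet> ?M \<alpha>)"
      unfolding matrix_matrix_mult_def col_unstack_def vec_lambda_beta by (intro continuous_intros)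
    then obtain z where "\<And>\<alpha>. \<alpha> \<in> S \<Longrightarrow> ?M \<alpha> \<bullet> ?M \<alpha> \<le> ?M z \<bullet> ?M z"
      using continuous_attains_sup[OF S, of "\<lambda>\<alpha>. ?M \<alpha> \<bullet> ?M \<alpha>"] by blast
    then show ?thesis using that by blast
  qed
  define s where "s = 2 * b2 + norm (D \<bullet> D) + 1"
  have Dle: "w \<bullet> (D *v w) \<le> (D \<bullet> D + 1) * (w \<bullet> w)" for w
  proof -
    have "2 * (w \<bullet> (D *v w)) \<le> w \<bullet> w + (D *v w) \<bullet> (D *v w)"
      using inner_ge_zero[of "w - D *v w"] by (simp add: inner_diff_left inner_diff_right inner_commute)
    also have "\<dots> \<le> w \<bullet> w + (D \<bullet> D) * (w \<bullet> w)" using mult_vec_norm_le[of D w] by simp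
    finally have "2 * (w \<bullet> (D *v w)) \<le> w \<bullet> w + (D \<bullet> D) * (w \<bullet> w)" .
    moreover have "0 \<le> (D \<bullet> D) * (w \<bullet> w)" by simp
    ultimately show ?thesis unfolding distrib_right mult_1 using inner_ge_zero[of w] by linarith
  qed
  let ?F = "\<lambda>\<Sigma> B. k0 * det \<Sigma> powr (- ((real CARD('n) + a) / 2)) *
     exp (- (1/2) * (s * trace (matrix_inv \<Sigma>) + 2 * trace
         (matrix_inv \<Sigma> ** (transpose (X ** B) ** (X ** B)))))"
  define \<eta>0 where "\<eta>0 \<Sigma> = (\<integral>\<^sup>+(B::('p, 'r) rmat). ennreal (?F \<Sigma> B) \<partial>lborel)" for \<Sigma>
  have \<eta>m[measurable]: "\<eta>0 \<in> borel_measurable lborel_spd"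
  proof -
    have [measurable]: "(\<lambda>z::('r,'r) rmat \<times> ('p,'r) rmat. fst z) \<in> borel_measurable (lborel_spd \<Otimes>\<^sub>M lborel)"
      by (rule measurable_lborel_spd_borel) measurable
    show ?thesis unfolding \<eta>0_def[abs_def]
      by (intro lborel.borel_measurable_nn_integral) (unfold case_prod_beta, measurable)
  qed
  have low: "ennreal b1 * \<eta>0 \<Sigma> \<le> u \<alpha> \<Sigma>" if \<alpha>: "\<alpha> \<in> S" and \<Sigma>: "\<Sigma> \<in> space lborel_spd" for \<alpha> \<Sigma>
  proof -
    have spd: "sym_pos_def \<Sigma>" using \<Sigma> by (simp add: space_lborel_spd)
    have d: "det \<Sigma> > 0" using spd by (rule det_sym_pos_def)
    obtain T :: "('r, 'r) rmat" where T: "matrix_inv \<Sigma> = transpose T ** T"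
        using sym_pos_def_factor[OF sym_pos_def_matrix_inv[OF spd]] .
    have tr: "trace (matrix_inv \<Sigma>) = (\<Sum>i\<in>UNIV. row i T \<bullet> row i T)"
      using trace_mult_gram[of "mat 1" T] by (simp add: T)
    have trB: "trace (matrix_inv \<Sigma> ** (transpose (X ** B) ** (X ** B)))
        = (\<Sum>i\<in>UNIV. ((X ** B) *v row i T) \<bullet> ((X ** B) *v row i T))" for B :: "('p, 'r) rmat"
      unfolding T by (subst trace_mul_sym) (simp only: trace_mult_gram inner_gram)
    have w: "rform \<alpha> B w \<le> s * (w \<bullet> w) + 2 * (((X ** B) *v w) \<bullet> ((X ** B) *v w))" for B w
    proof -
      have "(resid \<alpha> B *v w) \<bullet> (resid \<alpha> B *v w) \<le> 2 * ((?M \<alpha> *v w) \<bullet> (?M \<alpha> *v w)) + 2 *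
          (((X ** B) *v w) \<bullet> ((X ** B) *v w))"
        unfolding resid_def matrix_vector_mult_diff_rdistrib[of "?M \<alpha>"] by (rule inner_diff_le_twice_sum)
      moreover have "(?M \<alpha> *v w) \<bullet> (?M \<alpha> *v w) \<le> b2 * (w \<bullet> w)"
        using mult_vec_norm_le[of "?M \<alpha>" w] mult_right_mono[OF b2[OF \<alpha>], of "w \<bullet> w"] by simp
      ultimately show ?thesis using Dle[of w] by (simp add: s_def rform_def algebra_simps)
    qed
    have "ennreal b1 * \<eta>0 \<Sigma> = (\<integral>\<^sup>+(B::('p, 'r) rmat). ennreal b1 * ennreal (?F \<Sigma> B) \<partial>lborel)"
      unfolding \<eta>0_def by (intro nn_integral_cmult[symmetric]) measurable
    also have "\<dots> \<le> u \<alpha> \<Sigma>" unfolding unnorm_alpha_Sigma_def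
    proof (intro nn_integral_mono)
      fix B :: "('p, 'r) rmat"
      let ?k = "k0 * det \<Sigma> powr (- ((real CARD('n) + a) / 2))"
      have "(\<Sum>i\<in>UNIV. rform \<alpha> B (row i T)) \<le>
         s * trace (matrix_inv \<Sigma>) + 2 * trace (matrix_inv \<Sigma> ** (transpose (X ** B) ** (X ** B)))"
        unfolding tr trB sum_distrib_left sum.distrib[symmetric] by (intro sum_mono w)
      then have "b1 * (?F \<Sigma> B) \<le>
         prior_alpha m C \<alpha> * (?k * exp (- (1/2) * (\<Sum>i\<in>UNIV. rform \<alpha> B (row i T))))"
        using b1 \<alpha> k0 prior_alpha_pos[of \<alpha>] by (intro mult_mono) (auto simp: less_imp_le)
      also have "\<dots> = g \<alpha> B \<Sigma>" unfolding posterior_density_eq[OF spd T] by (simp only: mult_ac)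
      finally show "ennreal b1 * ennreal (?F \<Sigma> B) \<le> ennreal (g \<alpha> B \<Sigma>)"
        using b1 k0 by (simp add: ennreal_mult[symmetric] ennreal_leI)
    qed
    finally show ?thesis .
  qed
  define I where "I = (\<integral>\<^sup>+\<Sigma>. \<eta>0 \<Sigma> \<partial>lborel_spd)"
  have \<eta>pos: "\<eta>0 \<Sigma> > 0" if "\<Sigma> \<in> space lborel_spd" for \<Sigma>
    unfolding \<eta>0_def using k0 det_sym_pos_def[of \<Sigma>] that
    by (intro nn_integral_lborel_pos) (auto simp: space_lborel_spd)
  have Ipos: "I > 0"
    unfolding I_def using \<eta>pos by (intro nn_integral_lborel_spd_pos) auto
  obtain \<alpha>1 where \<alpha>1: "\<alpha>1 \<in> S" using S by auto
  have "ennreal b1 * I = (\<integral>\<^sup>+\<Sigma>. ennreal b1 * \<eta>0 \<Sigma> \<partial>lborel_spd)" unfolding I_def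
      by (rule nn_integral_cmult[symmetric]) measurable
  also have "\<dots> \<le> marg_alpha \<alpha>1" unfolding marg_alpha_def by (intro nn_integral_mono low \<alpha>1)
  also have "\<dots> < \<infinity>" using marginals_finite(1)[of \<alpha>1] by (simp add: less_top)
  finally have Ifin: "I < \<infinity>" using b1 by (auto simp: ennreal_mult_less_top)
  define N1 where "N1 = ennreal k1 * (\<integral>\<^sup>+\<Sigma>. W \<Sigma> \<partial>lborel_spd)"
  have N1: "marg_alpha \<alpha> \<le> N1" for \<alpha>
  proof -
    have "marg_alpha \<alpha> \<le> ennreal (k1 * prior_alpha m C \<alpha>) * (\<integral>\<^sup>+\<Sigma>. W \<Sigma> \<partial>lborel_spd)"
        unfolding marg_alpha_def by (rule Sigma_integral_le)
    also have "\<dots> \<le> N1" unfolding N1_def using prior_alpha_le_1[of \<alpha>] k1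
      by (intro mult_right_mono ennreal_leI) (auto simp: mult_left_le)
    finally show ?thesis .
  qed
  have N1fin: "N1 < \<infinity>" using W_integral_finite by (simp add: N1_def ennreal_mult_less_top)
  have N1pos: "N1 > 0" using N1[of \<alpha>1] marg_alpha_pos[of \<alpha>1] by simp
  define \<epsilon> where "\<epsilon> = enn2real (ennreal b1 * I / N1)"
  have \<epsilon>fin: "ennreal b1 * I / N1 < \<infinity>" using Ifin N1pos
      by (auto simp: ennreal_divide_eq_top_iff ennreal_mult_eq_top_iff less_top[symmetric])
  have \<epsilon>pos: "ennreal b1 * I / N1 > 0" using Ipos N1fin b1
      by (simp add: zero_less_iff_neq_zero ennreal_divide_eq_0_iff)
  show ?thesis
  proof (rule that[of "\<lambda>\<Sigma>. \<eta>0 \<Sigma> / I" \<epsilon>])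
    show "(\<lambda>\<Sigma>. \<eta>0 \<Sigma> / I) \<in> borel_measurable lborel_spd" by measurable
    show "(\<integral>\<^sup>+\<Sigma>. \<eta>0 \<Sigma> / I \<partial>lborel_spd) = 1"
      using Ipos Ifin by (subst nn_integral_divide) (auto simp: I_def[symmetric] ennreal_divide_self_pos)
    show "\<epsilon> > 0" using \<epsilon>pos \<epsilon>fin by (simp add: \<epsilon>_def enn2real_positive_iff)
    fix \<alpha> \<Sigma> assume \<alpha>: "\<alpha> \<in> S" and \<Sigma>: "\<Sigma> \<in> space (lborel_spd :: ('r, 'r) rmat measure)"
    have "ennreal \<epsilon> * (\<eta>0 \<Sigma> / I) = (ennreal b1 * I / N1) * (\<eta>0 \<Sigma> / I)" using \<epsilon>fin by (simp add: \<epsilon>_def)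
    also have "\<dots> = ennreal b1 * (I * (\<eta>0 \<Sigma> / I)) / N1" by (simp add: divide_ennreal_def mult_ac)
    also have "\<dots> = ennreal b1 * \<eta>0 \<Sigma> / N1" using Ipos Ifin by (subst ennreal_mult_divide_cancel) auto
    also have "\<dots> \<le> u \<alpha> \<Sigma> / marg_alpha \<alpha>"
    proof -
      have "inverse N1 \<le> inverse (marg_alpha \<alpha>)"
        using N1 by (rule ennreal_inverse_antimono)
      then show ?thesis unfolding divide_ennreal_def by (intro mult_mono low \<alpha> \<Sigma>) auto
    qed
    finally show "ennreal \<epsilon> * (\<eta>0 \<Sigma> / I) \<le> fS \<alpha> \<Sigma>" by (simp add: fS_eq)
  qed
qed

lemma kernels_geometrically_ergodic:
  "geometrically_ergodic lborel_Theta (K_C g) (posterior g)"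
  "geometrically_ergodic lborel_alpha_Sigma (K_G g) (posterior_alpha_Sigma g)"
  "geometrically_ergodic lborel (K_A g) (posterior_alpha g)"
proof -
  obtain \<alpha>0 \<rho> where \<rho>: "\<rho> \<ge> 0" and tight:
    "\<And>\<Sigma>. \<Sigma> \<in> space lborel_spd \<Longrightarrow> marg_Sigma \<Sigma> \<le> 2 * (\<integral>\<^sup>+\<alpha>. u \<alpha> \<Sigma> * indicator (cball \<alpha>0 \<rho>) \<alpha> \<partial>lborel)"
    using alpha_given_Sigma_tight by blast
  have ne: "cball \<alpha>0 \<rho> \<noteq> {}" using \<rho> by simp
  obtain \<eta> \<epsilon> where \<eta>: "\<eta> \<in> borel_measurable lborel_spd" "(\<integral>\<^sup>+\<Sigma>. \<eta> \<Sigma> \<partial>lborel_spd) = 1" "\<epsilon> > 0"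
    "\<And>\<alpha> \<Sigma>. \<alpha> \<in> cball \<alpha>0 \<rho> \<Longrightarrow> \<Sigma> \<in> space lborel_spd \<Longrightarrow> ennreal \<epsilon> * \<eta> \<Sigma> \<le> fS \<alpha> \<Sigma>"
    using Sigma_given_alpha_minorization[OF compact_cball ne] by blast
  show "geometrically_ergodic lborel_Theta (K_C g) (posterior g)"
    by (rule geometrically_ergodic_K_C[OF _ \<eta>(1,2,3) \<eta>(4) tight]) auto
  then show "geometrically_ergodic lborel_alpha_Sigma (K_G g) (posterior_alpha_Sigma g)"
    "geometrically_ergodic lborel (K_A g) (posterior_alpha g)"
    by (rule geometrically_ergodic_K_G, intro geometrically_ergodic_K_A geometrically_ergodic_K_G)
qed

end

section \<open>Coercivity of the residual form\<close>

text \<open>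
  At the least squares fit \<open>B0 \<alpha>\<close> of \<open>F \<alpha>\<close> on \<open>X\<close> the residuals are orthogonal to the columns of \<open>X\<close>, so the
  residual form is at least \<open>\<bar>X (B - B0 \<alpha>) w\<bar>\<^sup>2\<close>.
\<close>

lemma coercive_full_rank_regressors:
  fixes Y :: "('n::finite, 'r::finite) rmat" and X :: "('n, 'p::finite) rmat" and D :: "('r, 'r) rmat"
    and F :: "'a \<Rightarrow> ('n, 'r) rmat"
  assumes "sym_pos_def D" "full_column_rank X"
  obtains c B0 where "c > 0" "\<And>\<alpha> B w. c * (w \<bullet> w + ((B - B0 \<alpha>) *v w) \<bullet> ((B - B0 \<alpha>) *v w)) \<le>
      ((F \<alpha> - X ** B) *v w) \<bullet> ((F \<alpha> - X ** B) *v w) + w \<bullet> (D *v w)"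
proof -
  obtain d where d: "d > 0" "\<And>w. d * (w \<bullet> w) \<le> w \<bullet> (D *v w)" using sym_pos_def_lower_bound[OF assms(1)]
      by blast
  obtain x where x: "x > 0" "\<And>z. x * (z \<bullet> z) \<le> (X *v z) \<bullet> (X *v z)"
      using full_column_rank_lower_bound[OF assms(2)] by blast
  have "\<exists>B::('p, 'r) rmat. \<forall>z w. (X *v z) \<bullet> ((F \<alpha> - X ** B) *v w) = 0" for \<alpha>
    using least_squares[of X "F \<alpha>"] by metis
  then obtain B0 :: "'a \<Rightarrow> ('p, 'r) rmat" where B0: "\<And>\<alpha> z w. (X *v z) \<bullet> ((F \<alpha> - X ** B0 \<alpha>) *v w) = 0" by metis
  show ?thesis
  proof (rule that[of "min d x" B0])
    fix \<alpha> and B :: "('p, 'r) rmat" and w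
    let ?b = "(B - B0 \<alpha>) *v w" and ?r = "(F \<alpha> - X ** B0 \<alpha>) *v w"
    have e: "(F \<alpha> - X ** B) *v w = ?r - X *v ?b"
      by (simp add: matrix_vector_mult_diff_rdistrib matrix_vector_mult_diff_distrib matrix_vector_mul_assoc)
    have "((F \<alpha> - X ** B) *v w) \<bullet> ((F \<alpha> - X ** B) *v w) = ?r \<bullet> ?r + (X *v ?b) \<bullet> (X *v ?b)"
      unfolding e using B0[of ?b \<alpha> w] by (simp add: inner_diff_left inner_diff_right inner_commute)
    moreover have "min d x * (?b \<bullet> ?b) \<le> x * (?b \<bullet> ?b)" "min d x * (w \<bullet> w) \<le> d * (w \<bullet> w)"
      by (intro mult_right_mono; simp)+
    ultimately show "min d x * (w \<bullet> w + ?b \<bullet> ?b) \<le> ((F \<alpha> - X ** B) *v w) \<bullet> ((F \<alpha> - X ** B) *v w) +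
        w \<bullet> (D *v w)"
      unfolding distrib_left using x(2)[of ?b] d(2)[of w] inner_ge_zero[of ?r] by linarith
  qed (use d x in auto)
qed

text \<open>
  \<open>(Y - Z A - X B) w\<close> is the value of \<open>[Y, Z, X]\<close> at the stacked vector of \<open>w\<close>, \<open>- A w\<close> and \<open>- B w\<close>.
\<close>

lemma coercive_full_rank_data:
  fixes Y :: "('n::finite, 'r::finite) rmat" and Z :: "('n, 'k::finite) rmat" and X :: "('n, 'p::finite)
      rmat" and D :: "('r, 'r) rmat"
  assumes "full_column_rank (hcat Y (hcat Z X))" "sym_pos_semidef D"
  obtains c where "c > 0" "\<And>A B w. c * (w \<bullet> w + (B *v w) \<bullet> (B *v w)) \<le>
      ((Y - Z ** A - X ** B) *v w) \<bullet> ((Y - Z ** A - X ** B) *v w) + w \<bullet> (D *v w)"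
proof -
  obtain c where c: "c > 0" "\<And>z. c * (z \<bullet> z) \<le> (hcat Y (hcat Z X) *v z) \<bullet> (hcat Y (hcat Z X) *v z)"
    using full_column_rank_lower_bound[OF assms(1)] by blast
  show ?thesis
  proof (rule that[OF c(1)])
    fix A :: "('k, 'r) rmat" and B :: "('p, 'r) rmat" and w
    define z :: "real^('r + 'k + 'p)" where "z = (\<chi> i. case i of Inl i \<Rightarrow> w $ i | Inr j \<Rightarrow> (case j of Inl
        k \<Rightarrow> - ((A *v w) $ k) | Inr l \<Rightarrow> - ((B *v w) $ l)))"
    have z: "(\<chi> i. z $ Inl i) = w" "(\<chi> k. z $ Inr (Inl k)) = - (A *v w)" "(\<chi> l. z $ Inr (Inr l)) = - (B *v w)"
      by (simp_all add: z_def vec_eq_iff)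
    have neg: "Z *v (- v) = - (Z *v v)" "X *v (- v') = - (X *v v')" for v v'
      using matrix_vector_mult_diff_distrib[of Z 0 v] matrix_vector_mult_diff_distrib[of X 0 v'] by simp_all
    have "hcat Y (hcat Z X) *v z = (Y - Z ** A - X ** B) *v w"
      by (simp add: hcat_mult_vec z neg matrix_vector_mult_diff_rdistrib matrix_vector_mul_assoc[symmetric])
    moreover have "z \<bullet> z = w \<bullet> w + ((A *v w) \<bullet> (A *v w) + (B *v w) \<bullet> (B *v w))"
      using inner_sum_type[of z] inner_sum_type[of "\<chi> j. z $ Inr j"] by (simp add: z)
    moreover have "0 \<le> c * ((A *v w) \<bullet> (A *v w))" using c by simp
    moreover have "0 \<le> w \<bullet> (D *v w)" using assms(2) by (simp add: sym_pos_semidef_def)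
    ultimately show "c * (w \<bullet> w + (B *v w) \<bullet> (B *v w))
        \<le> ((Y - Z ** A - X ** B) *v w) \<bullet> ((Y - Z ** A - X ** B) *v w) + w \<bullet> (D *v w)"
      using c(2)[of z] by (simp add: distrib_left)
  qed
qed

section \<open>Geometric ergodicity of the three samplers\<close>

theorem theorem4p3:
  fixes y :: "int \<Rightarrow> ('r::{finite,linorder}) rvec"
    and Y :: "('n::{finite,linorder}, 'r) rmat"
    and Z :: "('n, 'q::{finite,linorder} \<times> 'r) rmat"
    and X :: "('n, 'p::finite) rmat"
    and m :: "('r \<times> 'q \<times> 'r) rvec"
    and C :: "('r \<times> 'q \<times> 'r, 'r \<times> 'q \<times> 'r) rmat"
    and D :: "('r, 'r) rmat"
    and a :: real
    and g :: "('r \<times> 'q \<times> 'r) rvec \<Rightarrow> ('p, 'r) rmat \<Rightarrow> ('r, 'r) rmat \<Rightarrow> real"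
  assumes "CARD('n) > CARD('p)"
    and "Y = response_matrix y" and "Z = lag_matrix y"
    and "sym_pos_semidef C" and "sym_pos_semidef D" and "a \<ge> 0"
    and "g = unnorm_posterior Y Z X m C D a"
    and "sym_pos_def C"
    and "(sym_pos_def D \<and> full_column_rank X \<and>
            real CARD('n) + a > 2 * real CARD('r) + real CARD('p) \<and>
            proper_density (prior_alpha m C)) \<or>
         (full_column_rank (hcat Y (hcat Z X)) \<and>
            real CARD('n) + a > (2 + real CARD('q)) * real CARD('r) + real CARD('p) \<and>
            bounded (range (prior_alpha m C)))"
  shows "geometrically_ergodic lborel_Theta (K_C g) (posterior g)
       \<and> geometrically_ergodic lborel_alpha_Sigma (K_G g) (posterior_alpha_Sigma g)
       \<and> geometrically_ergodic lborel (K_A g) (posterior_alpha g)"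
proof -
  have df: "real CARD('n) + a - real CARD('p) > 2 * real CARD('r)"
  proof -
    have "2 * real CARD('r) \<le> (2 + real CARD('q)) * real CARD('r)" by (intro mult_right_mono) auto
    with assms(9) show ?thesis by (elim disjE conjE) linarith+
  qed
  obtain c B0 where c: "c > 0" and coercive: "\<And>\<alpha> B w. c * (w \<bullet> w + ((B - B0 \<alpha>) *v w) \<bullet> ((B - B0 \<alpha>) *v w)) \<le>
      ((Y - Z ** col_unstack \<alpha> - X ** B) *v w) \<bullet> ((Y - Z ** col_unstack \<alpha> - X ** B) *v w) + w \<bullet> (D *v w)"
  proof (cases "sym_pos_def D \<and> full_column_rank X")
    case True
    then show ?thesis using coercive_full_rank_regressors[of D X "\<lambda>\<alpha>. Y - Z ** col_unstack \<alpha>"] that by metis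
  next
    case False
    then have "full_column_rank (hcat Y (hcat Z X))" using assms(9) by auto
    then obtain c where "c > 0" "\<And>A B w. c * (w \<bullet> w + (B *v w) \<bullet> (B *v w)) \<le>
        ((Y - Z ** A - X ** B) *v w) \<bullet> ((Y - Z ** A - X ** B) *v w) + w \<bullet> (D *v w)"
      using coercive_full_rank_data[OF _ assms(5)] by metis
    then show ?thesis using that[of c "\<lambda>_. 0"] by simp
  qed
  interpret var_posterior Y Z X m C D a c B0
    by unfold_locales (use assms(8) c coercive df in auto)
  show ?thesis unfolding assms(7) using kernels_geometrically_ergodic by blast
qed

end
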